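(* For every $v_h\in K_h^{cr}$ and $y_h\in K_h^{rt,*}$, the discrete primal-dual gap estimator $\eta_{\mathrm{gap},h}^2(v_h,y_h):=I_h^{cr}(v_h)-D_h^{rt}(y_h)$ satisfies $$\eta_{\mathrm{gap},h}^2(v_h,y_h)=\int_\Omega\big\{\phi_h^*(\cdot,\Pi_hy_h)-\Pi_hy_h\cdot\nabla_hv_h+\phi_h(\cdot,\nabla_hv_h)\big\}\,\mathrm{d}x.$$
   Context: Let $\Omega\subseteq\mathbb{R}^d$, $d\in\mathbb{N}$, be a bounded simplicial Lipschitz domain with $\partial\Omega=\overline\Gamma_D\cup\overline\Gamma_N$, $\Gamma_D,\Gamma_N$ disjoint and relatively open, $|\Gamma_D|>0$. $\mathcal{T}_h$ is a (shape-regular, conforming) simplicial triangulation of $\Omega$; $\mathcal{S}_h$ is the set of its sides (($d-1$)-dimensional faces), $\mathcal{S}_h^i$ the interior sides, $\mathcal{S}_h^{\Gamma_D},\mathcal{S}_h^{\Gamma_N}$ the boundary sides whose relative interior lies in $\Gamma_D$, resp. $\Gamma_N$; every boundary side belongs to exactly one of these two sets. $(v,w)_\omega=\int_\omega v\cdot w$; $\|\cdot\|_{p,\omega}$ is the $L^p(\omega)$-norm. $\mathcal{L}^k(\mathcal{T}_h)$ are the element-wise polynomials of degree $\le k$; $\mathcal{L}^0(\mathcal{S}_h^{\gamma})$ the side-wise constant functions on $\mathcal{S}_h^\gamma$. $\Pi_h$ is the $L^2$-projection onto element-wise constants (element averages, component-wise for vector fields), $\pi_h$ the projection onto side-wise constants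 (side averages). $\nabla_h$ is the element-wise gradient. $\mathcal{S}^{1,cr}(\mathcal{T}_h)=\{v_h\in\mathcal{L}^1(\mathcal{T}_h):$ the side average of the jump of $v_h$ vanishes on every interior side$\}$ (Crouzeix–Raviart). $\mathcal{R}T^0(\mathcal{T}_h)=\{y_h\in(\mathcal{L}^1(\mathcal{T}_h))^d: y_h|_T\cdot n_T$ is constant on each side of each $T\in\mathcal{T}_h$ and the normal jump of $y_h$ vanishes on every interior side$\}$ (lowest-order Raviart–Thomas; on each $T$, $y_h(x)=a_T+b_Tx$ with $a_T\in\mathbb{R}^d,b_T\in\mathbb{R}$). $n$ is the outward unit normal on $\partial\Omega$. Data: $f_h\in\mathcal{L}^0(\mathcal{T}_h)$, $g_h\in\mathcal{L}^0(\mathcal{S}_h^{\Gamma_N})$, $\zeta_h\in\mathcal{L}^0(\mathcal{T}_h)$ with $\operatorname{ess\,inf}_\Omega\zeta_h>0$, $u_D^h\in\mathcal{L}^0(\mathcal{S}_h^{\Gamma_D})$ such that there exists $\widehat u_D^h\in\mathcal{S}^{1,cr}(\mathcal{T}_h)$ with $\pi_h\widehat u_D^h=u_D^h$ on $\Gamma_D$ and $\|\nabla_h\widehat u_D^h/\zeta_h\|_{\infty,\Omega}<1$. For a.e. $x$ and $s,t\in\mathbb{R}^d$: $\phi_h(x,t)=\frac12|t|^2$ if $|t|\le\zeta_h(x)$, $+\infty$ otherwise; $\phi_h^*(x,s)=\frac12|s|^2$ if $|s|\le\zeta_h(x)$, $\phi_h^*(x,s)=\zeta_h(x)|s|-\frac12\zeta_h(x)^2$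 if $|s|>\zeta_h(x)$. Discrete primal functional: $K_h^{cr}=\{v_h\in\mathcal{S}^{1,cr}(\mathcal{T}_h):|\nabla_hv_h|\le\zeta_h\text{ a.e. in }\Omega,\ \pi_hv_h=u_D^h\text{ a.e. on }\Gamma_D\}$; $I_h^{cr}(v_h)=\frac12\|\nabla_hv_h\|_{2,\Omega}^2-(f_h,\Pi_hv_h)_\Omega-(g_h,\pi_hv_h)_{\Gamma_N}$ if $v_h\in K_h^{cr}$ and $+\infty$ for other $v_h\in\mathcal{S}^{1,cr}(\mathcal{T}_h)$. Discrete dual functional: $K_h^{rt,*}=\{y_h\in\mathcal{R}T^0(\mathcal{T}_h):\operatorname{div}y_h=-f_h\text{ a.e. in }\Omega,\ y_h\cdot n=g_h\text{ a.e. on }\Gamma_N\}$; $D_h^{rt}(y_h)=-\int_\Omega\phi_h^*(\cdot,\Pi_hy_h)\,\mathrm{d}x+(y_h\cdot n,u_D^h)_{\Gamma_D}$ if $y_h\in K_h^{rt,*}$ and $-\infty$ for other $y_h\in\mathcal{R}T^0(\mathcal{T}_h)$. *)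

theory Defs
  imports "HOL-Analysis.Analysis" "HOL-Probability.Essential_Supremum"
begin

section \<open>Domains and triangulations\<close>

text \<open>Near each boundary point the domain lies on one side of the graph of a Lipschitz function
  over the orthogonal complement of a unit vector \<open>e\<close>; \<open>x - (x \<bullet> e) *\<^sub>R e\<close> is the projection of \<open>x\<close>
  to that complement.\<close>

definition lipschitz_domain :: "'a::euclidean_space set \<Rightarrow> bool" where
  "lipschitz_domain \<Omega> \<longleftrightarrow> open \<Omega> \<and> connected \<Omega> \<and> \<Omega> \<noteq> {} \<and> bounded \<Omega> \<and>
     (\<forall>p\<in>frontier \<Omega>. \<exists>r>0. \<exists>e. \<exists>\<gamma>::'a \<Rightarrow> real. \<exists>L.
        norm e = 1 \<and> L-lipschitz_on UNIV \<gamma> \<and>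
        \<Omega> \<inter> ball p r = {x \<in> ball p r. \<gamma> (x - (x \<bullet> e) *\<^sub>R e) < x \<bullet> e})"

text \<open>The library predicate \<open>triangulation\<close> contains conformity (two members meet in a common
  face); here the members are moreover full-dimensional and cover the closed domain.\<close>

definition triangulation_of :: "'a::euclidean_space set set \<Rightarrow> 'a set \<Rightarrow> bool" where
  "triangulation_of \<T> \<Omega> \<longleftrightarrow>
     triangulation \<T> \<and> (\<forall>T\<in>\<T>. int DIM('a) simplex T) \<and> \<Union>\<T> = closure \<Omega>"

definition simplicial_domain :: "'a::euclidean_space set \<Rightarrow> bool" where
  "simplicial_domain \<Omega> \<longleftrightarrow> (\<exists>\<T>. triangulation_of \<T> \<Omega>)"

definition shape_regular :: "real \<Rightarrow> 'a::euclidean_space set set \<Rightarrow> bool" where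
  "shape_regular \<kappa> \<T> \<longleftrightarrow>
     (\<forall>T\<in>\<T>. diameter T \<le> \<kappa> * Sup {\<rho>. 0 \<le> \<rho> \<and> (\<exists>c. cball c (\<rho> / 2) \<subseteq> T)})"

definition sides :: "'a::euclidean_space set set \<Rightarrow> 'a set set" where
  "sides \<T> = {S. \<exists>T\<in>\<T>. S facet_of T}"

definition interior_sides :: "'a::euclidean_space set set \<Rightarrow> 'a set \<Rightarrow> 'a set set" where
  "interior_sides \<T> \<Omega> = {S \<in> sides \<T>. rel_interior S \<subseteq> \<Omega>}"

definition boundary_sides :: "'a::euclidean_space set set \<Rightarrow> 'a set \<Rightarrow> 'a set set" where
  "boundary_sides \<T> \<Omega> = {S \<in> sides \<T>. S \<subseteq> frontier \<Omega>}"

definition sides_on :: "'a::euclidean_space set set \<Rightarrow> 'a set \<Rightarrow> 'a set \<Rightarrow> 'a set set" where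
  "sides_on \<T> \<Omega> \<Gamma> = {S \<in> boundary_sides \<T> \<Omega>. rel_interior S \<subseteq> \<Gamma>}"

section \<open>Surface measure, normals and traces\<close>

text \<open>The \<open>(d - 1)\<close>-dimensional Lebesgue measure on a hyperplane \<open>H\<close>: the slab of total thickness
  one around \<open>H\<close> is \<open>H \<times> [-1/2, 1/2]\<close> up to an isometry, so by Fubini the push-forward of the
  volume under the orthogonal projection to \<open>H\<close> is the surface measure of \<open>H\<close>. For \<open>d = 1\<close> this
  is the unit mass at the point of \<open>H\<close>.\<close>

definition hyperplane_measure :: "'a::euclidean_space set \<Rightarrow> 'a measure" where
  "hyperplane_measure H =
     completion (distr (restrict_space lborel {x. infdist x H \<le> 1 / 2}) borel (closest_point H))"

abbreviation side_measure :: "'a::euclidean_space set \<Rightarrow> 'a measure" where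
  "side_measure S \<equiv> hyperplane_measure (affine hull S)"

text \<open>Surface measure, integrals and almost-everywhere statements on a subset \<open>\<Gamma>\<close> of \<open>\<partial>\<Omega>\<close>: the
  boundary is the union of the boundary sides, which overlap in null sets only.\<close>

definition boundary_area ::
    "'a::euclidean_space set set \<Rightarrow> 'a set \<Rightarrow> 'a set \<Rightarrow> real" where
  "boundary_area \<T> \<Omega> \<Gamma> = (\<Sum>S\<in>boundary_sides \<T> \<Omega>. measure (side_measure S) (S \<inter> \<Gamma>))"

definition boundary_integral ::
    "'a::euclidean_space set set \<Rightarrow> 'a set \<Rightarrow> 'a set \<Rightarrow> ('a \<Rightarrow> real) \<Rightarrow> real" where
  "boundary_integral \<T> \<Omega> \<Gamma> q =
     (\<Sum>S\<in>boundary_sides \<T> \<Omega>. LINT x : S \<inter> \<Gamma> | side_measure S. q x)"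

definition AE_boundary ::
    "'a::euclidean_space set set \<Rightarrow> 'a set \<Rightarrow> 'a set \<Rightarrow> ('a \<Rightarrow> bool) \<Rightarrow> bool" where
  "AE_boundary \<T> \<Omega> \<Gamma> P \<longleftrightarrow>
     (\<forall>S\<in>boundary_sides \<T> \<Omega>. AE x in side_measure S. x \<in> S \<inter> \<Gamma> \<longrightarrow> P x)"

text \<open>The outward unit normal of \<open>A\<close> at a boundary point \<open>x\<close> where the boundary is flat: near \<open>x\<close>
  the interior of \<open>A\<close> is an open half-ball. It is used for the domain and for its elements, at
  points in the relative interior of a side.\<close>

definition outward_normal :: "'a::euclidean_space set \<Rightarrow> 'a \<Rightarrow> 'a" where
  "outward_normal A x =
     (THE n. norm n = 1 \<and> (\<exists>r>0. \<forall>z\<in>ball x r. z \<in> interior A \<longleftrightarrow> n \<bullet> (z - x) < 0))"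

text \<open>The one-sided limit from the interior of \<open>A\<close>; for an element-wise polynomial and \<open>A\<close> an
  element, this is the value of the polynomial on \<open>A\<close>.\<close>

definition trace_from :: "'a::euclidean_space set \<Rightarrow> ('a \<Rightarrow> 'b::t2_space) \<Rightarrow> 'a \<Rightarrow> 'b" where
  "trace_from A v x = Lim (at x within interior A) v"

definition normal_trace :: "'a::euclidean_space set \<Rightarrow> ('a \<Rightarrow> 'a) \<Rightarrow> 'a \<Rightarrow> real" where
  "normal_trace A y x = trace_from A y x \<bullet> outward_normal A x"

section \<open>Discrete spaces and operators\<close>

text \<open>Discrete functions are functions on the whole space that are constrained only on the
  interiors of the elements (or the relative interiors of the sides); the values elsewhere are
  irrelevant, in accordance with the identification of functions that agree almost everywhere.\<close>

definition L0 :: "'a::euclidean_space set set \<Rightarrow> ('a \<Rightarrow> real) set" where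
  "L0 \<T> = {q. \<forall>T\<in>\<T>. \<exists>c. \<forall>x\<in>interior T. q x = c}"

definition L1 :: "'a::euclidean_space set set \<Rightarrow> ('a \<Rightarrow> real) set" where
  "L1 \<T> = {q. \<forall>T\<in>\<T>. \<exists>c a. \<forall>x\<in>interior T. q x = c + a \<bullet> x}"

definition L0_sides :: "'a::euclidean_space set set \<Rightarrow> ('a \<Rightarrow> real) set" where
  "L0_sides \<S> = {q. \<forall>S\<in>\<S>. \<exists>c. \<forall>x\<in>rel_interior S. q x = c}"

definition element_average ::
    "'a::euclidean_space set \<Rightarrow> ('a \<Rightarrow> 'b::{banach, second_countable_topology}) \<Rightarrow> 'b" where
  "element_average T q = (LINT x : T | lebesgue. q x) /\<^sub>R measure lebesgue T"

definition side_average :: "'a::euclidean_space set \<Rightarrow> ('a \<Rightarrow> real) \<Rightarrow> real" where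
  "side_average S q = (LINT x : S | side_measure S. q x) / measure (side_measure S) S"

definition element_projection ::
    "'a::euclidean_space set set \<Rightarrow> ('a \<Rightarrow> 'b::{banach, second_countable_topology}) \<Rightarrow> 'a \<Rightarrow> 'b" where
  "element_projection \<T> q x = (\<Sum>T\<in>\<T>. indicator (interior T) x *\<^sub>R element_average T q)"

text \<open>The projection to side-wise constants is only needed on the boundary sides, where the
  function to be averaged is the trace from within the domain.\<close>

definition side_projection ::
    "'a::euclidean_space set set \<Rightarrow> 'a set \<Rightarrow> ('a \<Rightarrow> real) \<Rightarrow> 'a \<Rightarrow> real" where
  "side_projection \<T> \<Omega> q x =
     (\<Sum>S\<in>boundary_sides \<T> \<Omega>. indicator (rel_interior S) x * side_average S (trace_from \<Omega> q))"

definition gradient :: "('a::euclidean_space \<Rightarrow> real) \<Rightarrow> 'a \<Rightarrow> 'a" where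
  "gradient v x = (\<Sum>b\<in>Basis. frechet_derivative v (at x) b *\<^sub>R b)"

definition gradient_h ::
    "'a::euclidean_space set set \<Rightarrow> ('a \<Rightarrow> real) \<Rightarrow> 'a \<Rightarrow> 'a" where
  "gradient_h \<T> v x = (\<Sum>T\<in>\<T>. indicator (interior T) x *\<^sub>R gradient v x)"

text \<open>Only used at points of the interiors of the elements, where the functions are smooth.\<close>

definition divergence :: "('a::euclidean_space \<Rightarrow> 'a) \<Rightarrow> 'a \<Rightarrow> real" where
  "divergence y x = (\<Sum>b\<in>Basis. frechet_derivative y (at x) b \<bullet> b)"

definition crouzeix_raviart ::
    "'a::euclidean_space set set \<Rightarrow> 'a set \<Rightarrow> ('a \<Rightarrow> real) set" where
  "crouzeix_raviart \<T> \<Omega> = {v \<in> L1 \<T>.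
     \<forall>S\<in>interior_sides \<T> \<Omega>. \<forall>T\<in>\<T>. \<forall>T'\<in>\<T>. T \<noteq> T' \<and> S facet_of T \<and> S facet_of T' \<longrightarrow>
       side_average S (\<lambda>x. trace_from T v x - trace_from T' v x) = 0}"

text \<open>The outward normals of the two elements at a common side are opposite, so the sum of the
  two normal traces is the jump of the normal component.\<close>

definition raviart_thomas ::
    "'a::euclidean_space set set \<Rightarrow> 'a set \<Rightarrow> ('a \<Rightarrow> 'a) set" where
  "raviart_thomas \<T> \<Omega> = {y. (\<forall>b\<in>Basis. (\<lambda>x. y x \<bullet> b) \<in> L1 \<T>) \<and>
     (\<forall>T\<in>\<T>. \<forall>S. S facet_of T \<longrightarrow> (\<exists>c. \<forall>x\<in>rel_interior S. normal_trace T y x = c)) \<and>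
     (\<forall>S\<in>interior_sides \<T> \<Omega>. \<forall>T\<in>\<T>. \<forall>T'\<in>\<T>. T \<noteq> T' \<and> S facet_of T \<and> S facet_of T' \<longrightarrow>
       (\<forall>x\<in>rel_interior S. normal_trace T y x + normal_trace T' y x = 0))}"

section \<open>Primal and dual functionals\<close>

definition essinf :: "'a measure \<Rightarrow> ('a \<Rightarrow> real) \<Rightarrow> ereal" where
  "essinf M q = - esssup M (\<lambda>x. - ereal (q x))"

definition Linf_norm :: "'a measure \<Rightarrow> ('a \<Rightarrow> 'b::real_normed_vector) \<Rightarrow> ereal" where
  "Linf_norm M q = esssup M (\<lambda>x. ereal (norm (q x)))"

definition \<phi>\<^sub>h :: "('a \<Rightarrow> real) \<Rightarrow> 'a \<Rightarrow> 'a::euclidean_space \<Rightarrow> ereal" where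
  "\<phi>\<^sub>h \<zeta> x t = (if norm t \<le> \<zeta> x then ereal (1 / 2 * (norm t)\<^sup>2) else \<infinity>)"

definition \<phi>\<^sub>h_star :: "('a \<Rightarrow> real) \<Rightarrow> 'a \<Rightarrow> 'a::euclidean_space \<Rightarrow> real" where
  "\<phi>\<^sub>h_star \<zeta> x s =
     (if norm s \<le> \<zeta> x then 1 / 2 * (norm s)\<^sup>2 else \<zeta> x * norm s - 1 / 2 * (\<zeta> x)\<^sup>2)"

text \<open>The Lebesgue integral of an extended real-valued function, as the difference of the
  integrals of its positive and negative parts (\<open>e2ennreal\<close> maps negative numbers to \<open>0\<close>).\<close>

definition ereal_integral :: "'a measure \<Rightarrow> ('a \<Rightarrow> ereal) \<Rightarrow> ereal" where
  "ereal_integral M q =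
     enn2ereal (\<integral>\<^sup>+ x. e2ennreal (q x) \<partial>M) - enn2ereal (\<integral>\<^sup>+ x. e2ennreal (- q x) \<partial>M)"

definition K_cr ::
    "'a::euclidean_space set set \<Rightarrow> 'a set \<Rightarrow> 'a set \<Rightarrow> ('a \<Rightarrow> real) \<Rightarrow> ('a \<Rightarrow> real)
      \<Rightarrow> ('a \<Rightarrow> real) set" where
  "K_cr \<T> \<Omega> \<Gamma>\<^sub>D \<zeta> u\<^sub>D = {v \<in> crouzeix_raviart \<T> \<Omega>.
     (AE x in lebesgue_on \<Omega>. norm (gradient_h \<T> v x) \<le> \<zeta> x) \<and>
     AE_boundary \<T> \<Omega> \<Gamma>\<^sub>D (\<lambda>x. side_projection \<T> \<Omega> v x = u\<^sub>D x)}"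

definition I_cr ::
    "'a::euclidean_space set set \<Rightarrow> 'a set \<Rightarrow> 'a set \<Rightarrow> 'a set
      \<Rightarrow> ('a \<Rightarrow> real) \<Rightarrow> ('a \<Rightarrow> real) \<Rightarrow> ('a \<Rightarrow> real) \<Rightarrow> ('a \<Rightarrow> real)
      \<Rightarrow> ('a \<Rightarrow> real) \<Rightarrow> ereal" where
  "I_cr \<T> \<Omega> \<Gamma>\<^sub>D \<Gamma>\<^sub>N f g \<zeta> u\<^sub>D v =
     (if v \<in> K_cr \<T> \<Omega> \<Gamma>\<^sub>D \<zeta> u\<^sub>D
      then ereal (1 / 2 * (LINT x | lebesgue_on \<Omega>. (norm (gradient_h \<T> v x))\<^sup>2)
                  - (LINT x | lebesgue_on \<Omega>. f x * element_projection \<T> v x)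
                  - boundary_integral \<T> \<Omega> \<Gamma>\<^sub>N (\<lambda>x. g x * side_projection \<T> \<Omega> v x))
      else \<infinity>)"

definition K_rt ::
    "'a::euclidean_space set set \<Rightarrow> 'a set \<Rightarrow> 'a set \<Rightarrow> ('a \<Rightarrow> real) \<Rightarrow> ('a \<Rightarrow> real)
      \<Rightarrow> ('a \<Rightarrow> 'a) set" where
  "K_rt \<T> \<Omega> \<Gamma>\<^sub>N f g = {y \<in> raviart_thomas \<T> \<Omega>.
     (AE x in lebesgue_on \<Omega>. divergence y x = - f x) \<and>
     AE_boundary \<T> \<Omega> \<Gamma>\<^sub>N (\<lambda>x. normal_trace \<Omega> y x = g x)}"

definition D_rt ::
    "'a::euclidean_space set set \<Rightarrow> 'a set \<Rightarrow> 'a set \<Rightarrow> 'a set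
      \<Rightarrow> ('a \<Rightarrow> real) \<Rightarrow> ('a \<Rightarrow> real) \<Rightarrow> ('a \<Rightarrow> real) \<Rightarrow> ('a \<Rightarrow> real)
      \<Rightarrow> ('a \<Rightarrow> 'a) \<Rightarrow> ereal" where
  "D_rt \<T> \<Omega> \<Gamma>\<^sub>D \<Gamma>\<^sub>N f g \<zeta> u\<^sub>D y =
     (if y \<in> K_rt \<T> \<Omega> \<Gamma>\<^sub>N f g
      then ereal (- (LINT x | lebesgue_on \<Omega>. \<phi>\<^sub>h_star \<zeta> x (element_projection \<T> y x))
                  + boundary_integral \<T> \<Omega> \<Gamma>\<^sub>D (\<lambda>x. normal_trace \<Omega> y x * u\<^sub>D x))
      else -\<infinity>)"

definition gap_estimator_squared ::
    "'a::euclidean_space set set \<Rightarrow> 'a set \<Rightarrow> 'a set \<Rightarrow> 'a set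
      \<Rightarrow> ('a \<Rightarrow> real) \<Rightarrow> ('a \<Rightarrow> real) \<Rightarrow> ('a \<Rightarrow> real) \<Rightarrow> ('a \<Rightarrow> real)
      \<Rightarrow> ('a \<Rightarrow> real) \<Rightarrow> ('a \<Rightarrow> 'a) \<Rightarrow> ereal" where
  "gap_estimator_squared \<T> \<Omega> \<Gamma>\<^sub>D \<Gamma>\<^sub>N f g \<zeta> u\<^sub>D v y =
     I_cr \<T> \<Omega> \<Gamma>\<^sub>D \<Gamma>\<^sub>N f g \<zeta> u\<^sub>D v - D_rt \<T> \<Omega> \<Gamma>\<^sub>D \<Gamma>\<^sub>N f g \<zeta> u\<^sub>D y"

end

theory Submission
  imports Defs
begin

text \<open>
  The estimator is the difference of two finite numbers. Inserting \<open>f = - div y\<close>, \<open>g = y \<bullet> n\<close> on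
  \<open>\<Gamma>\<^sub>N\<close> and \<open>u\<^sub>D = \<pi>\<^sub>h v\<close> on \<open>\<Gamma>\<^sub>D\<close> turns the load and boundary terms into
  \<open>(div y, \<Pi>\<^sub>h v)\<close> minus the integral of \<open>(y \<bullet> n) \<pi>\<^sub>h v\<close> over \<open>\<partial>\<Omega>\<close>, and this is
  \<open>- (\<Pi>\<^sub>h y, \<nabla>\<^sub>h v)\<close> by the discrete integration by parts formula
  \<open>discrete_integration_by_parts\<close>. What remains is the integral of
  \<open>\<phi>\<^sub>h\<^sup>* (\<Pi>\<^sub>h y) - \<Pi>\<^sub>h y \<bullet> \<nabla>\<^sub>h v + |\<nabla>\<^sub>h v|\<^sup>2 / 2\<close>, where the last term is \<open>\<phi>\<^sub>h (\<nabla>\<^sub>h v)\<close> because \<open>v\<close>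
  satisfies the gradient constraint.

  Integration by parts is Green's identity for \<open>v y\<close> on each element (\<open>green_identity_element\<close>),
  summed over the elements. As the normal component of \<open>y\<close> is constant on every side, only the side
  averages of \<open>v\<close> enter. On a side shared by two elements these averages agree and the normal
  components are opposite, so the two contributions cancel. The other sides are exactly the
  boundary sides: elements intersect in common faces and \<open>\<Omega>\<close> is the interior of its closure,
  which holds for Lipschitz domains but not for domains with slits.

  On a simplex with vertices \<open>C\<close> everything is expressed by the gradients \<open>grad u\<close> of the barycentric
  coordinates. The outward normal of the facet opposite \<open>u\<close> is \<open>- grad u / |grad u|\<close>, the averages of
  an affine function over the simplex and over a facet are the means of its vertex values, and the
  area of the facet is \<open>d |grad u| |T|\<close> in dimension \<open>d\<close>. Green's identity becomes the algebraic
  identity \<open>constant_normal_component_identity\<close>.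

  Averages and areas are computed from volumes alone, because the surface measure is the volume of a
  prism of thickness one. A reflection that swaps two vertices shows that all barycentric
  coordinates have the same integral, and the prism over a facet is a stack of \<open>d\<close> wedges, each of
  which is, up to a shear, an affine image of the simplex with Jacobian \<open>|grad u|\<close>. All these maps
  have the form \<open>x + (\<alpha> + g \<bullet> x) r\<close>, whose Jacobian is \<open>|1 + g \<bullet> r|\<close>.
\<close>

section \<open>Volume under affine maps of rank one\<close>

lemma linear_rank_one_update: "linear (\<lambda>x. x + (g \<bullet> x) *\<^sub>R r)"
  by (rule linearI) (simp_all add: inner_add_right scaleR_left_distrib scaleR_right_distrib)

text \<open>An isometry takes \<open>g\<close> to a multiple of a standard basis vector. The matrix then differs from the
  identity in one column only, and Cramer's lemma evaluates its determinant.\<close>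

lemma det_rank_one_update:
  fixes g r :: "real ^ 'n"
  shows "det (matrix (\<lambda>x. x + (g \<bullet> x) *\<^sub>R r)) = 1 + g \<bullet> r"
proof -
  have axis: "det (matrix (\<lambda>x. x + (c *\<^sub>R axis k 1 \<bullet> x) *\<^sub>R s)) = 1 + c *\<^sub>R axis k 1 \<bullet> s"
    for k :: 'n and c :: real and s :: "real ^ 'n"
  proof -
    have "matrix (\<lambda>x. x + (c *\<^sub>R axis k 1 \<bullet> x) *\<^sub>R s) =
        (\<chi> i j. if j = k then (axis k 1 + c *\<^sub>R s) $ i else mat 1 $ i $ j)" (is "_ = ?M")
    proof -
      have "matrix (\<lambda>x. x + (c *\<^sub>R axis k 1 \<bullet> x) *\<^sub>R s) $ i $ j = ?M $ i $ j" for i j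
        by (simp add: matrix_def inner_axis_axis mat_def) (simp add: axis_def)
      then show ?thesis by (simp only: vec_eq_iff) simp
    qed
    also have "\<dots> = (\<chi> i j. if j = k then (mat 1 *v (axis k 1 + c *\<^sub>R s)) $ i else mat 1 $ i $ j)"
      by (simp only: matrix_vector_mul_lid)
    finally show ?thesis
      by (simp only: cramer_lemma) (simp add: inner_axis')
  qed
  obtain k :: 'n where True by simp
  obtain f :: "real ^ 'n \<Rightarrow> real ^ 'n"
    where f: "orthogonal_transformation f" "f g = norm g *\<^sub>R axis k 1"
    by (rule orthogonal_transformation_exists[of g "norm g *\<^sub>R axis k 1"]) auto
  let ?L = "\<lambda>x. x + (g \<bullet> x) *\<^sub>R r" and ?L' = "\<lambda>x. x + (f g \<bullet> x) *\<^sub>R f r"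
  have linf: "linear f" using f(1) by (rule orthogonal_transformation_linear)
  have lin: "linear ?L" "linear ?L'"
    by (rule linear_rank_one_update)+
  have inner: "f x \<bullet> f y = x \<bullet> y" for x y
    using f(1) by (simp add: orthogonal_transformation_def)
  have "f \<circ> ?L = ?L' \<circ> f"
    by (rule ext) (simp add: linear_add[OF linf] linear_scale[OF linf] inner)
  then have "matrix f ** matrix ?L = matrix ?L' ** matrix f"
    by (simp only: matrix_compose[OF lin(1) linf, symmetric] matrix_compose[OF linf lin(2), symmetric])
  then have "det (matrix f) * det (matrix ?L) = det (matrix ?L') * det (matrix f)"
    unfolding det_mul[symmetric] by (rule arg_cong)
  moreover have "det (matrix f) \<noteq> 0"
    using orthogonal_transformation_det[OF f(1)] by auto
  moreover have "det (matrix ?L') = 1 + f g \<bullet> f r"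
    unfolding f(2) by (rule axis)
  ultimately show ?thesis
    unfolding inner by simp
qed

text \<open>The determinant formula for the volume of a linear image rests on elimination, which takes the
  coordinates in some order. A copy of the index type with a well-order serves this purpose: the
  relabelling \<open>reindex\<close> of coordinates is an isometry that preserves Lebesgue measure, and results
  transfer along it to an arbitrary finite index type.\<close>

typedef 'a ordered_copy = "UNIV :: 'a set" by simp

lemma bij_Rep_ordered_copy: "bij Rep_ordered_copy"
  by (metis Abs_ordered_copy_inverse Rep_ordered_copy_inverse UNIV_I bij_def injI surjI)

instance ordered_copy :: (finite) finite
proof
  have "finite (Rep_ordered_copy -` (UNIV :: 'a set))"
    by (rule finite_vimageI) (simp_all add: bij_is_inj[OF bij_Rep_ordered_copy])
  then show "finite (UNIV :: 'a ordered_copy set)"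
    by simp
qed

instantiation ordered_copy :: (finite) wellorder
begin

definition less_eq_ordered_copy :: "'a ordered_copy \<Rightarrow> 'a ordered_copy \<Rightarrow> bool" where
  "less_eq_ordered_copy i j \<longleftrightarrow> to_nat (Rep_ordered_copy i) \<le> to_nat (Rep_ordered_copy j)"

definition less_ordered_copy :: "'a ordered_copy \<Rightarrow> 'a ordered_copy \<Rightarrow> bool" where
  "less_ordered_copy i j \<longleftrightarrow> to_nat (Rep_ordered_copy i) < to_nat (Rep_ordered_copy j)"

instance
proof
  fix P :: "'a ordered_copy \<Rightarrow> bool" and i
  assume step: "\<And>i. (\<And>j. j < i \<Longrightarrow> P j) \<Longrightarrow> P i"
  show "P i"
  proof (rule measure_induct_rule[where f = "\<lambda>i. to_nat (Rep_ordered_copy i)" and P = P])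
    fix i :: "'a ordered_copy"
    assume "\<And>j. to_nat (Rep_ordered_copy j) < to_nat (Rep_ordered_copy i) \<Longrightarrow> P j"
    then show "P i"
      by (rule step) (simp add: less_ordered_copy_def)
  qed
qed (auto simp: less_eq_ordered_copy_def less_ordered_copy_def Rep_ordered_copy_inject)

end

definition reindex :: "real ^ 'n \<Rightarrow> real ^ 'n ordered_copy" where
  "reindex x = (\<chi> i. x $ Rep_ordered_copy i)"

definition unindex :: "real ^ 'n ordered_copy \<Rightarrow> real ^ 'n" where
  "unindex x = (\<chi> i. x $ Abs_ordered_copy i)"

lemma reindex_inverse [simp]: "unindex (reindex x) = x" "reindex (unindex y) = y"
  by (auto simp: reindex_def unindex_def vec_eq_iff Rep_ordered_copy_inverse
      Abs_ordered_copy_inverse)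

lemma linear_reindex: "linear reindex" "linear unindex"
  by (auto intro!: linearI simp: reindex_def unindex_def vec_eq_iff)

lemma inner_reindex [simp]: "reindex x \<bullet> reindex y = x \<bullet> y"
  unfolding inner_vec_def reindex_def
  by (simp add: sum.reindex_bij_betw[OF bij_Rep_ordered_copy, of "\<lambda>i. x $ i * y $ i"])

lemma axis_Basis_cases:
  assumes "b \<in> (Basis :: (real ^ 'n) set)"
  obtains i where "b = axis i 1"
  using assms by (auto simp: Basis_vec_def)

lemma prod_inner_Basis_vec: "(\<Prod>b\<in>Basis. (x :: real ^ 'n) \<bullet> b) = (\<Prod>i\<in>UNIV. x $ i)"
proof -
  have Basis: "Basis = range (\<lambda>i :: 'n. axis i (1 :: real))"
    by (auto simp: Basis_vec_def)
  have "inj (\<lambda>i :: 'n. axis i (1 :: real))"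
    by (simp add: inj_on_def axis_eq_axis)
  then show ?thesis
    unfolding Basis by (subst prod.reindex) (simp_all add: inner_axis)
qed

lemma distr_reindex: "distr lborel lborel reindex = (lborel :: (real ^ 'n::finite ordered_copy) measure)"
proof (rule lborel_eqI[symmetric])
  fix l u :: "real ^ 'n ordered_copy"
  assume lu: "\<And>b. b \<in> Basis \<Longrightarrow> l \<bullet> b \<le> u \<bullet> b"
  have all_copy: "(\<forall>j. Q j) \<longleftrightarrow> (\<forall>i. Q (Rep_ordered_copy i))" for Q :: "'n \<Rightarrow> bool"
    using bij_is_surj[OF bij_Rep_ordered_copy] by (metis surj_def)
  have "reindex -` box l u = box (unindex l) (unindex u)"
    by (rule set_eqI)
      (simp add: mem_box_cart all_copy reindex_def unindex_def Rep_ordered_copy_inverse)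
  moreover have "reindex \<in> borel_measurable borel"
    by (intro borel_measurable_continuous_onI linear_continuous_on
        linear_conv_bounded_linear[THEN iffD1] linear_reindex)
  moreover have "(\<Prod>b\<in>Basis. (unindex u - unindex l) \<bullet> b) = (\<Prod>b\<in>Basis. (u - l) \<bullet> b)"
    using prod.reindex_bij_betw[OF bij_Rep_ordered_copy, of "\<lambda>i. (unindex u - unindex l) $ i"]
    by (simp add: prod_inner_Basis_vec unindex_def Rep_ordered_copy_inverse)
  moreover have "unindex l \<bullet> b \<le> unindex u \<bullet> b" if basis: "b \<in> Basis" for b
  proof -
    obtain i where b: "b = axis i 1"
      using basis by (rule axis_Basis_cases)
    have "axis (Abs_ordered_copy i) (1 :: real) \<in> Basis"
      by (auto simp: Basis_vec_def)
    from lu[OF this] show ?thesis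
      by (simp add: b inner_axis unindex_def)
  qed
  ultimately show "emeasure (distr lborel lborel reindex) (box l u) = (\<Prod>b\<in>Basis. (u - l) \<bullet> b)"
    by (subst emeasure_distr) auto
qed simp

lemma measure_reindex_compact:
  fixes K :: "(real ^ 'n) set"
  assumes "compact K"
  shows "measure lebesgue (reindex ` K) = measure lebesgue K"
proof -
  have meas: "reindex \<in> borel_measurable (borel :: (real ^ 'n) measure)"
    by (intro borel_measurable_continuous_onI linear_continuous_on
        linear_conv_bounded_linear[THEN iffD1] linear_reindex)
  have "continuous_on K reindex"
    by (intro linear_continuous_on linear_conv_bounded_linear[THEN iffD1] linear_reindex)
  then have "compact (reindex ` K)"
    using assms by (rule compact_continuous_image)
  then have sets: "K \<in> sets borel" "reindex ` K \<in> sets borel"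
    using assms by (blast intro: borel_compact)+
  have "inj (reindex :: real ^ 'n \<Rightarrow> _)"
    by (rule inj_on_inverseI[of _ unindex]) (rule reindex_inverse)
  then have vimage: "reindex -` reindex ` K \<inter> space lborel = K"
    by (simp add: inj_vimage_image_eq)
  have "emeasure (distr lborel lborel reindex) (reindex ` K) =
      emeasure lborel (reindex -` reindex ` K \<inter> space lborel)"
    using meas sets by (intro emeasure_distr) simp_all
  then have "emeasure lborel (reindex ` K) = emeasure lborel K"
    unfolding vimage distr_reindex .
  then show ?thesis
    using sets by (simp add: measure_def)
qed

text \<open>The maps of this form used below are shears (\<open>g \<bullet> r = 0\<close>), reflections that swap two vertices
  (\<open>g \<bullet> r = - 2\<close>), and maps that move one vertex of a simplex and fix the opposite facet.\<close>

lemma measure_rank_one_update: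
  fixes g r :: "real ^ 'n"
  assumes S: "S \<in> lmeasurable"
  shows "(\<lambda>x. x + (\<alpha> + g \<bullet> x) *\<^sub>R r) ` S \<in> lmeasurable" (is "?A ` S \<in> _")
    and "measure lebesgue ((\<lambda>x. x + (\<alpha> + g \<bullet> x) *\<^sub>R r) ` S) = \<bar>1 + g \<bullet> r\<bar> * measure lebesgue S"
proof -
  let ?L = "\<lambda>x. x + (g \<bullet> x) *\<^sub>R r" and ?L' = "\<lambda>x. x + (reindex g \<bullet> x) *\<^sub>R reindex r"
  have lin: "linear ?L" "linear ?L'"
    by (rule linear_rank_one_update)+
  have "?L ` S \<in> lmeasurable \<and> \<bar>1 + g \<bullet> r\<bar> * measure lebesgue S = measure lebesgue (?L ` S)"
  proof (rule measure_linear_sufficient[OF lin(1) S])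
    fix a b :: "real ^ 'n"
    have cont: "continuous_on (cbox a b) ?L" "continuous_on (cbox a b) reindex"
      by (intro linear_continuous_on linear_conv_bounded_linear[THEN iffD1] lin linear_reindex)+
    have compact: "compact (?L ` cbox a b)" "compact (reindex ` cbox a b)"
      by (rule compact_continuous_image[OF cont(1) compact_cbox]
          compact_continuous_image[OF cont(2) compact_cbox])+
    have eq: "reindex ` ?L ` cbox a b = ?L' ` reindex ` cbox a b"
      unfolding image_image
      by (intro image_cong refl)
        (simp add: linear_add[OF linear_reindex(1)] linear_scale[OF linear_reindex(1)])
    have "measure lebesgue (?L ` cbox a b) = measure lebesgue (?L' ` reindex ` cbox a b)"
      unfolding eq[symmetric] by (rule measure_reindex_compact[OF compact(1), symmetric])
    also have "\<dots> = \<bar>det (matrix ?L')\<bar> * measure lebesgue (reindex ` cbox a b)"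
      using compact by (intro measure_linear_image lin lmeasurable_compact)
    also have "\<dots> = \<bar>1 + g \<bullet> r\<bar> * measure lebesgue (cbox a b)"
      by (simp only: det_rank_one_update inner_reindex measure_reindex_compact[OF compact_cbox])
    finally show "measure lebesgue (?L ` cbox a b) = \<bar>1 + g \<bullet> r\<bar> * measure lebesgue (cbox a b)" .
  qed
  note L = this
  have A: "?A ` S = (+) (\<alpha> *\<^sub>R r) ` ?L ` S"
    unfolding image_image by (intro image_cong refl) (simp add: scaleR_add_left)
  show "?A ` S \<in> lmeasurable"
    unfolding A by (rule measurable_translation) (rule L[THEN conjunct1])
  show "measure lebesgue (?A ` S) = \<bar>1 + g \<bullet> r\<bar> * measure lebesgue S"
    unfolding A measure_translation by (rule L[THEN conjunct2, symmetric])
qed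

text \<open>The map \<open>x + (\<alpha> + g \<bullet> x) r\<close> is then a volume-preserving involution, and it changes the sign of
  the integrand.\<close>

lemma integral_eq_0_if_reflection_invariant:
  fixes g r :: "real ^ 'n"
  assumes gr: "g \<bullet> r = - 2"
    and W: "W \<in> sets borel"
    and invariant: "\<And>x. x \<in> W \<Longrightarrow> x + (\<alpha> + g \<bullet> x) *\<^sub>R r \<in> W"
  shows "(LINT x : W | lborel. \<alpha> + g \<bullet> x) = 0"
proof -
  define \<sigma> where "\<sigma> x = x + (\<alpha> + g \<bullet> x) *\<^sub>R r" for x
  have \<phi>\<sigma>: "\<alpha> + g \<bullet> \<sigma> x = - (\<alpha> + g \<bullet> x)" for x
    by (simp add: \<sigma>_def gr inner_add_right)
  have \<sigma>\<sigma>: "\<sigma> (\<sigma> x) = x" for x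
    unfolding \<sigma>_def[of "\<sigma> x"] \<phi>\<sigma> by (simp add: \<sigma>_def scaleR_add_left scaleR_diff_left)
  have "continuous_on UNIV \<sigma>"
    unfolding \<sigma>_def by (intro continuous_intros)
  then have meas: "\<sigma> \<in> borel_measurable borel"
    by (rule borel_measurable_continuous_onI)
  have distr: "distr lborel lborel \<sigma> = lborel"
  proof (rule lborel_eqI[symmetric])
    fix l u :: "real ^ 'n"
    assume lu: "\<And>b. b \<in> Basis \<Longrightarrow> l \<bullet> b \<le> u \<bullet> b"
    have eq: "\<sigma> -` box l u = \<sigma> ` box l u"
    proof (intro set_eqI iffI)
      fix x assume "x \<in> \<sigma> -` box l u"
      then show "x \<in> \<sigma> ` box l u"
        using \<sigma>\<sigma>[of x, symmetric] by (simp add: image_iff) blast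
    qed (auto simp: \<sigma>\<sigma>)
    have sets: "\<sigma> -` box l u \<in> sets borel"
      using measurable_sets[OF meas, of "box l u"] by simp
    have "box l u \<in> lmeasurable"
      by simp
    note * = measure_rank_one_update[OF this, of \<alpha> g r, folded \<sigma>_def]
    have "emeasure (distr lborel lborel \<sigma>) (box l u) = emeasure lborel (\<sigma> -` box l u)"
      using meas by (subst emeasure_distr) auto
    also have "\<dots> = emeasure lebesgue (\<sigma> ` box l u)"
      using sets by (simp flip: eq)
    also have "\<dots> = emeasure lebesgue (box l u)"
      unfolding emeasure_eq_measure2[OF *(1)] emeasure_eq_measure2[OF \<open>box l u \<in> lmeasurable\<close>]
        *(2) gr by simp
    also have "\<dots> = (\<Prod>b\<in>Basis. (u - l) \<bullet> b)"
      using lu by simp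
    finally show "emeasure (distr lborel lborel \<sigma>) (box l u) = (\<Prod>b\<in>Basis. (u - l) \<bullet> b)" .
  qed simp
  have "\<sigma> x \<in> W \<longleftrightarrow> x \<in> W" for x
    using invariant[of x] invariant[of "\<sigma> x"] \<sigma>\<sigma>[of x] unfolding \<sigma>_def by auto
  then have W\<sigma>: "indicator W (\<sigma> x) = (indicator W x :: real)" for x
    by (simp add: indicator_def)
  have "integral\<^sup>L (distr lborel lborel \<sigma>) (\<lambda>x. indicator W x *\<^sub>R (\<alpha> + g \<bullet> x)) =
      (\<integral>x. indicator W (\<sigma> x) *\<^sub>R (\<alpha> + g \<bullet> \<sigma> x) \<partial>lborel)"
    using meas W by (intro integral_distr borel_measurable_continuous_onI continuous_intros
        borel_measurable_scaleR borel_measurable_indicator) simp_all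
  then have "(LINT x : W | lborel. \<alpha> + g \<bullet> x) = - (LINT x : W | lborel. \<alpha> + g \<bullet> x)"
    unfolding set_lebesgue_integral_def distr W\<sigma> \<phi>\<sigma> scaleR_minus_right integral_minus .
  then show ?thesis by simp
qed

section \<open>Barycentric coordinates\<close>

locale full_simplex =
  fixes C :: "(real ^ 'n) set"
  assumes indep: "\<not> affine_dependent C"
    and card_C: "card C = CARD('n) + 1"
begin

lemma finite_C: "finite C"
  using card_C by (intro card_ge_0_finite) simp

lemma card_C_diff: "u \<in> C \<Longrightarrow> card (C - {u}) = CARD('n)"
  using card_C by simp

lemma C_nonempty: "C \<noteq> {}"
  using card_C by auto

lemma facet_vertices_nonempty: "u \<in> C \<Longrightarrow> C - {u} \<noteq> {}"
  by (metis card_C_diff card.empty zero_less_card_finite less_irrefl)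

lemma ex_barycentric_gradient:
  assumes u: "u \<in> C"
  shows "\<exists>g. \<forall>w\<in>C - {u}. g \<bullet> (u - w) = 1"
proof -
  have "\<not> affine_dependent (C - {u})"
    using indep affine_independent_subset by blast
  then have "aff_dim (C - {u}) = DIM(real ^ 'n) - 1"
    using card_C_diff[OF u] aff_dim_affine_independent[of "C - {u}"] by simp
  then obtain a b where ab: "a \<noteq> 0" "affine hull (C - {u}) = {x. a \<bullet> x = b}"
    using aff_dim_eq_hyperplane by blast
  have w: "a \<bullet> w = b" if "w \<in> C - {u}" for w
    using ab(2) hull_inc[OF that, of affine] by auto
  have "u \<notin> affine hull (C - {u})"
    using indep u by (auto simp: affine_dependent_def)
  then have "a \<bullet> u - b \<noteq> 0"
    using ab by auto
  then have "\<forall>w\<in>C - {u}. (a /\<^sub>R (a \<bullet> u - b)) \<bullet> (u - w) = 1"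
    using w by (auto simp: inner_diff_right simp flip: right_diff_distrib)
  then show ?thesis by blast
qed

text \<open>The gradient of the affine function that is \<open>1\<close> at \<open>u\<close> and \<open>0\<close> at the other vertices.\<close>

definition grad :: "real ^ 'n \<Rightarrow> real ^ 'n" where
  "grad u = (SOME g. \<forall>w\<in>C - {u}. g \<bullet> (u - w) = 1)"

definition bary :: "real ^ 'n \<Rightarrow> real ^ 'n \<Rightarrow> real" where
  "bary u x = 1 + grad u \<bullet> (x - u)"

lemma bary_vertex:
  assumes "u \<in> C" "w \<in> C"
  shows "bary u w = of_bool (w = u)"
proof (cases "w = u")
  case False
  then have "grad u \<bullet> (u - w) = 1"
    using someI_ex[OF ex_barycentric_gradient[OF assms(1)]] assms(2) by (auto simp: grad_def)
  then show ?thesis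
    using False by (simp add: bary_def inner_diff_right)
qed (simp add: bary_def)

lemma bary_add: "bary u (x + y) = bary u x + grad u \<bullet> y"
  by (simp add: bary_def inner_diff_right inner_add_right)

lemma bary_diff: "bary u x - bary u y = grad u \<bullet> (x - y)"
  by (simp add: bary_def inner_diff_right)

lemma grad_vertex_diff:
  "u \<in> C \<Longrightarrow> w \<in> C \<Longrightarrow> w' \<in> C \<Longrightarrow> grad u \<bullet> (w - w') = of_bool (w = u) - of_bool (w' = u)"
  using bary_diff[of u w w'] by (simp add: bary_vertex)

lemma continuous_on_bary [continuous_intros]: "continuous_on A (bary u)"
  unfolding bary_def by (intro continuous_intros)

lemma eq_0_if_orthogonal_to_edges:
  assumes "\<And>w w'. w \<in> C \<Longrightarrow> w' \<in> C \<Longrightarrow> a \<bullet> (w - w') = 0"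
  shows "a = 0"
proof (rule ccontr)
  assume a: "a \<noteq> 0"
  obtain w where w: "w \<in> C"
    using C_nonempty by blast
  have "a \<bullet> x = a \<bullet> w" if "x \<in> C" for x
    using assms[OF that w] by (simp add: inner_diff_right)
  then have "C \<subseteq> {x. a \<bullet> x = a \<bullet> w}"
    by blast
  then have "aff_dim C \<le> aff_dim {x. a \<bullet> x = a \<bullet> w}"
    by (rule aff_dim_subset)
  then show False
    using a card_C aff_dim_affine_independent[OF indep] by simp
qed

text \<open>The affine function with gradient \<open>a\<close> is the combination of the barycentric coordinates with its
  vertex values as coefficients.\<close>

lemma gradient_expansion: "(\<Sum>u\<in>C. (a \<bullet> u) *\<^sub>R grad u) = a"
proof -
  have "((\<Sum>u\<in>C. (a \<bullet> u) *\<^sub>R grad u) - a) \<bullet> (w - w') = 0" if w: "w \<in> C" "w' \<in> C" for w w'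
  proof -
    have "(\<Sum>u\<in>C. (a \<bullet> u) *\<^sub>R grad u) \<bullet> (w - w') =
        (\<Sum>u\<in>C. (a \<bullet> u) * of_bool (w = u) - (a \<bullet> u) * of_bool (w' = u))"
      using w by (simp add: inner_sum_left grad_vertex_diff right_diff_distrib)
    also have "\<dots> = a \<bullet> w - a \<bullet> w'"
      using w finite_C by (simp add: sum_subtractf of_bool_def if_distrib[of "(*) _"] cong: if_cong)
    finally show ?thesis
      by (simp add: inner_diff_left inner_diff_right)
  qed
  then have "(\<Sum>u\<in>C. (a \<bullet> u) *\<^sub>R grad u) - a = 0"
    by (rule eq_0_if_orthogonal_to_edges)
  then show ?thesis by simp
qed

lemma sum_grad: "(\<Sum>u\<in>C. grad u) = 0"
proof (rule eq_0_if_orthogonal_to_edges)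
  fix w w' assume w: "w \<in> C" "w' \<in> C"
  then have "(\<Sum>u\<in>C. grad u) \<bullet> (w - w') = (\<Sum>u\<in>C. of_bool (w = u) - of_bool (w' = u))"
    by (simp add: inner_sum_left grad_vertex_diff)
  also have "\<dots> = 0"
    using w finite_C by (simp add: sum_subtractf of_bool_def)
  finally show "(\<Sum>u\<in>C. grad u) \<bullet> (w - w') = 0" .
qed

lemma sum_bary: "(\<Sum>u\<in>C. bary u x) = 1"
proof -
  obtain w where w: "w \<in> C"
    using C_nonempty by blast
  have "(\<Sum>u\<in>C. bary u x) - (\<Sum>u\<in>C. bary u w) = (\<Sum>u\<in>C. grad u) \<bullet> (x - w)"
    by (simp add: inner_sum_left flip: sum_subtractf bary_diff)
  moreover have "(\<Sum>u\<in>C. bary u w) = 1"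
    using w finite_C by (simp add: bary_vertex of_bool_def)
  ultimately show ?thesis
    by (simp add: sum_grad)
qed

lemma affine_expansion: "(\<Sum>u\<in>C. bary u x * (c + a \<bullet> u)) = c + a \<bullet> x"
proof -
  obtain w where w: "w \<in> C"
    using C_nonempty by blast
  have "(\<Sum>u\<in>C. bary u x * (a \<bullet> u)) - (\<Sum>u\<in>C. bary u w * (a \<bullet> u)) =
      (\<Sum>u\<in>C. (a \<bullet> u) *\<^sub>R grad u) \<bullet> (x - w)"
    by (simp add: inner_sum_left flip: sum_subtractf bary_diff left_diff_distrib)
      (simp add: mult.commute)
  moreover have "(\<Sum>u\<in>C. bary u w * (a \<bullet> u)) = a \<bullet> w"
    using w finite_C by (simp add: bary_vertex of_bool_def if_distrib[of "\<lambda>x. x * _"] cong: if_cong)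
  ultimately have "(\<Sum>u\<in>C. bary u x * (a \<bullet> u)) = a \<bullet> x"
    by (simp add: gradient_expansion inner_diff_right)
  then show ?thesis
    by (simp add: distrib_left sum.distrib sum_bary flip: sum_distrib_right)
qed

lemma barycentric_expansion: "(\<Sum>u\<in>C. bary u x *\<^sub>R u) = x"
proof -
  have "a \<bullet> ((\<Sum>u\<in>C. bary u x *\<^sub>R u) - x) = 0" for a
    using affine_expansion[of x 0 a] by (simp add: inner_diff_right inner_sum_right)
  then show ?thesis
    using inner_eq_zero_iff eq_iff_diff_eq_0 by metis
qed

lemma bary_combination:
  assumes D: "D \<subseteq> C" and \<mu>: "sum \<mu> D = 1" and u: "u \<in> C"
  shows "bary u (\<Sum>w\<in>D. \<mu> w *\<^sub>R w) = (if u \<in> D then \<mu> u else 0)"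
proof -
  have fin: "finite D"
    using D finite_C finite_subset by blast
  have "bary u (\<Sum>w\<in>D. \<mu> w *\<^sub>R w) = (\<Sum>w\<in>D. \<mu> w * bary u w)"
    unfolding bary_def inner_diff_right inner_sum_right
    by (simp add: distrib_left sum.distrib \<mu> right_diff_distrib sum_subtractf
        flip: sum_distrib_right)
  also have "\<dots> = (\<Sum>w\<in>D. \<mu> w * of_bool (w = u))"
    using D u by (intro sum.cong refl) (auto simp: bary_vertex subset_iff)
  also have "\<dots> = (if u \<in> D then \<mu> u else 0)"
    using fin by (simp add: of_bool_def if_distrib[of "(*) _"] cong: if_cong)
  finally show ?thesis .
qed

text \<open>The barycentric coordinates are the only weights that represent a point by the vertices. Hence the
  convex hull, the relative interior and the affine hull of a set of vertices are all described by
  signs of coordinates; the predicate \<open>P\<close> covers the three cases.\<close>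

lemma weights_iff_bary:
  assumes D: "D \<subseteq> C"
  shows "(\<exists>\<mu>. (\<forall>w\<in>D. P (\<mu> w)) \<and> sum \<mu> D = 1 \<and> (\<Sum>w\<in>D. \<mu> w *\<^sub>R w) = x) \<longleftrightarrow>
    (\<forall>w\<in>D. P (bary w x)) \<and> (\<forall>w\<in>C - D. bary w x = 0)" (is "?l \<longleftrightarrow> ?r")
proof
  assume ?l
  then show ?r
    using D by (auto simp: bary_combination subset_iff)
next
  assume r: ?r
  then have "(\<Sum>w\<in>D. bary w x) = 1" "(\<Sum>w\<in>D. bary w x *\<^sub>R w) = x"
    using sum.mono_neutral_left[OF finite_C D, of "\<lambda>w. bary w x"] sum_bary[of x]
      sum.mono_neutral_left[OF finite_C D, of "\<lambda>w. bary w x *\<^sub>R w"] barycentric_expansion[of x]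
    by auto
  with r show ?l
    by (intro exI[of _ "\<lambda>w. bary w x"]) simp
qed

lemma convex_hull_eq_bary:
  assumes D: "D \<subseteq> C"
  shows "convex hull D = {x. (\<forall>w\<in>D. 0 \<le> bary w x) \<and> (\<forall>w\<in>C - D. bary w x = 0)}"
  using weights_iff_bary[OF D, of "\<lambda>t. 0 \<le> t"] finite_subset[OF D finite_C]
  by (simp add: convex_hull_finite)

lemma rel_interior_eq_bary:
  assumes D: "D \<subseteq> C"
  shows "rel_interior (convex hull D) =
    {x. (\<forall>w\<in>D. 0 < bary w x) \<and> (\<forall>w\<in>C - D. bary w x = 0)}"
  using weights_iff_bary[OF D, of "\<lambda>t. 0 < t"] affine_independent_subset[OF indep D]
  by (simp add: rel_interior_convex_hull_explicit)

lemma simplex_eq_bary: "convex hull C = {x. \<forall>w\<in>C. 0 \<le> bary w x}"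
  using convex_hull_eq_bary[of C] by simp

lemma interior_eq_bary: "interior (convex hull C) = {x. \<forall>w\<in>C. 0 < bary w x}"
  using weights_iff_bary[of C "\<lambda>t. 0 < t"] card_C indep
  by (simp add: interior_convex_hull_explicit_minimal)

end

section \<open>Integrals of barycentric coordinates\<close>

text \<open>For barycentric coordinates, which sum to \<open>1\<close> and are permuted by symmetries of \<open>W\<close>.\<close>

lemma set_integral_eq_if_symmetric:
  fixes f :: "'i \<Rightarrow> 'a \<Rightarrow> real"
  assumes fin: "finite I" and W: "W \<in> sets M" "emeasure M W < \<infinity>"
    and int: "\<And>i. i \<in> I \<Longrightarrow> set_integrable M W (f i)"
    and sum: "\<And>x. x \<in> W \<Longrightarrow> (\<Sum>i\<in>I. f i x) = 1"
    and sym: "\<And>i j. i \<in> I \<Longrightarrow> j \<in> I \<Longrightarrow> (LINT x : W | M. f i x - f j x) = 0"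
    and i: "i \<in> I"
  shows "(LINT x : W | M. f i x) = measure M W / card I"
proof -
  have eq: "(LINT x : W | M. f j x) = (LINT x : W | M. f i x)" if "j \<in> I" for j
    using sym[OF i that] int[OF i] int[OF that] by simp
  have "measure M W = (LINT x : W | M. 1)"
    using W by (simp add: set_lebesgue_integral_def)
  also have "\<dots> = (LINT x : W | M. \<Sum>j\<in>I. f j x)"
    using W sum by (intro set_lebesgue_integral_cong) auto
  also have "\<dots> = (\<Sum>j\<in>I. LINT x : W | M. f j x)"
    using int by (simp add: set_lebesgue_integral_def set_integrable_def sum_distrib_left)
  also have "\<dots> = card I * (LINT x : W | M. f i x)"
    using eq by simp
  moreover have "card I > 0"
    using i fin card_gt_0_iff by blast
  ultimately show ?thesis
    by (simp add: field_simps)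
qed

context full_simplex
begin

lemma compact_simplex: "compact (convex hull C)"
  by (rule finite_imp_compact_convex_hull[OF finite_C])

lemma bary_eq_affine: "bary u x = bary u 0 + grad u \<bullet> x"
  using bary_add[of u 0 x] by simp

text \<open>The reflection along the edge from \<open>v\<close> to \<open>v'\<close> swaps these two vertices and fixes the others, so it
  preserves the simplex and exchanges the two coordinates.\<close>

lemma set_integral_bary:
  assumes w: "w \<in> C"
  shows "(LINT x : convex hull C | lborel. bary w x) = measure lebesgue (convex hull C) / card C"
proof -
  note compact = compact_simplex
  have "(LINT x : convex hull C | lborel. bary w x) = measure lborel (convex hull C) / card C"
  proof (rule set_integral_eq_if_symmetric[OF finite_C _ _ _ sum_bary _ w])
    show "convex hull C \<in> sets lborel"
      using compact by (simp add: borel_compact)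
    show "emeasure lborel (convex hull C) < \<infinity>"
      by (rule emeasure_bounded_finite[OF compact_imp_bounded[OF compact]])
    show "set_integrable lborel (convex hull C) (bary v)" for v
      unfolding set_integrable_def
      by (rule borel_integrable_compact[OF compact]) (intro continuous_intros)
    show "(LINT x : convex hull C | lborel. bary v x - bary v' x) = 0"
      if v: "v \<in> C" "v' \<in> C" for v v'
    proof (cases "v = v'")
      case False
      define \<alpha> where "\<alpha> = bary v 0 - bary v' 0"
      have eq: "bary v x - bary v' x = \<alpha> + (grad v - grad v') \<bullet> x" for x
        using bary_eq_affine[of v x] bary_eq_affine[of v' x] by (simp add: \<alpha>_def inner_diff_left)
      show ?thesis
        unfolding eq
      proof (rule integral_eq_0_if_reflection_invariant[where r = "v' - v"])
        show "(grad v - grad v') \<bullet> (v' - v) = - 2"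
          using v False by (simp add: inner_diff_left grad_vertex_diff)
        show "convex hull C \<in> sets borel"
          using compact by (rule borel_compact)
        fix x assume "x \<in> convex hull C"
        then have x: "0 \<le> bary z x" if "z \<in> C" for z
          using that by (simp add: simplex_eq_bary)
        have "0 \<le> bary z (x + (bary v x - bary v' x) *\<^sub>R (v' - v))" if "z \<in> C" for z
          using x[OF that] x[OF v(1)] x[OF v(2)] v that
          by (auto simp: bary_add grad_vertex_diff)
        then show "x + (\<alpha> + (grad v - grad v') \<bullet> x) *\<^sub>R (v' - v) \<in> convex hull C"
          unfolding eq[symmetric] by (simp add: simplex_eq_bary)
      qed
    qed simp
  qed
  then show ?thesis
    using compact by (simp add: borel_compact measure_completion)
qed

end

section \<open>Facets and their surface measure\<close>

text \<open>The facet opposite the vertex \<open>u\<close>. A point is described by its signed height over the hyperplane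
  of the facet, positive on the side away from \<open>u\<close>, and by the barycentric coordinates of its foot in
  the hyperplane.\<close>

locale simplex_facet = full_simplex C for C :: "(real ^ 'n) set" +
  fixes u :: "real ^ 'n"
  assumes u: "u \<in> C"
begin

abbreviation D :: "(real ^ 'n) set" where
  "D \<equiv> C - {u}"

abbreviation facet :: "(real ^ 'n) set" where
  "facet \<equiv> convex hull D"

definition \<nu> :: "real ^ 'n" where
  "\<nu> = - grad u /\<^sub>R norm (grad u)"

definition height :: "real ^ 'n \<Rightarrow> real" where
  "height x = - bary u x / norm (grad u)"

definition foot :: "real ^ 'n \<Rightarrow> real ^ 'n" where
  "foot x = x - height x *\<^sub>R \<nu>"

definition base :: "real ^ 'n \<Rightarrow> real ^ 'n \<Rightarrow> real" where
  "base w x = bary w (foot x)"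

definition base_grad :: "real ^ 'n \<Rightarrow> real ^ 'n" where
  "base_grad w = grad w - (grad w \<bullet> \<nu>) *\<^sub>R \<nu>"

lemma finite_D: "finite D" and card_D: "card D = CARD('n)" and D_nonempty: "D \<noteq> {}"
  using finite_C card_C_diff[OF u] facet_vertices_nonempty[OF u] by simp_all

lemma norm_grad_pos: "0 < norm (grad u)"
proof -
  obtain w where "w \<in> D"
    using D_nonempty by blast
  then have "grad u \<bullet> (u - w) = 1"
    using u by (simp add: grad_vertex_diff)
  then show ?thesis by auto
qed

lemma norm_\<nu>: "norm \<nu> = 1" and inner_\<nu>: "\<nu> \<bullet> \<nu> = 1"
  and grad_u_\<nu>: "grad u \<bullet> \<nu> = - norm (grad u)"
proof -
  show n: "norm \<nu> = 1"
    using norm_grad_pos by (simp add: \<nu>_def)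
  show "\<nu> \<bullet> \<nu> = 1"
    using n unfolding norm_eq_1 .
  have "grad u \<bullet> grad u = norm (grad u) * norm (grad u)"
    by (simp only: dot_square_norm power2_eq_square)
  then have "grad u \<bullet> \<nu> = - (inverse (norm (grad u)) * (norm (grad u) * norm (grad u)))"
    by (simp only: \<nu>_def inner_scaleR_right inner_minus_right)
  then show "grad u \<bullet> \<nu> = - norm (grad u)"
    using norm_grad_pos by simp
qed

lemma height_add: "height (x + y) = height x + \<nu> \<bullet> y"
  using norm_grad_pos by (simp add: height_def \<nu>_def bary_add field_simps)

lemma base_add: "base w (x + y) = base w x + base_grad w \<bullet> y"
  by (simp add: base_def foot_def base_grad_def height_add bary_def inner_diff_left
      inner_diff_right inner_add_left inner_add_right scaleR_left_distrib distrib_left distrib_right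
      mult.commute)

lemma base_grad_\<nu>: "base_grad w \<bullet> \<nu> = 0"
  by (simp add: base_grad_def inner_diff_left inner_\<nu>)

lemma bary_foot: "bary u (foot x) = 0"
  using bary_diff[of u "foot x" x] norm_grad_pos
  by (simp add: foot_def height_def grad_u_\<nu>)

lemma sum_base: "(\<Sum>w\<in>D. base w x) = 1"
  using sum_bary[of "foot x"] bary_foot[of x] sum.remove[OF finite_C u, of "\<lambda>w. bary w (foot x)"]
  by (simp add: base_def)

lemma \<nu>_edge: "w \<in> D \<Longrightarrow> w' \<in> D \<Longrightarrow> \<nu> \<bullet> (w - w') = 0"
  using u by (simp add: \<nu>_def grad_vertex_diff)

lemma base_grad_edge:
  "v \<in> C \<Longrightarrow> w \<in> D \<Longrightarrow> w' \<in> D \<Longrightarrow> base_grad v \<bullet> (w - w') = of_bool (w = v) - of_bool (w' = v)"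
  using \<nu>_edge[of w w'] by (simp add: base_grad_def inner_diff_left grad_vertex_diff)

lemma base_eq_affine: "base w x = base w 0 + base_grad w \<bullet> x"
  using base_add[of w 0 x] by simp

lemma height_eq_affine: "height x = height 0 + \<nu> \<bullet> x"
  using height_add[of 0 x] by simp

lemma continuous_on_height: "continuous_on A height"
  using norm_grad_pos unfolding height_def by (intro continuous_intros) simp

lemma continuous_on_foot: "continuous_on A foot"
  unfolding foot_def by (intro continuous_intros continuous_on_height)

lemma continuous_on_base: "continuous_on A (base w)"
  unfolding base_def bary_def by (intro continuous_intros continuous_on_foot)

lemma facet_eq_bary: "facet = {x. (\<forall>w\<in>D. 0 \<le> bary w x) \<and> bary u x = 0}"
  using convex_hull_eq_bary[of D] u by (auto simp: double_diff)

lemma rel_interior_facet_eq_bary: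
  "rel_interior facet = {x. (\<forall>w\<in>D. 0 < bary w x) \<and> bary u x = 0}"
  using rel_interior_eq_bary[of D] u by (auto simp: double_diff)

lemma affine_hull_facet: "affine hull D = {x. bary u x = 0}"
proof -
  have "affine hull D = {x. \<forall>w\<in>C - D. bary w x = 0}"
    using weights_iff_bary[of D "\<lambda>_. True"] finite_D by (simp add: affine_hull_finite)
  then show ?thesis
    using u by (simp add: double_diff)
qed

lemma foot_in_facet_iff: "foot x \<in> facet \<longleftrightarrow> (\<forall>w\<in>D. 0 \<le> base w x)"
  by (simp add: facet_eq_bary base_def bary_foot)

lemma foot_nearest:
  assumes "bary u z = 0"
  shows "dist x (foot x) \<le> dist x z"
proof -
  have "dist x (foot x) = \<bar>height x\<bar>"
    by (simp add: foot_def dist_norm norm_\<nu>)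
  also have "\<dots> = \<bar>\<nu> \<bullet> (x - z)\<bar>"
    using height_add[of z "x - z"] assms by (simp add: height_def)
  also have "\<dots> \<le> dist x z"
    using Cauchy_Schwarz_ineq2[of \<nu> "x - z"] by (simp add: norm_\<nu> dist_norm)
  finally show ?thesis .
qed

lemma closest_point_facet_hyperplane: "closest_point (affine hull D) = foot"
  and infdist_facet_hyperplane: "infdist x (affine hull D) = \<bar>height x\<bar>"
proof -
  show *: "closest_point (affine hull D) = foot"
  proof
    fix x
    have "foot x \<in> affine hull D"
      by (simp add: affine_hull_facet bary_foot)
    moreover have "\<forall>z\<in>affine hull D. dist x (foot x) \<le> dist x z"
      by (simp add: affine_hull_facet foot_nearest)
    ultimately show "closest_point (affine hull D) x = foot x"
      by (intro closest_point_unique[symmetric] affine_imp_convex affine_affine_hull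
          closed_affine_hull)
  qed
  have "affine hull D \<noteq> {}"
    using D_nonempty by (simp only: affine_hull_eq_empty not_False_eq_True)
  then have "setdist {x} (affine hull D) = dist x (closest_point (affine hull D) x)"
    by (intro setdist_closest_point closed_affine_hull)
  then have "infdist x (affine hull D) = dist x (foot x)"
    unfolding infdist_eq_setdist * .
  then show "infdist x (affine hull D) = \<bar>height x\<bar>"
    by (simp add: foot_def dist_norm norm_\<nu>)
qed

text \<open>The part of the slab in the definition of the surface measure that projects to the facet; its
  volume is the area of the facet.\<close>

definition prism :: "(real ^ 'n) set" where
  "prism = {x. \<bar>height x\<bar> \<le> 1 / 2 \<and> foot x \<in> facet}"

lemma compact_facet: "compact facet"
  by (rule finite_imp_compact_convex_hull[OF finite_D])

lemma compact_prism: "compact prism"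
proof -
  have "closed prism"
  proof -
    have "prism = {x. \<bar>height x\<bar> \<le> 1 / 2} \<inter> (\<Inter>w\<in>D. {x. 0 \<le> base w x})"
      by (auto simp: prism_def foot_in_facet_iff)
    then show ?thesis
      by (auto intro!: closed_Int closed_INT closed_Collect_le continuous_intros
          continuous_on_height continuous_on_base)
  qed
  moreover obtain B where B: "\<And>x. x \<in> facet \<Longrightarrow> norm x \<le> B"
    using compact_imp_bounded[OF compact_facet] by (auto simp: bounded_iff)
  have "norm x \<le> B + 1 / 2" if "x \<in> prism" for x
  proof -
    have "norm x \<le> norm (foot x) + norm (height x *\<^sub>R \<nu>)"
      using norm_triangle_ineq[of "foot x" "height x *\<^sub>R \<nu>"] by (simp add: foot_def)
    also have "\<dots> \<le> B + 1 / 2"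
      using that B[of "foot x"] by (simp add: prism_def norm_\<nu>)
    finally show ?thesis .
  qed
  then have "bounded prism"
    by (auto simp: bounded_iff)
  ultimately show ?thesis
    by (simp add: compact_eq_bounded_closed)
qed

lemma slab_in_borel: "{x. infdist x (affine hull D) \<le> 1 / 2} \<in> sets borel"
  unfolding infdist_facet_hyperplane
  by (intro borel_closed closed_Collect_le continuous_intros continuous_on_height)

lemma foot_measurable:
  "foot \<in> measurable (restrict_space lborel {x. infdist x (affine hull D) \<le> 1 / 2}) borel"
  by (intro measurable_restrict_space1)
    (simp add: borel_measurable_continuous_onI continuous_on_foot)

lemma side_measure_facet:
  "side_measure facet =
    completion (distr (restrict_space lborel {x. infdist x (affine hull D) \<le> 1 / 2}) borel foot)"
  by (simp add: hyperplane_measure_def closest_point_facet_hyperplane)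

lemma emeasure_side_measure:
  assumes A: "A \<in> sets borel"
  shows "emeasure (side_measure facet) A = emeasure lborel {x. \<bar>height x\<bar> \<le> 1 / 2 \<and> foot x \<in> A}"
proof -
  let ?M = "restrict_space lborel {x. infdist x (affine hull D) \<le> 1 / 2}"
  have "emeasure (side_measure facet) A = emeasure (distr ?M borel foot) A"
    unfolding side_measure_facet using A by simp
  also have "\<dots> = emeasure ?M (foot -` A \<inter> space ?M)"
    using A foot_measurable by (intro emeasure_distr)
  also have "\<dots> = emeasure lborel (foot -` A \<inter> space ?M)"
    using slab_in_borel by (intro emeasure_restrict_space) (auto simp: space_restrict_space)
  also have "foot -` A \<inter> space ?M = {x. \<bar>height x\<bar> \<le> 1 / 2 \<and> foot x \<in> A}"
    by (auto simp: space_restrict_space infdist_facet_hyperplane)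
  finally show ?thesis .
qed

lemma sets_side_measure: "A \<in> sets borel \<Longrightarrow> A \<in> sets (side_measure facet)"
  unfolding side_measure_facet by (intro sets_completionI_sets) simp

lemma emeasure_facet: "emeasure (side_measure facet) facet = emeasure lborel prism"
  using emeasure_side_measure[OF borel_compact[OF compact_facet]] by (simp add: prism_def)

lemma measure_facet: "measure (side_measure facet) facet = measure lebesgue prism"
  using emeasure_facet borel_compact[OF compact_prism] by (simp add: measure_def)

lemma set_integral_facet:
  fixes q :: "real ^ 'n \<Rightarrow> real"
  assumes q: "continuous_on UNIV q"
  shows "set_integrable (side_measure facet) facet q"
    and "(LINT x : facet | side_measure facet. q x) = (LINT x : prism | lborel. q (foot x))"
proof -
  let ?H = "{x. infdist x (affine hull D) \<le> 1 / 2}"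
  let ?M = "restrict_space lborel ?H"
  let ?q = "\<lambda>x. indicator facet x *\<^sub>R q x"
  have meas: "?q \<in> borel_measurable borel"
    using q borel_compact[OF compact_facet]
    by (intro borel_measurable_scaleR borel_measurable_indicator borel_measurable_continuous_onI)
  have H: "?H \<inter> space lborel \<in> sets lborel"
    using slab_in_borel by simp
  have eq: "indicator ?H x *\<^sub>R ?q (foot x) = indicator prism x *\<^sub>R q (foot x)" for x
    by (simp add: prism_def infdist_facet_hyperplane indicator_def)
  have "continuous_on prism (\<lambda>x. q (foot x))"
    by (rule continuous_on_compose2[OF q continuous_on_foot]) simp
  then have "integrable lborel (\<lambda>x. indicator prism x *\<^sub>R q (foot x))"
    by (rule borel_integrable_compact[OF compact_prism])
  then have "integrable ?M (\<lambda>x. ?q (foot x))"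
    unfolding integrable_restrict_space[OF H] eq .
  then have "integrable (distr ?M borel foot) ?q"
    using foot_measurable meas by (simp add: integrable_distr_eq)
  then show "set_integrable (side_measure facet) facet q"
    unfolding set_integrable_def side_measure_facet by (rule integrable_completion[THEN iffD2, rotated]) (use meas in simp)
  have "integral\<^sup>L (side_measure facet) ?q = integral\<^sup>L (distr ?M borel foot) ?q"
    unfolding side_measure_facet using meas by (intro integral_completion) simp
  also have "\<dots> = integral\<^sup>L ?M (\<lambda>x. ?q (foot x))"
    using foot_measurable meas by (intro integral_distr)
  also have "\<dots> = (\<integral>x. indicator prism x *\<^sub>R q (foot x) \<partial>lborel)"
    unfolding integral_restrict_space[OF H] eq ..
  finally show "(LINT x : facet | side_measure facet. q x) = (LINT x : prism | lborel. q (foot x))"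
    by (simp add: set_lebesgue_integral_def)
qed

text \<open>On the relative boundary some barycentric coordinate vanishes, and the points whose foot has a
  vanishing coordinate form a null set, being contained in a hyperplane.\<close>

lemma AE_facet_rel_interior: "AE x in side_measure facet. x \<in> facet \<longrightarrow> x \<in> rel_interior facet"
proof -
  have "AE x in side_measure facet. bary w x \<noteq> 0" if w: "w \<in> D" for w
  proof (rule AE_I)
    have borel: "{x. bary w x = 0} \<in> sets borel"
      by (intro borel_closed closed_Collect_eq continuous_intros)
    then show "{x. bary w x = 0} \<in> sets (side_measure facet)"
      by (rule sets_side_measure)
    have "base w w = 1"
      using w u by (simp add: base_def foot_def height_def bary_vertex)
    then have "base_grad w \<noteq> 0 \<or> - base w 0 \<noteq> 0"
      using base_eq_affine[of w w] by auto
    then have "negligible {x. base_grad w \<bullet> x = - base w 0}"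
      by (rule negligible_hyperplane)
    moreover have "base_grad w \<bullet> x = - base w 0 \<longleftrightarrow> base w x = 0" for x
      using base_eq_affine[of w x] by linarith
    moreover have "{x. base w x = 0} \<in> sets borel"
      by (intro borel_closed closed_Collect_eq continuous_intros continuous_on_base)
    ultimately have "emeasure lborel {x. base w x = 0} = 0"
      by (simp add: negligible_iff_null_sets null_sets_def)
    moreover have "emeasure lborel {x. \<bar>height x\<bar> \<le> 1 / 2 \<and> foot x \<in> {x. bary w x = 0}} \<le>
        emeasure lborel {x. base w x = 0}"
      using \<open>{x. base w x = 0} \<in> sets borel\<close> by (intro emeasure_mono) (auto simp: base_def)
    ultimately show "emeasure (side_measure facet) {x. bary w x = 0} = 0"
      unfolding emeasure_side_measure[OF borel] by simp
  qed auto
  then have "AE x in side_measure facet. \<forall>w\<in>D. bary w x \<noteq> 0"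
    using finite_D by (simp add: AE_finite_all)
  then show ?thesis
    unfolding rel_interior_facet_eq_bary
    by eventually_elim (auto simp: less_le dest: facet_eq_bary[THEN equalityD1, THEN subsetD])
qed

text \<open>The reflection of the simplex that swaps two vertices of the facet has an analogue for the prism,
  which leaves the height unchanged.\<close>

lemma set_integral_base:
  assumes w: "w \<in> D"
  shows "(LINT x : prism | lborel. base w x) = measure lebesgue prism / CARD('n)"
proof -
  note compact = compact_prism
  have "(LINT x : prism | lborel. base w x) = measure lborel prism / card D"
  proof (rule set_integral_eq_if_symmetric[OF finite_D _ _ _ sum_base _ w])
    show "prism \<in> sets lborel"
      using compact by (simp add: borel_compact)
    show "emeasure lborel prism < \<infinity>"
      by (rule emeasure_bounded_finite[OF compact_imp_bounded[OF compact]])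
    show "set_integrable lborel prism (base v)" for v
      unfolding set_integrable_def
      by (rule borel_integrable_compact[OF compact]) (intro continuous_on_base)
    show "(LINT x : prism | lborel. base v x - base v' x) = 0"
      if v: "v \<in> D" "v' \<in> D" for v v'
    proof (cases "v = v'")
      case False
      define \<alpha> where "\<alpha> = base v 0 - base v' 0"
      have eq: "base v x - base v' x = \<alpha> + (base_grad v - base_grad v') \<bullet> x" for x
        using base_eq_affine[of v x] base_eq_affine[of v' x] by (simp add: \<alpha>_def inner_diff_left)
      show ?thesis
        unfolding eq
      proof (rule integral_eq_0_if_reflection_invariant[where r = "v' - v"])
        show "(base_grad v - base_grad v') \<bullet> (v' - v) = - 2"
          using v False base_grad_edge[of v v' v] base_grad_edge[of v' v' v]
          by (simp add: inner_diff_left)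
        show "prism \<in> sets borel"
          using compact by (rule borel_compact)
        fix x assume x: "x \<in> prism"
        then have nonneg: "0 \<le> base z x" if "z \<in> D" for z
          using that by (simp add: prism_def foot_in_facet_iff)
        have "0 \<le> base z (x + (base v x - base v' x) *\<^sub>R (v' - v))" if z: "z \<in> D" for z
          using nonneg[OF z] nonneg[OF v(1)] nonneg[OF v(2)] z base_grad_edge[of z v' v] v
          by (auto simp: base_add)
        then show "x + (\<alpha> + (base_grad v - base_grad v') \<bullet> x) *\<^sub>R (v' - v) \<in> prism"
          using x \<nu>_edge[OF v(2) v(1)] unfolding eq[symmetric]
          by (simp add: prism_def foot_in_facet_iff height_add)
      qed
    qed simp
  qed
  then show ?thesis
    using compact by (simp add: borel_compact measure_completion card_D)
qed

end

section \<open>Averages of affine functions and areas of facets\<close>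

context full_simplex
begin

lemma interior_simplex_nonempty: "interior (convex hull C) \<noteq> {}"
proof -
  have "interior (convex hull C) = rel_interior (convex hull C)"
    using interior_eq_bary rel_interior_eq_bary[of C] by simp
  then show ?thesis
    using C_nonempty by (simp add: rel_interior_eq_empty)
qed

lemma measure_simplex_pos: "0 < measure lebesgue (convex hull C)"
proof -
  have "\<not> negligible (convex hull C)"
    using open_not_negligible[OF open_interior interior_simplex_nonempty] interior_subset
      negligible_subset by blast
  then show ?thesis
    using lmeasurable_compact[OF compact_simplex]
    by (simp add: negligible_iff_measure zero_less_measure_iff)
qed

lemma set_integral_affine:
  "(LINT x : convex hull C | lebesgue. c + a \<bullet> x) =
    measure lebesgue (convex hull C) * ((\<Sum>w\<in>C. c + a \<bullet> w) / (CARD('n) + 1))"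
proof -
  have int: "set_integrable lborel (convex hull C) (\<lambda>x. bary w x * t)" for w t
    unfolding set_integrable_def
    by (intro borel_integrable_compact[OF compact_simplex] continuous_intros)
  have meas: "(\<lambda>x. c + a \<bullet> x) \<in> borel_measurable borel"
    by (intro borel_measurable_continuous_onI continuous_intros)
  have T: "convex hull C \<in> sets borel"
    by (rule borel_compact[OF compact_simplex])
  have "(LINT x : convex hull C | lebesgue. c + a \<bullet> x) = (LINT x : convex hull C | lborel. c + a \<bullet> x)"
    unfolding set_lebesgue_integral_def using meas T
    by (intro integral_completion borel_measurable_scaleR borel_measurable_indicator) simp_all
  also have "\<dots> = (LINT x : convex hull C | lborel. \<Sum>w\<in>C. bary w x * (c + a \<bullet> w))"
    by (simp only: affine_expansion)
  also have "\<dots> = (\<Sum>w\<in>C. LINT x : convex hull C | lborel. bary w x * (c + a \<bullet> w))"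
    unfolding set_lebesgue_integral_def scaleR_sum_right
    using int by (intro Bochner_Integration.integral_sum) (simp add: set_integrable_def)
  also have "\<dots> = (\<Sum>w\<in>C. measure lebesgue (convex hull C) / card C * (c + a \<bullet> w))"
    by (simp add: set_integral_bary)
  also have "\<dots> = measure lebesgue (convex hull C) * ((\<Sum>w\<in>C. c + a \<bullet> w) / (CARD('n) + 1))"
    by (simp add: sum_distrib_left card_C flip: sum_divide_distrib)
  finally show ?thesis .
qed

end

context simplex_facet
begin

text \<open>For a single vertex \<open>j\<close> this is the simplex spanned by the facet and \<open>j + \<nu>\<close>; for all vertices of
  the facet it is the prism, moved by half its thickness.\<close>

definition wedge :: "(real ^ 'n) set \<Rightarrow> (real ^ 'n) set" where
  "wedge A = {x. foot x \<in> facet \<and> 0 \<le> height x \<and> height x \<le> (\<Sum>w\<in>A. base w x)}"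

lemma height_translate: "height (x + t *\<^sub>R \<nu>) = height x + t"
  by (simp add: height_add inner_\<nu>)

lemma base_translate: "base w (x + t *\<^sub>R \<nu>) = base w x"
  by (simp add: base_add base_grad_\<nu>)

text \<open>The map fixes the facet, where \<open>bary u\<close> vanishes, and moves the vertex \<open>u\<close> to \<open>j + \<nu>\<close>.\<close>

lemma wedge_single_eq_image:
  assumes j: "j \<in> D"
  shows "wedge {j} = (\<lambda>x. x + (bary u 0 + grad u \<bullet> x) *\<^sub>R (j + \<nu> - u)) ` (convex hull C)"
proof -
  let ?n = "norm (grad u)" and ?r = "j + \<nu> - u"
  note j = j u
  have gj: "grad u \<bullet> (j - u) = - 1"
    using j by (simp add: grad_vertex_diff)
  have gr: "grad u \<bullet> ?r = - 1 - ?n"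
    using gj by (simp add: inner_add_right inner_diff_right grad_u_\<nu>)
  have \<nu>r: "\<nu> \<bullet> ?r = 1 + 1 / ?n"
    using gr norm_grad_pos by (simp add: \<nu>_def field_simps)
  have \<nu>j: "\<nu> \<bullet> (j - u) = 1 / ?n"
    using gj norm_grad_pos by (simp add: \<nu>_def field_simps)
  have height: "height (x + bary u x *\<^sub>R ?r) = bary u x" for x
    using norm_grad_pos unfolding height_add inner_scaleR_right \<nu>r
    by (simp add: height_def field_simps)
  have base: "base w (x + bary u x *\<^sub>R ?r) = bary w x + bary u x * of_bool (w = j)"
    if w: "w \<in> D" for w x
  proof -
    have q: "base_grad w \<bullet> ?r = of_bool (w = j) - (grad w \<bullet> \<nu>) / ?n"
    proof -
      have "base_grad w \<bullet> ?r = base_grad w \<bullet> (j - u)"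
        using base_grad_\<nu>[of w] by (simp add: inner_add_right inner_diff_right)
      also have "\<dots> = of_bool (w = j) - (grad w \<bullet> \<nu>) * (\<nu> \<bullet> (j - u))"
        using w j by (simp add: base_grad_def inner_diff_left grad_vertex_diff) auto
      finally show ?thesis
        unfolding \<nu>j by simp
    qed
    have p: "base w x = bary w x + bary u x / ?n * (grad w \<bullet> \<nu>)"
      using bary_diff[of w "foot x" x] by (simp add: base_def foot_def height_def)
    show ?thesis
      unfolding base_add inner_scaleR_right q p by (simp add: right_diff_distrib)
  qed
  have iff: "x + bary u x *\<^sub>R ?r \<in> wedge {j} \<longleftrightarrow> x \<in> convex hull C" for x
  proof -
    have "x + bary u x *\<^sub>R ?r \<in> wedge {j} \<longleftrightarrow>
        (\<forall>w\<in>D. 0 \<le> bary w x + bary u x * of_bool (w = j)) \<and> 0 \<le> bary u x \<and> 0 \<le> bary j x"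
      using j base by (simp add: wedge_def foot_in_facet_iff height)
    also have "\<dots> \<longleftrightarrow> (\<forall>w\<in>C. 0 \<le> bary w x)"
    proof (intro iffI ballI conjI)
      fix w
      assume *: "(\<forall>w\<in>D. 0 \<le> bary w x + bary u x * of_bool (w = j)) \<and> 0 \<le> bary u x \<and> 0 \<le> bary j x"
        and w: "w \<in> C"
      show "0 \<le> bary w x"
      proof (cases "w = u \<or> w = j")
        case False
        with w have "w \<in> D"
          by blast
        with * have "0 \<le> bary w x + bary u x * of_bool (w = j)"
          by blast
        then show ?thesis
          using False by simp
      qed (use * in blast)
    qed (use j u in simp_all)
    finally show ?thesis
      by (simp add: simplex_eq_bary)
  qed
  \<comment> \<open>the inverse map moves \<open>y\<close> back by its own height, as the map makes \<open>bary u x\<close> the new height\<close>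
  have surj: "\<exists>x. y = x + bary u x *\<^sub>R ?r" for y
  proof -
    define x where "x = y - height y *\<^sub>R ?r"
    have "x = y + (- height y) *\<^sub>R ?r"
      by (simp add: x_def)
    then have "bary u x = bary u y + (- height y) * (grad u \<bullet> ?r)"
      by (simp only: bary_add inner_scaleR_right)
    also have "\<dots> = bary u y + height y * (1 + ?n)"
      unfolding gr by (simp add: algebra_simps)
    also have "\<dots> = height y"
      using norm_grad_pos by (simp add: height_def field_simps)
    finally have "y = x + bary u x *\<^sub>R ?r"
      by (simp add: x_def)
    then show ?thesis ..
  qed
  have "wedge {j} = (\<lambda>x. x + bary u x *\<^sub>R ?r) ` (convex hull C)"
  proof (intro set_eqI iffI)
    fix y assume y: "y \<in> wedge {j}"
    obtain x where x: "y = x + bary u x *\<^sub>R ?r"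
      using surj by blast
    then show "y \<in> (\<lambda>x. x + bary u x *\<^sub>R ?r) ` (convex hull C)"
      using y iff[of x] by blast
  qed (auto simp: iff)
  moreover have "bary u 0 + grad u \<bullet> x = bary u x" for x
    using bary_eq_affine[of u x] by simp
  ultimately show ?thesis
    by simp
qed

lemma measure_wedge_single:
  assumes j: "j \<in> D"
  shows "wedge {j} \<in> lmeasurable"
    and "measure lebesgue (wedge {j}) = norm (grad u) * measure lebesgue (convex hull C)"
proof -
  have T: "convex hull C \<in> lmeasurable"
    by (rule lmeasurable_compact[OF compact_simplex])
  show "wedge {j} \<in> lmeasurable"
    unfolding wedge_single_eq_image[OF j] by (rule measure_rank_one_update(1)[OF T])
  have "grad u \<bullet> (j - u) = - 1"
    using j u by (simp add: grad_vertex_diff)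
  then have "1 + grad u \<bullet> (j + \<nu> - u) = - norm (grad u)"
    using grad_u_\<nu> by (simp add: inner_add_right inner_diff_right)
  then show "measure lebesgue (wedge {j}) = norm (grad u) * measure lebesgue (convex hull C)"
    unfolding wedge_single_eq_image[OF j] measure_rank_one_update(2)[OF T] by simp
qed

text \<open>The wedge of \<open>j\<close> is placed on top of the wedge of \<open>A\<close> by a shear in the direction of the normal.\<close>

lemma wedge_insert:
  assumes j: "j \<in> D" "j \<notin> A" and A: "A \<subseteq> D"
  shows "wedge (insert j A) = wedge A \<union> (\<lambda>x. x + (\<Sum>w\<in>A. base w x) *\<^sub>R \<nu>) ` wedge {j}"
proof -
  have fin: "finite A"
    using A finite_D finite_subset by blast
  let ?b = "\<lambda>x. \<Sum>w\<in>A. base w x"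
  have translate: "?b (x + t *\<^sub>R \<nu>) = ?b x" for x t
    by (simp add: base_translate)
  have foot: "foot (x + t *\<^sub>R \<nu>) \<in> facet \<longleftrightarrow> foot x \<in> facet" for x t
    by (simp add: foot_in_facet_iff base_translate)
  have b_nonneg: "0 \<le> ?b x" if "foot x \<in> facet" for x
    using that A by (intro sum_nonneg) (auto simp: foot_in_facet_iff)
  have image: "y \<in> (\<lambda>x. x + ?b x *\<^sub>R \<nu>) ` wedge {j} \<longleftrightarrow>
      foot y \<in> facet \<and> ?b y \<le> height y \<and> height y \<le> ?b y + base j y" for y
  proof
    assume "y \<in> (\<lambda>x. x + ?b x *\<^sub>R \<nu>) ` wedge {j}"
    then obtain x where "y = x + ?b x *\<^sub>R \<nu>" "x \<in> wedge {j}"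
      by blast
    then show "foot y \<in> facet \<and> ?b y \<le> height y \<and> height y \<le> ?b y + base j y"
      using translate[of x "?b x"] by (simp add: wedge_def foot base_translate height_translate)
  next
    assume y: "foot y \<in> facet \<and> ?b y \<le> height y \<and> height y \<le> ?b y + base j y"
    let ?x = "y + (- ?b y) *\<^sub>R \<nu>"
    have "?x \<in> wedge {j}"
      using y by (simp only: wedge_def mem_Collect_eq foot base_translate height_translate) simp
    moreover have "y = ?x + ?b ?x *\<^sub>R \<nu>"
      unfolding translate by simp
    ultimately show "y \<in> (\<lambda>x. x + ?b x *\<^sub>R \<nu>) ` wedge {j}"
      by blast
  qed
  show ?thesis
  proof (intro set_eqI)
    fix y
    have "foot y \<in> facet \<Longrightarrow> 0 \<le> base j y"
      using j by (simp add: foot_in_facet_iff)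
    then show "y \<in> wedge (insert j A) \<longleftrightarrow>
        y \<in> wedge A \<union> (\<lambda>x. x + ?b x *\<^sub>R \<nu>) ` wedge {j}"
      unfolding Un_iff image using b_nonneg[of y] j fin by (auto simp: wedge_def)
  qed
qed

text \<open>In every step of the stacking the two pieces overlap in a hyperplane only, and the shear preserves
  the volume.\<close>

lemma measure_wedge:
  assumes "A \<subseteq> D"
  shows "wedge A \<in> lmeasurable \<and>
    measure lebesgue (wedge A) = card A * (norm (grad u) * measure lebesgue (convex hull C))"
proof -
  have "finite A"
    using assms finite_D finite_subset by blast
  then show ?thesis
    using assms
  proof (induction A)
    case empty
    have "\<nu> \<noteq> 0 \<or> - height 0 \<noteq> 0"
      using norm_\<nu> by auto
    then have "negligible {x. \<nu> \<bullet> x = - height 0}"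
      by (rule negligible_hyperplane)
    moreover have "wedge {} \<subseteq> {x. \<nu> \<bullet> x = - height 0}"
    proof
      fix x assume "x \<in> wedge {}"
      then show "x \<in> {x. \<nu> \<bullet> x = - height 0}"
        using height_eq_affine[of x] by (simp add: wedge_def)
    qed
    ultimately have "negligible (wedge {})"
      by (rule negligible_subset)
    then show ?case
      by (simp add: negligible_imp_measurable negligible_imp_measure0)
  next
    case (insert j A)
    then have j: "j \<in> D" "j \<notin> A" and A: "A \<subseteq> D"
      by auto
    define b where "b = (\<Sum>w\<in>A. base w 0)"
    define g where "g = (\<Sum>w\<in>A. base_grad w)"
    have b: "(\<Sum>w\<in>A. base w x) = b + g \<bullet> x" for x
    proof -
      have "(\<Sum>w\<in>A. base w x) = (\<Sum>w\<in>A. base w 0 + base_grad w \<bullet> x)"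
        by (rule sum.cong[OF refl base_eq_affine])
      then show ?thesis
        by (simp add: b_def g_def sum.distrib inner_sum_left)
    qed
    have g\<nu>: "g \<bullet> \<nu> = 0"
      by (simp add: g_def inner_sum_left base_grad_\<nu>)
    let ?B = "(\<lambda>x. x + (b + g \<bullet> x) *\<^sub>R \<nu>) ` wedge {j}"
    note B = measure_rank_one_update[OF measure_wedge_single(1)[OF j(1)], of b g \<nu>]
    have eq: "wedge (insert j A) = wedge A \<union> ?B"
      using wedge_insert[OF j A] unfolding b .
    have IH: "wedge A \<in> lmeasurable"
      "measure lebesgue (wedge A) = card A * (norm (grad u) * measure lebesgue (convex hull C))"
      using insert.IH[OF A] by auto
    have "(\<nu> - g) \<bullet> \<nu> = 1"
      by (simp add: inner_diff_left inner_\<nu> g\<nu>)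
    then have "\<nu> - g \<noteq> 0 \<or> b - height 0 \<noteq> 0"
      by auto
    then have "negligible {x. (\<nu> - g) \<bullet> x = b - height 0}"
      by (rule negligible_hyperplane)
    moreover have "wedge A \<inter> ?B \<subseteq> {x. (\<nu> - g) \<bullet> x = b - height 0}"
    proof
      fix y assume y: "y \<in> wedge A \<inter> ?B"
      then have "height y \<le> b + g \<bullet> y"
        by (simp add: wedge_def b)
      moreover obtain x where x: "y = x + (b + g \<bullet> x) *\<^sub>R \<nu>" "0 \<le> height x"
        using y by (auto simp: wedge_def)
      then have "b + g \<bullet> y \<le> height y"
        by (simp add: height_translate inner_add_right g\<nu>)
      ultimately show "y \<in> {x. (\<nu> - g) \<bullet> x = b - height 0}"
        using height_eq_affine[of y] by (simp add: inner_diff_left)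
    qed
    ultimately have "negligible (wedge A \<inter> ?B)"
      by (rule negligible_subset)
    then have "measure lebesgue (wedge A \<inter> ?B) = 0"
      by (rule negligible_imp_measure0)
    then have "measure lebesgue (wedge A \<union> ?B) = measure lebesgue (wedge A) + measure lebesgue ?B"
      using measure_Un3[OF IH(1) B(1)] by simp
    also have "measure lebesgue ?B = norm (grad u) * measure lebesgue (convex hull C)"
      unfolding B(2) g\<nu> measure_wedge_single(2)[OF j(1)] by simp
    finally have "measure lebesgue (wedge (insert j A)) =
        (1 + card A) * (norm (grad u) * measure lebesgue (convex hull C))"
      unfolding eq IH(2) by (simp add: algebra_simps)
    moreover have "wedge (insert j A) \<in> lmeasurable"
      unfolding eq by (rule fmeasurable.Un[OF IH(1) B(1)])
    ultimately show ?case
      using insert.hyps by simp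
  qed
qed

text \<open>The height of the simplex over the facet is \<open>1 / |grad u|\<close>, so this is the classical
  relation between volume, height and base of a cone.\<close>

lemma measure_facet_eq:
  "measure (side_measure facet) facet =
    CARD('n) * (norm (grad u) * measure lebesgue (convex hull C))"
proof -
  have "prism = (+) (- (1 / 2) *\<^sub>R \<nu>) ` wedge D"
  proof (intro set_eqI iffI)
    fix x assume x: "x \<in> prism"
    then have "\<bar>height x\<bar> \<le> 1 / 2"
      by (simp only: prism_def mem_Collect_eq)
    then have "0 \<le> height x + 1 / 2" "height x + 1 / 2 \<le> 1"
      by linarith+
    then have "x + (1 / 2) *\<^sub>R \<nu> \<in> wedge D"
      using x unfolding wedge_def mem_Collect_eq foot_in_facet_iff base_translate height_translate
        sum_base by (simp add: prism_def foot_in_facet_iff)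
    then show "x \<in> (+) (- (1 / 2) *\<^sub>R \<nu>) ` wedge D"
      by (rule rev_image_eqI) simp
  next
    fix x assume "x \<in> (+) (- (1 / 2) *\<^sub>R \<nu>) ` wedge D"
    then obtain y where y: "x = y + (- 1 / 2) *\<^sub>R \<nu>" "y \<in> wedge D"
      by auto
    then have "foot y \<in> facet" "0 \<le> height y" "height y \<le> 1"
      unfolding wedge_def mem_Collect_eq sum_base by blast+
    then have "foot x \<in> facet" "\<bar>height x\<bar> \<le> 1 / 2"
      unfolding y(1) foot_in_facet_iff base_translate height_translate by (blast, linarith)
    then show "x \<in> prism"
      by (simp only: prism_def mem_Collect_eq)
  qed
  then have "measure lebesgue prism = measure lebesgue (wedge D)"
    by (simp only: measure_translation)
  then show ?thesis
    unfolding measure_facet using measure_wedge[OF subset_refl] by (simp add: card_D)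
qed

lemma side_average_facet:
  "side_average facet (\<lambda>x. c + a \<bullet> x) = (\<Sum>w\<in>D. c + a \<bullet> w) / CARD('n)"
proof -
  have int: "set_integrable lborel prism (\<lambda>x. base w x * t)" for w t
    unfolding set_integrable_def
    by (intro borel_integrable_compact[OF compact_prism] continuous_intros continuous_on_base)
  have expand: "c + a \<bullet> foot x = (\<Sum>w\<in>D. base w x * (c + a \<bullet> w))" for x
    using affine_expansion[of "foot x" c a] bary_foot[of x]
      sum.remove[OF finite_C u, of "\<lambda>w. bary w (foot x) * (c + a \<bullet> w)"]
    by (simp add: base_def)
  have "(LINT x : facet | side_measure facet. c + a \<bullet> x) = (LINT x : prism | lborel. c + a \<bullet> foot x)"
    by (intro set_integral_facet continuous_intros)
  also have "\<dots> = (\<Sum>w\<in>D. LINT x : prism | lborel. base w x * (c + a \<bullet> w))"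
    unfolding expand set_lebesgue_integral_def scaleR_sum_right
    using int by (intro Bochner_Integration.integral_sum) (simp add: set_integrable_def)
  also have "\<dots> = (\<Sum>w\<in>D. measure lebesgue prism / CARD('n) * (c + a \<bullet> w))"
    by (simp add: set_integral_base)
  also have "\<dots> = measure lebesgue prism * ((\<Sum>w\<in>D. c + a \<bullet> w) / CARD('n))"
    by (simp add: sum_distrib_left flip: sum_divide_distrib)
  finally have "(LINT x : facet | side_measure facet. c + a \<bullet> x) =
      measure (side_measure facet) facet * ((\<Sum>w\<in>D. c + a \<bullet> w) / CARD('n))"
    unfolding measure_facet .
  moreover have "measure (side_measure facet) facet \<noteq> 0"
    using measure_facet_eq norm_grad_pos measure_simplex_pos by simp
  ultimately show ?thesis
    by (simp add: side_average_def)
qed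

end

section \<open>Almost everywhere equal integrands\<close>

lemma borel_measurable_completion_cong_AE:
  assumes "AE x in completion M. f x = g x" and "g \<in> borel_measurable (completion M)"
  shows "f \<in> borel_measurable (completion M)"
proof (rule measurableI)
  fix X :: "'b set" assume X: "X \<in> sets borel"
  show "f -` X \<inter> space (completion M) \<in> sets (completion M)"
  proof (rule completion.in_sets_AE)
    show "AE x in completion M. x \<in> g -` X \<inter> space (completion M) \<longleftrightarrow>
        x \<in> f -` X \<inter> space (completion M)"
      using assms(1) by eventually_elim simp
    show "g -` X \<inter> space (completion M) \<in> sets (completion M)"
      using assms(2) X by (rule measurable_sets)
  qed simp
qed simp

lemma integral_completion_cong_AE:
  fixes f g :: "'a \<Rightarrow> 'b :: {banach, second_countable_topology}"
  assumes "AE x in completion M. f x = g x" and "g \<in> borel_measurable (completion M)"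
  shows "integral\<^sup>L (completion M) f = integral\<^sup>L (completion M) g"
  using assms borel_measurable_completion_cong_AE[OF assms] by (intro integral_cong_AE)

section \<open>Outward normals and traces\<close>

text \<open>The condition in the definition of \<open>outward_normal\<close>.\<close>

definition is_outward_normal :: "'a::euclidean_space set \<Rightarrow> 'a \<Rightarrow> 'a \<Rightarrow> bool" where
  "is_outward_normal A x n \<longleftrightarrow>
     norm n = 1 \<and> (\<exists>r>0. \<forall>z\<in>ball x r. z \<in> interior A \<longleftrightarrow> n \<bullet> (z - x) < 0)"

lemma is_outward_normal_ray:
  assumes "is_outward_normal A x n"
  obtains \<epsilon> where "\<epsilon> > 0"
    "\<And>t. 0 < t \<Longrightarrow> t < \<epsilon> \<Longrightarrow> x + t *\<^sub>R d \<in> interior A \<longleftrightarrow> n \<bullet> d < 0"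
proof -
  obtain r where r: "r > 0" "\<forall>z\<in>ball x r. z \<in> interior A \<longleftrightarrow> n \<bullet> (z - x) < 0"
    using assms by (auto simp: is_outward_normal_def)
  show thesis
  proof (rule that[of "r / (1 + norm d)"])
    have d: "0 < 1 + norm d"
      using norm_ge_zero[of d] by linarith
    then show "r / (1 + norm d) > 0"
      using r(1) by simp
    fix t :: real assume t: "0 < t" "t < r / (1 + norm d)"
    then have "t * (1 + norm d) < r"
      using d by (simp add: pos_less_divide_eq)
    then have "t * norm d < r"
      using t(1) by (simp add: distrib_left)
    then have "x + t *\<^sub>R d \<in> ball x r"
      using t by (simp add: dist_norm)
    then show "x + t *\<^sub>R d \<in> interior A \<longleftrightarrow> n \<bullet> d < 0"
      using r(2) t(1) by (auto simp: zero_less_mult_iff mult_less_0_iff)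
  qed
qed

text \<open>Inside two half-balls at the same point, a short step along \<open>d\<close> decides both memberships at
  once.\<close>

lemma common_ray_point:
  assumes A: "is_outward_normal A x n" and B: "is_outward_normal B x n'"
  obtains z where "z \<in> interior A \<longleftrightarrow> n \<bullet> d < 0" "z \<in> interior B \<longleftrightarrow> n' \<bullet> d < 0"
proof -
  obtain \<epsilon> where e: "\<epsilon> > 0"
    "\<And>t. 0 < t \<Longrightarrow> t < \<epsilon> \<Longrightarrow> x + t *\<^sub>R d \<in> interior A \<longleftrightarrow> n \<bullet> d < 0"
    by (rule is_outward_normal_ray[OF A, where d = d]) blast
  obtain \<delta> where d: "\<delta> > 0"
    "\<And>t. 0 < t \<Longrightarrow> t < \<delta> \<Longrightarrow> x + t *\<^sub>R d \<in> interior B \<longleftrightarrow> n' \<bullet> d < 0"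
    by (rule is_outward_normal_ray[OF B, where d = d]) blast
  define t where "t = min \<epsilon> \<delta> / 2"
  have "0 < t" "t < \<epsilon>" "t < \<delta>"
    using e(1) d(1) by (auto simp: t_def)
  then show thesis
    using e(2) d(2) by (intro that[of "x + t *\<^sub>R d"]) blast+
qed

text \<open>If there were a second normal \<open>n'\<close>, then the direction \<open>n' - n\<close> would point into the half-ball of
  \<open>n\<close> but not into that of \<open>n'\<close>.\<close>

lemma outward_normal_eq:
  assumes n: "is_outward_normal A x n"
  shows "outward_normal A x = n"
proof -
  have "n' = n" if n': "is_outward_normal A x n'" for n'
  proof (rule ccontr)
    assume ne: "n' \<noteq> n"
    have unit: "n \<bullet> n = 1" "n' \<bullet> n' = 1"
      using n n' by (auto simp: is_outward_normal_def norm_eq_1)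
    have "0 < (n' - n) \<bullet> (n' - n)"
      using ne by simp
    then have "n \<bullet> (n' - n) < 0" "\<not> n' \<bullet> (n' - n) < 0"
      using unit by (simp_all add: inner_diff_left inner_diff_right inner_commute)
    moreover obtain z where
      "z \<in> interior A \<longleftrightarrow> n \<bullet> (n' - n) < 0" "z \<in> interior A \<longleftrightarrow> n' \<bullet> (n' - n) < 0"
      by (rule common_ray_point[OF n n'])
    ultimately show False
      by blast
  qed
  with n have "(THE n. is_outward_normal A x n) = n"
    by (rule the_equality)
  then show ?thesis
    unfolding outward_normal_def is_outward_normal_def .
qed

text \<open>Otherwise \<open>- (n + n')\<close> points into both half-balls, which are disjoint.\<close>

lemma outward_normals_opposite:
  assumes n: "is_outward_normal A x n" and n': "is_outward_normal B x n'"
    and disjoint: "interior A \<inter> interior B = {}"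
  shows "n' = - n"
proof (rule ccontr)
  assume "n' \<noteq> - n"
  then have "n + n' \<noteq> 0"
    using eq_neg_iff_add_eq_0[of n' n] by (simp add: add.commute)
  then have "0 < (n + n') \<bullet> (n + n')"
    by simp
  moreover have "n \<bullet> n = 1" "n' \<bullet> n' = 1"
    using n n' by (auto simp: is_outward_normal_def norm_eq_1)
  ultimately have "n \<bullet> (- (n + n')) < 0" "n' \<bullet> (- (n + n')) < 0"
    by (simp_all add: inner_add_left inner_add_right inner_diff_right inner_commute)
  moreover obtain z where
    "z \<in> interior A \<longleftrightarrow> n \<bullet> (- (n + n')) < 0" "z \<in> interior B \<longleftrightarrow> n' \<bullet> (- (n + n')) < 0"
    by (rule common_ray_point[OF n n'])
  ultimately show False
    using disjoint by blast
qed

lemma trace_from_eq: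
  fixes f :: "'a::euclidean_space \<Rightarrow> 'b::t2_space"
  assumes x: "x \<in> closure (interior A)"
    and v: "\<And>z. z \<in> interior A \<Longrightarrow> v z = f z" and f: "continuous_on UNIV f"
  shows "trace_from A v x = f x"
proof -
  have "x islimpt interior A"
  proof (cases "x \<in> interior A")
    case True
    then show ?thesis
      by (intro interior_limit_point) simp
  qed (use x in \<open>simp add: closure_def\<close>)
  then have "\<not> trivial_limit (at x within interior A)"
    by (simp add: trivial_limit_within)
  moreover have "isCont f x"
    using f by (simp add: continuous_on_eq_continuous_at)
  then have "(f \<longlongrightarrow> f x) (at x within interior A)"
    unfolding continuous_within[symmetric] by (rule continuous_at_imp_continuous_at_within)
  then have "(v \<longlongrightarrow> f x) (at x within interior A)"
    by (rule Lim_transform_eventually) (auto simp: eventually_at_filter v)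
  ultimately show ?thesis
    unfolding trace_from_def by (rule tendsto_Lim)
qed

lemma trace_from_cong:
  assumes A: "is_outward_normal A x n" and B: "is_outward_normal B x n"
  shows "trace_from A v x = trace_from B v x"
proof -
  obtain r where r: "r > 0" "\<forall>z\<in>ball x r. z \<in> interior A \<longleftrightarrow> n \<bullet> (z - x) < 0"
    using A by (auto simp: is_outward_normal_def)
  obtain s where s: "s > 0" "\<forall>z\<in>ball x s. z \<in> interior B \<longleftrightarrow> n \<bullet> (z - x) < 0"
    using B by (auto simp: is_outward_normal_def)
  have "at x within interior A = at x within interior B"
    by (rule at_within_nhd[of x "ball x (min r s)"]) (use r s in auto)
  then show ?thesis
    by (simp add: trace_from_def)
qed

lemma (in simplex_facet) is_outward_normal_facet:
  assumes x: "x \<in> rel_interior facet"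
  shows "is_outward_normal (convex hull C) x \<nu>"
proof -
  have "open (\<Inter>w\<in>D. {z. 0 < bary w z})"
    using finite_D by (intro open_INT ballI open_Collect_less continuous_intros)
  moreover have "x \<in> (\<Inter>w\<in>D. {z. 0 < bary w z})"
    using x by (simp add: rel_interior_facet_eq_bary)
  ultimately obtain r where r: "r > 0" "ball x r \<subseteq> (\<Inter>w\<in>D. {z. 0 < bary w z})"
    by (rule openE)
  have "z \<in> interior (convex hull C) \<longleftrightarrow> \<nu> \<bullet> (z - x) < 0" if z: "z \<in> ball x r" for z
  proof -
    have "z \<in> interior (convex hull C) \<longleftrightarrow> 0 < bary u z"
      using r(2) z u by (auto simp: interior_eq_bary)
    also have "\<dots> \<longleftrightarrow> 0 < grad u \<bullet> (z - x)"
      using bary_diff[of u z x] x by (simp add: rel_interior_facet_eq_bary)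
    also have "\<dots> \<longleftrightarrow> \<nu> \<bullet> (z - x) < 0"
      using norm_grad_pos by (simp add: \<nu>_def zero_less_mult_iff)
    finally show ?thesis .
  qed
  then show ?thesis
    using r(1) norm_\<nu> unfolding is_outward_normal_def by blast
qed

section \<open>Green's identity on one element\<close>

context full_simplex
begin

text \<open>The identity map is the sum of the rank-one maps \<open>x \<mapsto> (grad u \<bullet> x) u\<close>.\<close>

lemma trace_eq_sum_grad:
  assumes A: "linear A"
  shows "(\<Sum>b\<in>Basis. A b \<bullet> b) = (\<Sum>u\<in>C. A u \<bullet> grad u)"
proof -
  have vector: "(\<Sum>u\<in>C. (grad u \<bullet> x) *\<^sub>R u) = x" for x
  proof -
    have "(\<Sum>u\<in>C. (grad u \<bullet> x) *\<^sub>R u) = (\<Sum>u\<in>C. bary u x *\<^sub>R u - bary u 0 *\<^sub>R u)"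
      by (intro sum.cong refl) (simp add: bary_diff flip: scaleR_left_diff_distrib)
    then show ?thesis
      by (simp add: sum_subtractf barycentric_expansion)
  qed
  have "A b \<bullet> b = (\<Sum>u\<in>C. (grad u \<bullet> b) * (A u \<bullet> b))" for b
  proof -
    have "A b = A (\<Sum>u\<in>C. (grad u \<bullet> b) *\<^sub>R u)"
      by (simp only: vector)
    also have "\<dots> = (\<Sum>u\<in>C. (grad u \<bullet> b) *\<^sub>R A u)"
      by (simp add: linear_sum[OF A] linear_scale[OF A])
    finally show ?thesis
      by (simp add: inner_sum_left)
  qed
  then have "(\<Sum>b\<in>Basis. A b \<bullet> b) = (\<Sum>u\<in>C. \<Sum>b\<in>Basis. (A u \<bullet> b) * (grad u \<bullet> b))"
    by (subst sum.swap) (simp add: mult.commute)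
  then show ?thesis
    by (simp flip: euclidean_inner)
qed

text \<open>At a vertex \<open>w\<close> of the facet opposite \<open>u\<close> the affine field has the component \<open>\<gamma> u\<close> in the direction
  \<open>grad u\<close>. As the gradients sum to zero, its component at \<open>u\<close> itself is \<open>\<gamma> u - \<Gamma>\<close> with
  \<open>\<Gamma> = (\<Sum>u\<in>C. \<gamma> u)\<close>. These components determine the field, and each term of the identity is a
  combination of \<open>\<Gamma>\<close> and the products of \<open>\<gamma>\<close> with the vertex values of the affine function.\<close>

lemma constant_normal_component_identity:
  assumes A: "linear A"
    and const: "\<And>u w. u \<in> C \<Longrightarrow> w \<in> C - {u} \<Longrightarrow> (p + A w) \<bullet> grad u = \<gamma> u"
  shows "(\<Sum>w\<in>C. a \<bullet> (p + A w)) / (CARD('n) + 1) +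
      (\<Sum>b\<in>Basis. A b \<bullet> b) * ((\<Sum>w\<in>C. c + a \<bullet> w) / (CARD('n) + 1)) =
    - (\<Sum>u\<in>C. \<gamma> u * (\<Sum>w\<in>C - {u}. c + a \<bullet> w))"
proof -
  let ?N = "real CARD('n)"
  define \<Gamma> where "\<Gamma> = (\<Sum>u\<in>C. \<gamma> u)"
  define V where "V = (\<Sum>w\<in>C. c + a \<bullet> w)"
  define W where "W = (\<Sum>u\<in>C. (c + a \<bullet> u) * \<gamma> u)"
  have Y: "(p + A w) \<bullet> grad u = \<gamma> u - of_bool (w = u) * \<Gamma>" if w: "w \<in> C" "u \<in> C" for w u
  proof (cases "w = u")
    case True
    have "(\<Sum>k\<in>C. (p + A u) \<bullet> grad k) = 0"
      by (simp add: sum_grad flip: inner_sum_right)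
    then have "(p + A u) \<bullet> grad u = - (\<Sum>k\<in>C - {u}. (p + A u) \<bullet> grad k)"
      using sum.remove[OF finite_C w(2), of "\<lambda>k. (p + A u) \<bullet> grad k"] by simp
    also have "(\<Sum>k\<in>C - {u}. (p + A u) \<bullet> grad k) = (\<Sum>k\<in>C - {u}. \<gamma> k)"
      using w by (intro sum.cong refl const) auto
    also have "\<dots> = \<Gamma> - \<gamma> u"
      using sum.remove[OF finite_C w(2), of \<gamma>] by (simp add: \<Gamma>_def)
    finally show ?thesis
      using True by simp
  next
    case False
    then have "(p + A w) \<bullet> grad u = \<gamma> u"
      using w by (intro const) auto
    then show ?thesis
      using False by simp
  qed
  have "(\<Sum>b\<in>Basis. A b \<bullet> b) = (\<Sum>u\<in>C. (p + A u) \<bullet> grad u) - p \<bullet> (\<Sum>u\<in>C. grad u)"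
    unfolding trace_eq_sum_grad[OF A] inner_sum_right
    by (simp add: inner_add_left sum.distrib)
  also have "\<dots> = (\<Sum>u\<in>C. \<gamma> u - \<Gamma>)"
    by (simp add: sum_grad Y)
  also have "\<dots> = - ?N * \<Gamma>"
    by (simp add: sum_subtractf \<Gamma>_def[symmetric] card_C algebra_simps)
  finally have div: "(\<Sum>b\<in>Basis. A b \<bullet> b) = - ?N * \<Gamma>" .
  have "a \<bullet> (p + A w) = (\<Sum>u\<in>C. (a \<bullet> u) * (\<gamma> u - of_bool (w = u) * \<Gamma>))" if w: "w \<in> C" for w
  proof -
    have "a \<bullet> (p + A w) = (p + A w) \<bullet> (\<Sum>u\<in>C. (a \<bullet> u) *\<^sub>R grad u)"
      unfolding gradient_expansion by (rule inner_commute)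
    then show ?thesis
      using w by (simp only: inner_sum_right inner_scaleR_right Y cong: sum.cong)
  qed
  then have "(\<Sum>w\<in>C. a \<bullet> (p + A w)) =
      (\<Sum>w\<in>C. \<Sum>u\<in>C. (a \<bullet> u) * (\<gamma> u - of_bool (w = u) * \<Gamma>))"
    by (intro sum.cong refl)
  also have "\<dots> = (\<Sum>u\<in>C. (a \<bullet> u) * (\<Sum>w\<in>C. \<gamma> u - of_bool (w = u) * \<Gamma>))"
    by (subst sum.swap) (simp only: sum_distrib_left)
  also have "\<dots> = (\<Sum>u\<in>C. (a \<bullet> u) * ((?N + 1) * \<gamma> u - \<Gamma>))"
  proof (intro sum.cong refl arg_cong2[where f = "(*)"])
    fix u assume "u \<in> C"
    then have "(\<Sum>w\<in>C. of_bool (w = u) * \<Gamma>) = \<Gamma>"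
      using finite_C by (simp add: of_bool_def if_distrib[of "\<lambda>t. t * \<Gamma>"] cong: if_cong)
    then show "(\<Sum>w\<in>C. \<gamma> u - of_bool (w = u) * \<Gamma>) = (?N + 1) * \<gamma> u - \<Gamma>"
      by (simp add: sum_subtractf card_C)
  qed
  \<comment> \<open>replacing \<open>a \<bullet> u\<close> by \<open>c + a \<bullet> u\<close> adds nothing, because the factors sum to zero\<close>
  also have "\<dots> = (\<Sum>u\<in>C. (?N + 1) * ((c + a \<bullet> u) * \<gamma> u) - \<Gamma> * (c + a \<bullet> u)
      - c * ((?N + 1) * \<gamma> u - \<Gamma>))"
    by (intro sum.cong refl) (simp add: algebra_simps)
  also have "\<dots> = (?N + 1) * W - \<Gamma> * V - c * ((?N + 1) * \<Gamma> - (?N + 1) * \<Gamma>)"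
    by (simp only: sum_subtractf sum_distrib_left[symmetric] W_def V_def \<Gamma>_def[symmetric]
        sum_constant card_C) simp
  finally have grad: "(\<Sum>w\<in>C. a \<bullet> (p + A w)) = (?N + 1) * W - \<Gamma> * V"
    by simp
  have "(\<Sum>u\<in>C. \<gamma> u * (\<Sum>w\<in>C - {u}. c + a \<bullet> w)) = (\<Sum>u\<in>C. V * \<gamma> u - (c + a \<bullet> u) * \<gamma> u)"
  proof (intro sum.cong refl)
    fix u assume "u \<in> C"
    then have "(\<Sum>w\<in>C - {u}. c + a \<bullet> w) = V - (c + a \<bullet> u)"
      using sum.remove[OF finite_C, of u "\<lambda>w. c + a \<bullet> w"] by (simp add: V_def)
    then show "\<gamma> u * (\<Sum>w\<in>C - {u}. c + a \<bullet> w) = V * \<gamma> u - (c + a \<bullet> u) * \<gamma> u"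
      by (simp only: right_diff_distrib mult.commute[of "\<gamma> u"])
  qed
  also have "\<dots> = V * \<Gamma> - W"
    by (simp add: sum_subtractf \<Gamma>_def W_def sum_distrib_left)
  finally have sides: "(\<Sum>u\<in>C. \<gamma> u * (\<Sum>w\<in>C - {u}. c + a \<bullet> w)) = V * \<Gamma> - W" .
  have pos: "?N + 1 \<noteq> 0"
    using of_nat_0_le_iff[of "CARD('n)"] by linarith
  have "((?N + 1) * W - \<Gamma> * V) / (?N + 1) + - ?N * \<Gamma> * (V / (?N + 1)) =
      ((?N + 1) * W - \<Gamma> * V + - ?N * \<Gamma> * V) / (?N + 1)"
    by (simp only: times_divide_eq_right add_divide_distrib)
  also have "(?N + 1) * W - \<Gamma> * V + - ?N * \<Gamma> * V = (?N + 1) * (W - V * \<Gamma>)"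
    by (simp add: algebra_simps)
  also have "(?N + 1) * (W - V * \<Gamma>) / (?N + 1) = W - V * \<Gamma>"
    using pos by simp
  finally have "((?N + 1) * W - \<Gamma> * V) / (?N + 1) + - ?N * \<Gamma> * (V / (?N + 1)) = - (V * \<Gamma> - W)"
    by simp
  then show ?thesis
    unfolding grad div sides V_def[symmetric] by (simp only: of_nat_add of_nat_1)
qed

end

lemma (in full_simplex) facets_eq: "{S. S facet_of (convex hull C)} = (\<lambda>u. convex hull (C - {u})) ` C"
  using facet_vertices_nonempty by (auto simp: facet_of_convex_hull_affine_independent[OF indep])

lemma (in full_simplex) inj_on_facets: "inj_on (\<lambda>u. convex hull (C - {u})) C"
proof (rule inj_onI)
  fix u u' assume u: "u \<in> C" "u' \<in> C" and eq: "convex hull (C - {u}) = convex hull (C - {u'})"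
  show "u = u'"
  proof (rule ccontr)
    assume "u \<noteq> u'"
    with u have "u' \<in> convex hull (C - {u'})"
      unfolding eq[symmetric] by (intro hull_inc) blast
    then have "bary u' u' = 0"
      using convex_hull_eq_bary[of "C - {u'}"] u by auto
    then show False
      using bary_vertex[OF u(2) u(2)] by simp
  qed
qed

lemma obtain_vertices:
  fixes T :: "(real ^ 'n) set"
  assumes "int CARD('n) simplex T"
  obtains C where "full_simplex C" "T = convex hull C"
proof -
  from assms obtain C where C: "\<not> affine_dependent C" "int (card C) = int CARD('n) + 1"
    and T: "T = convex hull C"
    unfolding simplex_def by blast
  have "full_simplex C"
    by unfold_locales (use C in linarith)+
  then show thesis
    using T by (rule that)
qed

lemma closure_interior_simplex:
  fixes T :: "(real ^ 'n) set"
  assumes "int CARD('n) simplex T"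
  shows "closure (interior T) = T" and "interior T \<noteq> {}" and "compact T" and "convex T"
    and "0 < measure lebesgue T"
proof -
  obtain C where C: "full_simplex C" and T: "T = convex hull C"
    by (rule obtain_vertices[OF assms])
  interpret full_simplex C by (rule C)
  show ne: "interior T \<noteq> {}" and comp: "compact T" and conv: "convex T"
    and "0 < measure lebesgue T"
    using interior_simplex_nonempty compact_simplex measure_simplex_pos by (simp_all add: T)
  show "closure (interior T) = T"
    using convex_closure_interior[OF conv ne] closure_closed[OF compact_imp_closed[OF comp]] by simp
qed

lemma AE_interior_convex:
  fixes T :: "'a::euclidean_space set"
  assumes "convex T"
  shows "AE x in lebesgue. x \<in> T \<longleftrightarrow> x \<in> interior T"
proof -
  have "frontier T \<in> null_sets lebesgue"
    using negligible_convex_frontier[OF assms] by (simp add: negligible_iff_null_sets)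
  then have "AE x in lebesgue. x \<notin> frontier T"
    by (rule AE_not_in)
  then show ?thesis
    by eventually_elim (use interior_subset closure_subset in \<open>auto simp: frontier_def\<close>)
qed

lemma set_integral_lebesgue_cong_interior:
  fixes f g :: "'a::euclidean_space \<Rightarrow> 'b::{banach, second_countable_topology}"
  assumes "convex T" "T \<in> sets lebesgue" and f: "\<And>x. x \<in> interior T \<Longrightarrow> f x = g x"
    and g: "continuous_on UNIV g"
  shows "(LINT x : T | lebesgue. f x) = (LINT x : T | lebesgue. g x)"
  unfolding set_lebesgue_integral_def
proof (rule integral_completion_cong_AE)
  show "AE x in lebesgue. indicator T x *\<^sub>R f x = indicator T x *\<^sub>R g x"
    using AE_interior_convex[OF assms(1)] by eventually_elim (auto simp: f indicator_def)
  have "g \<in> borel_measurable lebesgue"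
    using g by (intro measurable_completion) (simp add: borel_measurable_continuous_onI)
  then show "(\<lambda>x. indicator T x *\<^sub>R g x) \<in> borel_measurable lebesgue"
    using assms(2) by simp
qed

text \<open>Both sides are the integral of the divergence of \<open>v y\<close>: the left side by the product rule, where
  \<open>\<nabla>v = a\<close> and \<open>div y\<close> are constant, the right side by the divergence theorem.\<close>

proposition green_identity_element:
  fixes T :: "(real ^ 'n) set" and v :: "real ^ 'n \<Rightarrow> real" and y :: "real ^ 'n \<Rightarrow> real ^ 'n"
  assumes T: "int CARD('n) simplex T"
    and v: "\<And>x. x \<in> interior T \<Longrightarrow> v x = c + a \<bullet> x"
    and y: "\<And>x. x \<in> interior T \<Longrightarrow> y x = p + A x" and A: "linear A"
    and nt: "\<And>S x. S facet_of T \<Longrightarrow> x \<in> rel_interior S \<Longrightarrow> normal_trace T y x = nt S"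
  shows "measure lebesgue T * (element_average T y \<bullet> a + (\<Sum>b\<in>Basis. A b \<bullet> b) * element_average T v) =
    (\<Sum>S | S facet_of T. measure (side_measure S) S * (nt S * side_average S (trace_from T v)))"
proof -
  obtain C where C: "full_simplex C" and TC: "T = convex hull C"
    by (rule obtain_vertices[OF T])
  interpret full_simplex C by (rule C)
  note props = closure_interior_simplex[OF T]
  let ?m = "measure lebesgue T" and ?N = "real CARD('n)"
  have T_sets: "T \<in> sets lebesgue"
    using lmeasurable_compact[OF props(3)] by (rule fmeasurableD)
  have cont_A: "continuous_on UNIV A"
    using A by (intro linear_continuous_on) (simp add: linear_conv_bounded_linear)
  have m: "?m \<noteq> 0"
    using props(5) by simp
  have "element_average T v = (\<Sum>w\<in>C. c + a \<bullet> w) / (CARD('n) + 1)"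
  proof -
    have "(LINT x : T | lebesgue. v x) = (LINT x : T | lebesgue. c + a \<bullet> x)"
      using props(4) T_sets v
      by (rule set_integral_lebesgue_cong_interior) (auto intro!: continuous_intros)
    then show ?thesis
      using m by (simp add: element_average_def TC set_integral_affine)
  qed
  moreover have "element_average T y \<bullet> a = (\<Sum>w\<in>C. a \<bullet> (p + A w)) / (CARD('n) + 1)"
  proof -
    have affine: "(LINT x : T | lebesgue. y x) = (LINT x : T | lebesgue. p + A x)"
      using props(4) T_sets y
      by (rule set_integral_lebesgue_cong_interior) (auto intro!: continuous_intros cont_A)
    have "integrable lebesgue (\<lambda>x. indicator T x *\<^sub>R (p + A x))"
    proof -
      have "integrable lborel (\<lambda>x. indicator T x *\<^sub>R (p + A x))"
        by (intro borel_integrable_compact props continuous_intros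
            continuous_on_subset[OF cont_A subset_UNIV])
      then show ?thesis
        by (simp add: integrable_completion borel_measurable_integrable)
    qed
    then have inner: "(LINT x : T | lebesgue. p + A x) \<bullet> a =
        (\<integral>x. (indicator T x *\<^sub>R (p + A x)) \<bullet> a \<partial>lebesgue)"
      unfolding set_lebesgue_integral_def by (intro integral_inner_left[symmetric])
    have adjoint: "(indicator T x *\<^sub>R (p + A x)) \<bullet> a =
        indicator T x *\<^sub>R (p \<bullet> a + adjoint A a \<bullet> x)" for x
      using adjoint_works[OF A, of x a]
      by (simp add: inner_add_left inner_add_right inner_commute)
    have "(LINT x : T | lebesgue. y x) \<bullet> a =
        (LINT x : T | lebesgue. p \<bullet> a + adjoint A a \<bullet> x)"
      unfolding affine inner unfolding adjoint set_lebesgue_integral_def ..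
    also have "\<dots> = ?m * ((\<Sum>w\<in>C. p \<bullet> a + adjoint A a \<bullet> w) / (CARD('n) + 1))"
      unfolding TC by (rule set_integral_affine)
    also have "(\<Sum>w\<in>C. p \<bullet> a + adjoint A a \<bullet> w) = (\<Sum>w\<in>C. a \<bullet> (p + A w))"
      by (intro sum.cong refl) (simp add: adjoint_works[OF A] inner_add_right inner_commute)
    finally show ?thesis
      using m by (simp add: element_average_def)
  qed
  ultimately have average: "element_average T y \<bullet> a + (\<Sum>b\<in>Basis. A b \<bullet> b) * element_average T v =
      (\<Sum>w\<in>C. a \<bullet> (p + A w)) / (CARD('n) + 1) +
      (\<Sum>b\<in>Basis. A b \<bullet> b) * ((\<Sum>w\<in>C. c + a \<bullet> w) / (CARD('n) + 1))"
    by simp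
  let ?S = "\<lambda>u. convex hull (C - {u})"
  let ?\<gamma> = "\<lambda>u. - norm (grad u) * nt (?S u)"
  have const: "(p + A w) \<bullet> grad u = ?\<gamma> u" if u: "u \<in> C" and w: "w \<in> C - {u}" for u w
  proof -
    interpret simplex_facet C u
      by unfold_locales (rule u)
    have facet: "facet facet_of T"
      using facets_eq u by (auto simp: TC)
    have "(p + A x) \<bullet> \<nu> = nt facet" if x: "x \<in> rel_interior facet" for x
    proof -
      have "x \<in> T"
        using x rel_interior_subset facet facet_of_imp_subset by blast
      then have "trace_from T y x = p + A x"
        using props(1) y by (intro trace_from_eq continuous_intros cont_A) auto
      moreover have "outward_normal T x = \<nu>"
        unfolding TC by (rule outward_normal_eq[OF is_outward_normal_facet[OF x]])
      ultimately show ?thesis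
        using nt[OF facet x] by (simp add: normal_trace_def)
    qed
    moreover have "w \<in> closure (rel_interior facet)"
      using w by (simp add: convex_closure_rel_interior closure_closed hull_inc
          compact_imp_closed[OF compact_facet])
    moreover have "continuous_on (closure (rel_interior facet)) (\<lambda>x. (p + A x) \<bullet> \<nu>)"
      by (rule continuous_on_subset[OF _ subset_UNIV]) (intro continuous_intros cont_A)
    ultimately have "(p + A w) \<bullet> \<nu> = nt facet"
      using continuous_constant_on_closure[of "rel_interior facet" "\<lambda>x. (p + A x) \<bullet> \<nu>"] by blast
    then have "nt facet = - ((p + A w) \<bullet> grad u / norm (grad u))"
      by (simp add: \<nu>_def divide_inverse mult.commute)
    then show ?thesis
      using norm_grad_pos by simp
  qed
  have side: "measure (side_measure (?S u)) (?S u) * (nt (?S u) * side_average (?S u) (trace_from T v)) =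
      - ?m * (?\<gamma> u * (\<Sum>w\<in>C - {u}. c + a \<bullet> w))" if u: "u \<in> C" for u
  proof -
    interpret simplex_facet C u
      by unfold_locales (rule u)
    have "trace_from T v x = c + a \<bullet> x" if "x \<in> facet" for x
    proof -
      have "x \<in> T"
        using that hull_mono[of D C] by (auto simp: TC)
      then show ?thesis
        using props(1) v by (intro trace_from_eq continuous_intros) auto
    qed
    then have "indicator facet x *\<^sub>R trace_from T v x = indicator facet x *\<^sub>R (c + a \<bullet> x)" for x
      by (simp add: indicator_def)
    then have "side_average facet (trace_from T v) = side_average facet (\<lambda>x. c + a \<bullet> x)"
      unfolding side_average_def set_lebesgue_integral_def by (simp only:)
    then show ?thesis
      unfolding side_average_facet measure_facet_eq TC[symmetric] by simp
  qed
  have "(\<Sum>S | S facet_of T. measure (side_measure S) S * (nt S * side_average S (trace_from T v))) =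
      (\<Sum>u\<in>C. - ?m * (?\<gamma> u * (\<Sum>w\<in>C - {u}. c + a \<bullet> w)))"
    unfolding TC facets_eq sum.reindex[OF inj_on_facets] o_def
    using side by (intro sum.cong refl) (simp only: TC)
  also have "\<dots> = ?m * - (\<Sum>u\<in>C. ?\<gamma> u * (\<Sum>w\<in>C - {u}. c + a \<bullet> w))"
    by (simp add: sum_distrib_left sum_negf)
  also have "- (\<Sum>u\<in>C. ?\<gamma> u * (\<Sum>w\<in>C - {u}. c + a \<bullet> w)) =
      element_average T y \<bullet> a + (\<Sum>b\<in>Basis. A b \<bullet> b) * element_average T v"
    unfolding average by (rule constant_normal_component_identity[OF A const, symmetric])
  finally show ?thesis ..
qed

section \<open>Sides of the triangulation\<close>

text \<open>Let \<open>p\<close> be a boundary point. The point \<open>p - t e\<close> lies strictly below the graph, and so do all points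
  near it; hence it is not in the closure of the domain, although it is arbitrarily close to \<open>p\<close>.\<close>

lemma interior_closure_lipschitz_domain:
  assumes "lipschitz_domain \<Omega>"
  shows "interior (closure \<Omega>) = \<Omega>"
proof (intro subset_antisym subsetI)
  have op: "open \<Omega>"
    using assms by (simp add: lipschitz_domain_def)
  show "x \<in> interior (closure \<Omega>)" if "x \<in> \<Omega>" for x
    using that op by (meson closure_subset interior_maximal subsetD)
  fix p assume p: "p \<in> interior (closure \<Omega>)"
  show "p \<in> \<Omega>"
  proof (rule ccontr)
    assume "p \<notin> \<Omega>"
    then have "p \<in> frontier \<Omega>"
      using p interior_subset op by (auto simp: frontier_def interior_open)
    then obtain r e \<gamma> L where r: "r > 0" and e: "norm e = 1" and \<gamma>: "L-lipschitz_on UNIV \<gamma>"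
      and graph: "\<Omega> \<inter> ball p r = {x \<in> ball p r. \<gamma> (x - (x \<bullet> e) *\<^sub>R e) < x \<bullet> e}"
      using assms unfolding lipschitz_domain_def by blast
    obtain s where s: "s > 0" "ball p s \<subseteq> closure \<Omega>"
      using p by (auto simp: mem_interior)
    define t where "t = min r s / 2"
    have t: "0 < t" "t < r" "t < s"
      using r s by (auto simp: t_def)
    have ee: "e \<bullet> e = 1"
      using e by (simp add: norm_eq_1)
    let ?q = "p - t *\<^sub>R e"
    let ?U = "{x. x \<bullet> e < \<gamma> (x - (x \<bullet> e) *\<^sub>R e)} \<inter> ball p r"
    have graph': "x \<in> \<Omega> \<longleftrightarrow> \<gamma> (x - (x \<bullet> e) *\<^sub>R e) < x \<bullet> e" if "x \<in> ball p r" for x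
      using graph that by blast
    have dist: "dist p ?q = t"
      using t e by (simp add: dist_norm)
    have cont: "continuous_on UNIV \<gamma>"
      using \<gamma> by (rule lipschitz_on_continuous_on)
    have "open ?U"
      by (intro open_Int open_Collect_less continuous_intros open_ball
          continuous_on_compose2[OF cont]) simp_all
    moreover have "?q \<in> ?U"
    proof -
      have "\<not> \<gamma> (p - (p \<bullet> e) *\<^sub>R e) < p \<bullet> e"
        using graph'[of p] \<open>p \<notin> \<Omega>\<close> r by simp
      moreover have qe: "?q \<bullet> e = p \<bullet> e - t"
        by (simp add: inner_diff_left ee)
      moreover have qpe: "?q - (?q \<bullet> e) *\<^sub>R e = p - (p \<bullet> e) *\<^sub>R e"
        unfolding qe by (simp add: scaleR_left_diff_distrib)
      ultimately have "?q \<bullet> e < \<gamma> (?q - (?q \<bullet> e) *\<^sub>R e)"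
        using t(1) unfolding qpe unfolding qe by linarith
      moreover have "?q \<in> ball p r"
        using dist t(2) by (simp only: mem_ball)
      ultimately show ?thesis
        by blast
    qed
    moreover have "?U \<inter> \<Omega> = {}"
    proof -
      have False if "x \<in> ?U" "x \<in> \<Omega>" for x
        using that graph'[of x] by simp
      then show ?thesis by blast
    qed
    ultimately have "?q \<notin> closure \<Omega>"
      using open_Int_closure_eq_empty by blast
    then show False
      using s(2) dist t(3) by (metis mem_ball subsetD)
  qed
qed

locale mesh =
  fixes \<Omega> :: "(real ^ 'n) set" and \<T> :: "(real ^ 'n) set set"
  assumes lipschitz: "lipschitz_domain \<Omega>" and triangulates: "triangulation_of \<T> \<Omega>"
begin

lemma finite_\<T>: "finite \<T>"
  and simplex_\<T>: "T \<in> \<T> \<Longrightarrow> int CARD('n) simplex T"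
  and Union_\<T>: "\<Union>\<T> = closure \<Omega>"
  and Int_face: "T \<in> \<T> \<Longrightarrow> T' \<in> \<T> \<Longrightarrow> T \<inter> T' face_of T"
  using triangulates by (simp_all add: triangulation_of_def triangulation_def)

lemma open_\<Omega>: "open \<Omega>"
  using lipschitz by (simp add: lipschitz_domain_def)

lemma aff_dim_\<T>: "T \<in> \<T> \<Longrightarrow> aff_dim T = CARD('n)"
  using simplex_\<T> aff_dim_simplex by blast

lemma convex_\<T>: "T \<in> \<T> \<Longrightarrow> convex T" and closed_\<T>: "T \<in> \<T> \<Longrightarrow> closed T"
  using simplex_\<T> closure_interior_simplex(3,4) compact_imp_closed by blast+

lemma interior_subset_\<Omega>: "T \<in> \<T> \<Longrightarrow> interior T \<subseteq> \<Omega>"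
  using interior_closure_lipschitz_domain[OF lipschitz] Union_\<T> interior_mono[of T "closure \<Omega>"]
  by auto

lemma Int_ne_element:
  assumes "T \<in> \<T>" "T' \<in> \<T>" "T \<noteq> T'"
  shows "T \<inter> T' \<noteq> T"
proof
  assume "T \<inter> T' = T"
  then have "T face_of T'"
    using Int_face[of T' T] assms by (simp add: Int_commute)
  then have "aff_dim T < aff_dim T'"
    using assms convex_\<T> by (intro face_of_aff_dim_lt)
  then show False
    using assms aff_dim_\<T> by simp
qed

lemma interiors_disjoint:
  assumes "T \<in> \<T>" "T' \<in> \<T>" "T \<noteq> T'"
  shows "interior T \<inter> interior T' = {}"
  using face_of_disjoint_interior[OF Int_face Int_ne_element, of T T'] assms
    interior_subset[of T] interior_subset[of T'] by blast

text \<open>The intersection of the two elements is a proper face of \<open>T\<close> that meets the relative interior of \<open>S\<close>.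
  So it contains \<open>S\<close>, and for dimensional reasons it equals \<open>S\<close>.\<close>

lemma facet_of_neighbour:
  assumes T: "T \<in> \<T>" "T' \<in> \<T>" "T \<noteq> T'" and S: "S facet_of T"
    and x: "x \<in> rel_interior S" "x \<in> T'"
  shows "S facet_of T'"
proof -
  let ?F = "T \<inter> T'"
  have F: "?F face_of T"
    using Int_face T by blast
  have S': "S face_of T" "S \<noteq> {}" "aff_dim S = int CARD('n) - 1"
    using S aff_dim_\<T>[OF T(1)] by (auto simp: facet_of_def)
  have ST: "S \<subseteq> T"
    using S facet_of_imp_subset by blast
  have "S \<subseteq> ?F"
    using F ST
  proof (rule subset_of_face_of)
    show "?F \<inter> rel_interior S \<noteq> {}"
      using x ST rel_interior_subset by blast
  qed
  then have SF: "S face_of ?F"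
    by (rule face_of_subset[OF S'(1)]) (rule Int_lower1)
  have "aff_dim ?F < CARD('n)"
    using face_of_aff_dim_lt[OF convex_\<T>[OF T(1)] F Int_ne_element[OF T]] aff_dim_\<T>[OF T(1)] by simp
  moreover have "aff_dim S < aff_dim ?F" if "S \<noteq> ?F"
    using that SF convex_\<T> T by (blast intro: face_of_aff_dim_lt convex_Int)
  ultimately have "S = ?F"
    using S'(3) by linarith
  then have "S = T' \<inter> T"
    by blast
  then have "S face_of T'"
    using Int_face T by blast
  then show ?thesis
    using S' aff_dim_\<T>[OF T(2)] by (simp add: facet_of_def)
qed

lemma facet_normal:
  assumes T: "T \<in> \<T>" and S: "S facet_of T"
  obtains n where "\<And>x. x \<in> rel_interior S \<Longrightarrow> is_outward_normal T x n"
proof -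
  obtain C where C: "full_simplex C" and TC: "T = convex hull C"
    by (rule obtain_vertices[OF simplex_\<T>[OF T]])
  interpret full_simplex C by (rule C)
  obtain u where u: "u \<in> C" and Su: "S = convex hull (C - {u})"
    using facets_eq S by (auto simp: TC)
  interpret simplex_facet C u
    by unfold_locales (rule u)
  show thesis
    by (rule that[of \<nu>]) (simp only: TC Su is_outward_normal_facet)
qed

lemma facet_convex_closed:
  assumes T: "T \<in> \<T>" and S: "S facet_of T"
  shows "convex S" and "closed S" and "rel_interior S \<noteq> {}" and "closure (rel_interior S) = S"
proof -
  have face: "S face_of T" "S \<noteq> {}"
    using S by (auto simp: facet_of_def)
  show conv: "convex S"
    using face face_of_imp_convex by blast
  show closed: "closed S"
    using face_of_imp_closed[OF convex_\<T>[OF T] closed_\<T>[OF T]] face by blast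
  show "rel_interior S \<noteq> {}"
    using conv face by (simp add: rel_interior_eq_empty)
  show "closure (rel_interior S) = S"
    using conv closed by (simp add: convex_closure_rel_interior closure_closed)
qed

lemma finite_facets: "T \<in> \<T> \<Longrightarrow> finite {S. S facet_of T}"
proof -
  assume "T \<in> \<T>"
  then obtain C where C: "full_simplex C" and TC: "T = convex hull C"
    using obtain_vertices[OF simplex_\<T>] by metis
  interpret full_simplex C by (rule C)
  show ?thesis
    unfolding TC facets_eq using finite_C by simp
qed

lemma finite_sides: "finite (sides \<T>)"
proof -
  have "sides \<T> = (\<Union>T\<in>\<T>. {S. S facet_of T})"
    by (auto simp: sides_def)
  then show ?thesis
    using finite_\<T> finite_facets by simp
qed

lemma opposite_normals:
  assumes T: "T \<in> \<T>" "T' \<in> \<T>" "T \<noteq> T'"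
    and n: "is_outward_normal T x n" and n': "is_outward_normal T' x n'"
  shows "n' = - n"
  using outward_normals_opposite[OF n n' interiors_disjoint[OF T]] .

text \<open>The outward normals of three such elements would be pairwise opposite.\<close>

lemma at_most_two_elements:
  assumes T: "T1 \<in> \<T>" "T2 \<in> \<T>" "T3 \<in> \<T>" "T1 \<noteq> T2" "T1 \<noteq> T3" "T2 \<noteq> T3"
    and S: "S facet_of T1" "S facet_of T2" "S facet_of T3"
  shows False
proof -
  obtain x where x: "x \<in> rel_interior S"
    using facet_convex_closed(3)[OF T(1) S(1)] by blast
  obtain n1 where n1: "is_outward_normal T1 x n1"
    using facet_normal[OF T(1) S(1)] x by metis
  obtain n2 where n2: "is_outward_normal T2 x n2"
    using facet_normal[OF T(2) S(2)] x by metis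
  obtain n3 where n3: "is_outward_normal T3 x n3"
    using facet_normal[OF T(3) S(3)] x by metis
  have "n2 = - n1" "n3 = - n1" "n3 = - n2"
    using opposite_normals[OF T(1,2,4) n1 n2] opposite_normals[OF T(1,3,5) n1 n3]
      opposite_normals[OF T(2,3,6) n2 n3] by auto
  then have "n1 = - n1"
    by (metis minus_minus)
  then have "n1 + n1 = 0"
    by (metis add.right_inverse)
  then have "2 *\<^sub>R n1 = 0"
    by (simp only: scaleR_2)
  then have "n1 = 0"
    by simp
  then show False
    using n1 by (simp add: is_outward_normal_def)
qed

text \<open>The two elements fill the two open half-balls at \<open>x\<close>, and the dividing hyperplane consists of limits
  of points of these. So \<open>x\<close> is interior to the closure of \<open>\<Omega>\<close>.\<close>

lemma shared_facet_in_domain: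
  assumes T: "T \<in> \<T>" "T' \<in> \<T>" "T \<noteq> T'" and S: "S facet_of T" "S facet_of T'"
    and x: "x \<in> rel_interior S"
  shows "x \<in> \<Omega>"
proof -
  obtain n where n: "is_outward_normal T x n"
    using facet_normal[OF T(1) S(1)] x by metis
  obtain n' where n': "is_outward_normal T' x n'"
    using facet_normal[OF T(2) S(2)] x by metis
  have "n' = - n"
    by (rule opposite_normals[OF T n n'])
  obtain r where r: "r > 0" "\<forall>z\<in>ball x r. z \<in> interior T \<longleftrightarrow> n \<bullet> (z - x) < 0"
    using n by (auto simp: is_outward_normal_def)
  obtain s where s: "s > 0" "\<forall>z\<in>ball x s. z \<in> interior T' \<longleftrightarrow> n' \<bullet> (z - x) < 0"
    using n' by (auto simp: is_outward_normal_def)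
  define \<rho> where "\<rho> = min r s"
  have off: "z \<in> closure \<Omega>" if z: "z \<in> ball x \<rho>" and nz: "n \<bullet> (z - x) \<noteq> 0" for z
  proof -
    have "z \<in> ball x r" "z \<in> ball x s"
      using z by (simp_all add: \<rho>_def)
    then have "z \<in> interior T \<or> z \<in> interior T'"
      using r(2) s(2) nz by (auto simp: \<open>n' = - n\<close>)
    then show ?thesis
      using interior_subset_\<Omega> T closure_subset by blast
  qed
  have unit: "norm n = 1" "n \<bullet> n = 1"
    using n by (auto simp: is_outward_normal_def norm_eq_1)
  have "z \<in> closure \<Omega>" if z: "z \<in> ball x \<rho>" for z
  proof (cases "n \<bullet> (z - x) = 0")
    case True
    \<comment> \<open>a small step along the normal leaves the dividing hyperplane\<close>
    have "\<exists>y\<in>closure \<Omega>. dist y z < e" if e: "e > 0" for e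
    proof -
      define t where "t = min e (\<rho> - dist x z) / 2"
      have t: "0 < t" "t < e" "t < \<rho> - dist x z"
        using e z by (auto simp: t_def)
      have "dist x (z + t *\<^sub>R n) \<le> dist x z + t"
        using dist_triangle[of x "z + t *\<^sub>R n" z] t(1) unit by (simp add: dist_norm)
      then have "z + t *\<^sub>R n \<in> ball x \<rho>"
        using t by simp
      moreover have "n \<bullet> (z + t *\<^sub>R n - x) = n \<bullet> (z - x) + t"
        using unit by (simp add: inner_add_right inner_diff_right)
      then have "n \<bullet> (z + t *\<^sub>R n - x) \<noteq> 0"
        using True t by simp
      ultimately have "z + t *\<^sub>R n \<in> closure \<Omega>"
        by (rule off)
      moreover have "dist (z + t *\<^sub>R n) z < e"
        using t unit by (simp add: dist_norm)
      ultimately show ?thesis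
        by blast
    qed
    then show ?thesis
      by (metis closure_approachable closure_closure)
  qed (rule off[OF z])
  moreover have "\<rho> > 0"
    using r s by (simp add: \<rho>_def)
  ultimately have "x \<in> interior (closure \<Omega>)"
    by (auto simp: mem_interior)
  then show ?thesis
    by (simp add: interior_closure_lipschitz_domain[OF lipschitz])
qed

text \<open>Near \<open>x\<close> no other element is present, so \<open>\<Omega>\<close> coincides with the interior of \<open>T\<close> there.\<close>

lemma unshared_facet_normal:
  assumes T: "T \<in> \<T>" and S: "S facet_of T"
    and unique: "\<And>T'. T' \<in> \<T> \<Longrightarrow> S facet_of T' \<Longrightarrow> T' = T"
    and x: "x \<in> rel_interior S" and n: "is_outward_normal T x n"
  shows "is_outward_normal \<Omega> x n" and "x \<in> frontier \<Omega>"
proof -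
  let ?K = "\<Union>(\<T> - {T})"
  have "x \<notin> ?K"
    using facet_of_neighbour[OF T _ _ S x] unique by blast
  moreover have "closed ?K"
    using finite_\<T> closed_\<T> by (intro closed_Union) auto
  ultimately obtain s where s: "s > 0" "ball x s \<subseteq> - ?K"
    using openE[of "- ?K" x] by auto
  obtain r where r: "r > 0" "\<forall>z\<in>ball x r. z \<in> interior T \<longleftrightarrow> n \<bullet> (z - x) < 0"
    using n by (auto simp: is_outward_normal_def)
  have "closure \<Omega> \<inter> ball x s = T \<inter> ball x s"
    using s(2) T unfolding Union_\<T>[symmetric] by blast
  then have "interior (closure \<Omega>) \<inter> ball x s = interior T \<inter> ball x s"
    by (metis interior_Int interior_ball)
  then have "\<Omega> \<inter> ball x s = interior T \<inter> ball x s"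
    by (simp add: interior_closure_lipschitz_domain[OF lipschitz])
  then have same: "z \<in> \<Omega> \<longleftrightarrow> z \<in> interior T" if "z \<in> ball x s" for z
    using that by blast
  have half: "\<forall>z\<in>ball x (min r s). z \<in> interior \<Omega> \<longleftrightarrow> n \<bullet> (z - x) < 0"
  proof
    fix z assume "z \<in> ball x (min r s)"
    then have "z \<in> ball x r" "z \<in> ball x s"
      by simp_all
    then show "z \<in> interior \<Omega> \<longleftrightarrow> n \<bullet> (z - x) < 0"
      unfolding interior_open[OF open_\<Omega>] same[OF \<open>z \<in> ball x s\<close>] using r(2) by blast
  qed
  moreover have "min r s > 0"
    using r(1) s(1) by simp
  ultimately show "is_outward_normal \<Omega> x n"
    using n unfolding is_outward_normal_def by blast
  have "x \<notin> interior \<Omega>"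
    using half \<open>min r s > 0\<close> by auto
  moreover have "x \<in> closure \<Omega>"
    using x rel_interior_subset facet_of_imp_subset[OF S] T Union_\<T> by blast
  ultimately show "x \<in> frontier \<Omega>"
    by (simp add: frontier_def)
qed

lemma boundary_side_unshared:
  assumes S: "S \<in> boundary_sides \<T> \<Omega>" and T: "T \<in> \<T>" "S facet_of T" "T' \<in> \<T>" "S facet_of T'"
  shows "T' = T"
proof (rule ccontr)
  assume ne: "T' \<noteq> T"
  obtain x where x: "x \<in> rel_interior S"
    using facet_convex_closed(3)[OF T(1,2)] by blast
  then have "x \<in> \<Omega>"
    using shared_facet_in_domain[OF T(1,3) _ T(2,4)] ne by blast
  moreover have "x \<in> frontier \<Omega>"
    using S x rel_interior_subset by (auto simp: boundary_sides_def)
  ultimately show False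
    using open_\<Omega> by (simp add: frontier_def interior_open)
qed

lemma unshared_boundary_side:
  assumes T: "T \<in> \<T>" and S: "S facet_of T"
    and unique: "\<And>T'. T' \<in> \<T> \<Longrightarrow> S facet_of T' \<Longrightarrow> T' = T"
  shows "S \<in> boundary_sides \<T> \<Omega>"
proof -
  obtain n where n: "\<And>x. x \<in> rel_interior S \<Longrightarrow> is_outward_normal T x n"
    using facet_normal[OF T S] by blast
  have "rel_interior S \<subseteq> frontier \<Omega>"
    using unshared_facet_normal(2)[OF T S unique _ n] by blast
  then have "closure (rel_interior S) \<subseteq> frontier \<Omega>"
    by (rule closure_minimal) simp
  then have "S \<subseteq> frontier \<Omega>"
    by (simp add: facet_convex_closed(4)[OF T S])
  then show ?thesis
    using T S by (auto simp: boundary_sides_def sides_def)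
qed

lemma shared_interior_side:
  assumes T: "T \<in> \<T>" "T' \<in> \<T>" "T \<noteq> T'" and S: "S facet_of T" "S facet_of T'"
  shows "S \<in> interior_sides \<T> \<Omega>"
  using shared_facet_in_domain[OF T S] T S by (auto simp: interior_sides_def sides_def)

lemma rel_interior_sides_disjoint:
  assumes S: "S \<in> sides \<T>" "S' \<in> sides \<T>" and x: "x \<in> rel_interior S" "x \<in> rel_interior S'"
  shows "S = S'"
proof -
  obtain T T' where T: "T \<in> \<T>" "S facet_of T" "T' \<in> \<T>" "S' facet_of T'"
    using S by (auto simp: sides_def)
  have "x \<in> T'"
    using x rel_interior_subset facet_of_imp_subset[OF T(4)] by blast
  then have "S facet_of T'"
    using facet_of_neighbour[OF T(1,3) _ T(2) x(1)] T(2) by blast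
  then show ?thesis
    using T(4) x face_of_eq[of S T' S'] by (auto simp: facet_of_def)
qed

text \<open>Meant for boundary sides, where there is only one such element.\<close>

definition element :: "(real ^ 'n) set \<Rightarrow> (real ^ 'n) set" where
  "element S = (SOME T. T \<in> \<T> \<and> S facet_of T)"

lemma element:
  assumes "S \<in> sides \<T>"
  shows "element S \<in> \<T>" and "S facet_of element S"
  using someI_ex[of "\<lambda>T. T \<in> \<T> \<and> S facet_of T"] assms by (auto simp: sides_def element_def)

lemma sum_facets_eq_sum_boundary_sides:
  fixes Z :: "(real ^ 'n) set \<Rightarrow> (real ^ 'n) set \<Rightarrow> real"
  assumes cancel: "\<And>S T T'. S \<in> interior_sides \<T> \<Omega> \<Longrightarrow> T \<in> \<T> \<Longrightarrow> T' \<in> \<T> \<Longrightarrow> T \<noteq> T' \<Longrightarrow>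
    S facet_of T \<Longrightarrow> S facet_of T' \<Longrightarrow> Z T S + Z T' S = 0"
  shows "(\<Sum>T\<in>\<T>. \<Sum>S | S facet_of T. Z T S) = (\<Sum>S\<in>boundary_sides \<T> \<Omega>. Z (element S) S)"
proof -
  have "(\<Sum>T\<in>\<T>. \<Sum>S | S facet_of T. Z T S) = (\<Sum>T\<in>\<T>. \<Sum>S | S \<in> sides \<T> \<and> S facet_of T. Z T S)"
    by (intro sum.cong refl) (auto simp: sides_def)
  also have "\<dots> = (\<Sum>S\<in>sides \<T>. \<Sum>T | T \<in> \<T> \<and> S facet_of T. Z T S)"
    by (rule sum.swap_restrict[OF finite_\<T> finite_sides])
  also have "\<dots> = (\<Sum>S\<in>sides \<T>. if S \<in> boundary_sides \<T> \<Omega> then Z (element S) S else 0)"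
  proof (intro sum.cong refl)
    fix S assume S: "S \<in> sides \<T>"
    note E = element[OF S]
    show "(\<Sum>T | T \<in> \<T> \<and> S facet_of T. Z T S) =
        (if S \<in> boundary_sides \<T> \<Omega> then Z (element S) S else 0)"
    proof (cases "S \<in> boundary_sides \<T> \<Omega>")
      case True
      then have "{T. T \<in> \<T> \<and> S facet_of T} = {element S}"
        using E boundary_side_unshared[OF True E] by blast
      then show ?thesis
        using True by simp
    next
      case False
      then obtain T where T: "T \<in> \<T>" "S facet_of T" "T \<noteq> element S"
        using unshared_boundary_side[OF E] by blast
      then have "{T. T \<in> \<T> \<and> S facet_of T} = {element S, T}"
        using at_most_two_elements[OF E(1) T(1) _ _ _ _ E(2) T(2)] E by blast
      moreover have "Z (element S) S + Z T S = 0"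
        using E T shared_interior_side[OF E(1) T(1) _ E(2) T(2)] by (intro cancel) auto
      ultimately show ?thesis
        using False T(3) by simp
    qed
  qed
  also have "\<dots> = (\<Sum>S\<in>boundary_sides \<T> \<Omega>. Z (element S) S)"
    using finite_sides by (subst sum.inter_filter[symmetric]) (auto simp: boundary_sides_def intro!: sum.cong)
  finally show ?thesis .
qed

end

section \<open>Integrals of element-wise and side-wise constant functions\<close>

lemma ereal_integral_eq:
  assumes F: "AE x in M. F x = ereal (q x)" and q: "integrable M q"
  shows "ereal_integral M F = ereal (integral\<^sup>L M q)"
proof -
  have e2: "e2ennreal (ereal r) = ennreal r" for r
    by (simp add: ennreal.abs_eq e2ennreal_def ennreal_def)
  have pos: "(\<integral>\<^sup>+ x. e2ennreal (F x) \<partial>M) = (\<integral>\<^sup>+ x. ennreal (q x) \<partial>M)"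
    using F by (intro nn_integral_cong_AE) (auto simp: e2)
  have neg: "(\<integral>\<^sup>+ x. e2ennreal (- F x) \<partial>M) = (\<integral>\<^sup>+ x. ennreal (- q x) \<partial>M)"
    using F by (intro nn_integral_cong_AE) (auto simp: e2)
  have fin: "enn2ereal t = ereal (enn2real t)" if "t \<noteq> \<infinity>" for t
    using that by (cases t) (auto simp: enn2ereal_ennreal)
  have "(\<integral>\<^sup>+ x. ennreal (q x) \<partial>M) \<noteq> \<infinity>" "(\<integral>\<^sup>+ x. ennreal (- q x) \<partial>M) \<noteq> \<infinity>"
    using q by (simp_all add: real_integrable_def)
  then show ?thesis
    unfolding ereal_integral_def pos neg by (simp add: fin real_lebesgue_integral_def[OF q])
qed

lemma side_average_cong: "(\<And>x. x \<in> S \<Longrightarrow> q x = q' x) \<Longrightarrow> side_average S q = side_average S q'"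
proof -
  assume "\<And>x. x \<in> S \<Longrightarrow> q x = q' x"
  then have "indicator S x *\<^sub>R q x = indicator S x *\<^sub>R q' x" for x
    by (simp add: indicator_def)
  then show ?thesis
    by (simp only: side_average_def set_lebesgue_integral_def)
qed

lemma gradient_affine:
  fixes a :: "'a :: euclidean_space"
  assumes x: "x \<in> interior T" and v: "\<And>z. z \<in> interior T \<Longrightarrow> v z = c + a \<bullet> z"
  shows "gradient v x = a"
proof -
  have "((\<lambda>z. c + a \<bullet> z) has_derivative (\<lambda>h. a \<bullet> h)) (at x)"
    by (auto intro!: derivative_eq_intros)
  then have "(v has_derivative (\<lambda>h. a \<bullet> h)) (at x)"
    by (rule has_derivative_transform_within_open[OF _ open_interior x]) (simp add: v)
  then have "frechet_derivative v (at x) = (\<lambda>h. a \<bullet> h)"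
    by (rule frechet_derivative_at[symmetric])
  then show ?thesis
    by (simp add: gradient_def euclidean_representation)
qed

lemma divergence_affine:
  fixes A :: "'a :: euclidean_space \<Rightarrow> 'a"
  assumes x: "x \<in> interior T" and y: "\<And>z. z \<in> interior T \<Longrightarrow> y z = p + A z" and A: "linear A"
  shows "divergence y x = (\<Sum>b\<in>Basis. A b \<bullet> b)"
proof -
  have "(A has_derivative A) (at x)"
    by (rule linear_imp_has_derivative[OF A])
  then have "((\<lambda>z. p + A z) has_derivative A) (at x)"
    by (auto intro!: derivative_eq_intros)
  then have "(y has_derivative A) (at x)"
    by (rule has_derivative_transform_within_open[OF _ open_interior x]) (simp add: y)
  then have "frechet_derivative y (at x) = A"
    by (rule frechet_derivative_at[symmetric])
  then show ?thesis
    by (simp add: divergence_def)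
qed

lemma affine_if_components_affine:
  fixes y :: "'a :: euclidean_space \<Rightarrow> 'a"
  assumes "\<And>b. b \<in> Basis \<Longrightarrow> \<exists>c a. \<forall>x\<in>U. y x \<bullet> b = c + a \<bullet> x"
  shows "\<exists>p A. linear A \<and> (\<forall>x\<in>U. y x = p + A x)"
proof -
  obtain c a where ca: "\<And>b x. b \<in> Basis \<Longrightarrow> x \<in> U \<Longrightarrow> y x \<bullet> b = c b + a b \<bullet> x"
    using assms by metis
  define A where "A x = (\<Sum>b\<in>Basis. (a b \<bullet> x) *\<^sub>R b)" for x
  have "linear A"
    by (rule linearI)
      (simp_all add: A_def inner_add_right scaleR_left_distrib sum.distrib scaleR_sum_right)
  moreover have "y x = (\<Sum>b\<in>Basis. c b *\<^sub>R b) + A x" if "x \<in> U" for x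
  proof -
    have "y x = (\<Sum>b\<in>Basis. (y x \<bullet> b) *\<^sub>R b)"
      by (rule euclidean_representation[symmetric])
    also have "\<dots> = (\<Sum>b\<in>Basis. c b *\<^sub>R b + (a b \<bullet> x) *\<^sub>R b)"
      using ca[OF _ that] by (intro sum.cong refl) (simp add: scaleR_left_distrib)
    finally show ?thesis
      by (simp only: A_def sum.distrib)
  qed
  ultimately show ?thesis
    by blast
qed

context mesh
begin

lemma AE_element_interiors: "AE x in lebesgue. x \<in> \<Omega> \<longrightarrow> (\<exists>T\<in>\<T>. x \<in> interior T)"
proof -
  have "AE x in lebesgue. \<forall>T\<in>\<T>. x \<in> T \<longleftrightarrow> x \<in> interior T"
    using finite_\<T> AE_interior_convex[OF convex_\<T>] by (simp add: AE_finite_all)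
  then show ?thesis
  proof eventually_elim
    case (elim x)
    then show ?case
      using closure_subset[of \<Omega>] Union_\<T> by blast
  qed
qed

lemma \<Omega>_sets: "\<Omega> \<inter> space lebesgue \<in> sets lebesgue"
  using open_\<Omega> by (simp add: sets_completionI_sets)

lemma AE_lebesgue_on_\<Omega>: "(AE x in lebesgue_on \<Omega>. P x) \<longleftrightarrow> (AE x in lebesgue. x \<in> \<Omega> \<longrightarrow> P x)"
  by (rule AE_restrict_space_iff[OF \<Omega>_sets])

text \<open>Element-wise constant identities that hold almost everywhere thus hold on every element.\<close>

lemma AE_imp_ex_interior:
  assumes P: "AE x in lebesgue_on \<Omega>. P x" and T: "T \<in> \<T>"
  shows "\<exists>x\<in>interior T. P x"
proof (rule ccontr)
  assume "\<not> (\<exists>x\<in>interior T. P x)"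
  moreover have "AE x in lebesgue. x \<in> \<Omega> \<longrightarrow> P x"
    using P by (simp only: AE_lebesgue_on_\<Omega>)
  ultimately have "AE x in lebesgue. x \<notin> interior T"
    using interior_subset_\<Omega>[OF T] by (elim AE_mp) (auto intro!: AE_I2)
  moreover have "interior T \<in> sets lebesgue"
    by (simp add: sets_completionI_sets)
  ultimately have "interior T \<in> null_sets lebesgue"
    by (simp add: AE_iff_null_sets)
  then show False
    using open_not_negligible[OF open_interior closure_interior_simplex(2)[OF simplex_\<T>[OF T]]]
    by (simp add: negligible_iff_null_sets)
qed

lemma sum_indicator_interior:
  fixes k :: "(real ^ 'n) set \<Rightarrow> 'b :: real_vector"
  assumes T: "T \<in> \<T>" and x: "x \<in> interior T"
  shows "(\<Sum>T'\<in>\<T>. indicator (interior T') x *\<^sub>R k T') = k T"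
proof -
  have "x \<notin> interior T'" if "T' \<in> \<T>" "T' \<noteq> T" for T'
    using interiors_disjoint[OF T that(1)] that(2) x by blast
  then have "(\<Sum>T'\<in>\<T>. indicator (interior T') x *\<^sub>R k T') = (\<Sum>T'\<in>\<T>. if T' = T then k T' else 0)"
    using x by (intro sum.cong refl) (auto simp: indicator_def)
  then show ?thesis
    using T finite_\<T> by simp
qed

lemma element_projection_interior:
  "T \<in> \<T> \<Longrightarrow> x \<in> interior T \<Longrightarrow> element_projection \<T> q x = element_average T q"
  unfolding element_projection_def by (rule sum_indicator_interior)

lemma gradient_h_interior: "T \<in> \<T> \<Longrightarrow> x \<in> interior T \<Longrightarrow> gradient_h \<T> v x = gradient v x"
  unfolding gradient_h_def by (rule sum_indicator_interior)

lemma
  fixes q :: "real ^ 'n \<Rightarrow> real"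
  assumes q: "\<And>T x. T \<in> \<T> \<Longrightarrow> x \<in> interior T \<Longrightarrow> q x = k T"
  shows integrable_elementwise_constant: "integrable (lebesgue_on \<Omega>) q"
    and integral_elementwise_constant:
      "(LINT x | lebesgue_on \<Omega>. q x) = (\<Sum>T\<in>\<T>. measure lebesgue T * k T)"
proof -
  let ?g = "\<lambda>x. \<Sum>T\<in>\<T>. indicator (interior T) x *\<^sub>R k T"
  have AE: "AE x in lebesgue. indicator \<Omega> x *\<^sub>R q x = ?g x"
    using AE_element_interiors
  proof eventually_elim
    case (elim x)
    show ?case
    proof (cases "x \<in> \<Omega>")
      case True
      then obtain T where T: "T \<in> \<T>" "x \<in> interior T"
        using elim by blast
      show ?thesis
        unfolding sum_indicator_interior[OF T] using True q[OF T] by simp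
    next
      case False
      then have "x \<notin> interior T" if "T \<in> \<T>" for T
        using interior_subset_\<Omega> that by blast
      then have "?g x = 0"
        by (intro sum.neutral) simp
      then show ?thesis
        using False by simp
    qed
  qed
  have fin: "interior T \<in> lmeasurable" and meas: "measure lebesgue (interior T) = measure lebesgue T"
    if T: "T \<in> \<T>" for T
  proof -
    have "bounded (interior T)"
      using closure_interior_simplex(3)[OF simplex_\<T>[OF T]] interior_subset
      by (meson bounded_subset compact_imp_bounded)
    then show "interior T \<in> lmeasurable"
      by (rule lmeasurable_open) simp
    have "T \<in> sets lebesgue"
      using closed_\<T>[OF T] by (simp add: sets_completionI_sets)
    then show "measure lebesgue (interior T) = measure lebesgue T"
      using AE_interior_convex[OF convex_\<T>[OF T]] \<open>interior T \<in> lmeasurable\<close>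
      by (intro measure_eq_AE) (auto elim: AE_mp intro: fmeasurableD)
  qed
  have int: "integrable lebesgue (\<lambda>x. indicator (interior T) x *\<^sub>R k T)" if "T \<in> \<T>" for T
    using fin[OF that] by (intro integrable_scaleR_left) (simp add: fmeasurable_def)
  then have g: "integrable lebesgue ?g"
    by (intro Bochner_Integration.integrable_sum)
  then have "integrable lebesgue (\<lambda>x. indicator \<Omega> x *\<^sub>R q x)"
    using AE borel_measurable_completion_cong_AE[OF AE] by (subst integrable_cong_AE) auto
  then show "integrable (lebesgue_on \<Omega>) q"
    by (simp only: integrable_restrict_space[OF \<Omega>_sets])
  have "(LINT x | lebesgue_on \<Omega>. q x) = integral\<^sup>L lebesgue (\<lambda>x. indicator \<Omega> x *\<^sub>R q x)"
    by (rule integral_restrict_space[OF \<Omega>_sets])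
  also have "\<dots> = integral\<^sup>L lebesgue ?g"
    using AE borel_measurable_integrable[OF g] by (rule integral_completion_cong_AE)
  also have "\<dots> = (\<Sum>T\<in>\<T>. integral\<^sup>L lebesgue (\<lambda>x. indicator (interior T) x *\<^sub>R k T))"
    using int by (rule Bochner_Integration.integral_sum)
  also have "\<dots> = (\<Sum>T\<in>\<T>. measure lebesgue T * k T)"
    using meas by (intro sum.cong refl) simp
  finally show "(LINT x | lebesgue_on \<Omega>. q x) = (\<Sum>T\<in>\<T>. measure lebesgue T * k T)" .
qed

lemma facet_measure_facts:
  assumes T: "T \<in> \<T>" and S: "S facet_of T"
  shows "S \<in> sets (side_measure S)"
    and "AE x in side_measure S. x \<in> S \<longrightarrow> x \<in> rel_interior S"
    and "continuous_on UNIV q \<Longrightarrow> set_integrable (side_measure S) S (q :: _ \<Rightarrow> real)"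
proof -
  obtain C where C: "full_simplex C" and TC: "T = convex hull C"
    by (rule obtain_vertices[OF simplex_\<T>[OF T]])
  interpret full_simplex C by (rule C)
  obtain u where u: "u \<in> C" and Su: "S = convex hull (C - {u})"
    using facets_eq S by (auto simp: TC)
  interpret simplex_facet C u
    by unfold_locales (rule u)
  show "S \<in> sets (side_measure S)"
    unfolding Su by (rule sets_side_measure[OF borel_compact[OF compact_facet]])
  show "AE x in side_measure S. x \<in> S \<longrightarrow> x \<in> rel_interior S"
    unfolding Su by (rule AE_facet_rel_interior)
  show "set_integrable (side_measure S) S q" if "continuous_on UNIV q" for q :: "_ \<Rightarrow> real"
    unfolding Su by (rule set_integral_facet(1)[OF that])
qed

text \<open>The side and its relative interior differ by a null set, so \<open>S \<inter> \<Gamma>\<close> can be replaced by \<open>S\<close>.\<close>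

lemma set_integral_side_constant:
  fixes q :: "real ^ 'n \<Rightarrow> real"
  assumes T: "T \<in> \<T>" and S: "S facet_of T" and \<Gamma>: "rel_interior S \<subseteq> \<Gamma>"
    and q: "AE x in side_measure S. x \<in> rel_interior S \<longrightarrow> q x = k"
  shows "(LINT x : S \<inter> \<Gamma> | side_measure S. q x) = measure (side_measure S) S * k"
proof -
  have "AE x in side_measure S. indicator (S \<inter> \<Gamma>) x *\<^sub>R q x = indicator S x *\<^sub>R k"
    using q facet_measure_facts(2)[OF T S]
  proof eventually_elim
    case (elim x)
    then show ?case
      using \<Gamma> rel_interior_subset[of S] by (auto simp: indicator_def)
  qed
  then have "(LINT x : S \<inter> \<Gamma> | side_measure S. q x) = integral\<^sup>L (side_measure S) (\<lambda>x. indicator S x *\<^sub>R k)"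
    unfolding set_lebesgue_integral_def using facet_measure_facts(1)[OF T S]
    unfolding hyperplane_measure_def
    by (intro integral_completion_cong_AE borel_measurable_scaleR borel_measurable_indicator) auto
  also have "\<dots> = measure (side_measure S) S * k"
    using sets.sets_into_space[OF facet_measure_facts(1)[OF T S]] by (simp add: Int_absorb2)
  finally show ?thesis .
qed

lemma set_integral_side_eq_0:
  fixes q :: "real ^ 'n \<Rightarrow> real"
  assumes T: "T \<in> \<T>" and S: "S facet_of T" and \<Gamma>: "rel_interior S \<inter> \<Gamma> = {}"
  shows "(LINT x : S \<inter> \<Gamma> | side_measure S. q x) = 0"
proof -
  have "AE x in side_measure S. indicator (S \<inter> \<Gamma>) x *\<^sub>R q x = 0"
    using facet_measure_facts(2)[OF T S]
  proof eventually_elim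
    case (elim x)
    then show ?case
      using \<Gamma> by (auto simp: indicator_def)
  qed
  then have "(LINT x : S \<inter> \<Gamma> | side_measure S. q x) = integral\<^sup>L (side_measure S) (\<lambda>x. 0)"
    unfolding set_lebesgue_integral_def hyperplane_measure_def
    by (intro integral_completion_cong_AE) auto
  then show ?thesis
    by simp
qed

lemma boundary_side_normal:
  assumes S: "S \<in> boundary_sides \<T> \<Omega>" and x: "x \<in> rel_interior S"
  obtains n where "is_outward_normal \<Omega> x n" and "is_outward_normal (element S) x n"
proof -
  have "S \<in> sides \<T>"
    using S by (simp add: boundary_sides_def)
  note E = element[OF this]
  obtain n where n: "is_outward_normal (element S) x n"
    using facet_normal[OF E] x by metis
  have "is_outward_normal \<Omega> x n"
    by (rule unshared_facet_normal(1)[OF E _ x n]) (rule boundary_side_unshared[OF S E])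
  then show thesis
    using n by (rule that)
qed

lemma boundary_side_trace:
  assumes "S \<in> boundary_sides \<T> \<Omega>" "x \<in> rel_interior S"
  shows "trace_from \<Omega> q x = trace_from (element S) q x"
  by (rule boundary_side_normal[OF assms]) (rule trace_from_cong)

lemma boundary_side_normal_trace:
  assumes "S \<in> boundary_sides \<T> \<Omega>" "x \<in> rel_interior S"
  shows "normal_trace \<Omega> y x = normal_trace (element S) y x"
proof -
  obtain n where "is_outward_normal \<Omega> x n" and "is_outward_normal (element S) x n"
    by (rule boundary_side_normal[OF assms])
  then have "outward_normal \<Omega> x = outward_normal (element S) x"
    by (simp only: outward_normal_eq)
  then show ?thesis
    unfolding normal_trace_def by (simp only: boundary_side_trace[OF assms])
qed

lemma trace_from_element:
  assumes T: "T \<in> \<T>" and x: "x \<in> T"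
    and v: "\<And>x. x \<in> interior T \<Longrightarrow> v x = c + a \<bullet> x"
  shows "trace_from T v x = c + a \<bullet> x"
  using x closure_interior_simplex(1)[OF simplex_\<T>[OF T]] v
  by (intro trace_from_eq continuous_intros) auto

text \<open>The traces are compared on the relative interior of the side only, where \<open>\<Omega>\<close> and the element look
  alike.\<close>

lemma side_average_trace_domain:
  assumes S: "S \<in> boundary_sides \<T> \<Omega>"
    and v: "\<And>x. x \<in> interior (element S) \<Longrightarrow> v x = c + a \<bullet> x"
  shows "side_average S (trace_from \<Omega> v) = side_average S (trace_from (element S) v)"
proof -
  have "S \<in> sides \<T>"
    using S by (simp add: boundary_sides_def)
  note E = element[OF this]
  have affine: "trace_from (element S) v x = c + a \<bullet> x" if "x \<in> S" for x
    using that facet_of_imp_subset[OF E(2)] by (intro trace_from_element[OF E(1) _ v]) auto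
  have "AE x in side_measure S. indicator S x *\<^sub>R trace_from \<Omega> v x = indicator S x *\<^sub>R (c + a \<bullet> x)"
    using facet_measure_facts(2)[OF E]
    by eventually_elim (auto simp: boundary_side_trace[OF S] affine indicator_def)
  moreover have "set_integrable (side_measure S) S (\<lambda>x. c + a \<bullet> x)"
    by (intro facet_measure_facts(3)[OF E] continuous_intros)
  then have "(\<lambda>x. indicator S x *\<^sub>R (c + a \<bullet> x)) \<in> borel_measurable (side_measure S)"
    unfolding set_integrable_def by (rule borel_measurable_integrable)
  ultimately have "(LINT x : S | side_measure S. trace_from \<Omega> v x) =
      (LINT x : S | side_measure S. c + a \<bullet> x)"
    unfolding set_lebesgue_integral_def hyperplane_measure_def by (rule integral_completion_cong_AE)
  then have "side_average S (trace_from \<Omega> v) = side_average S (\<lambda>x. c + a \<bullet> x)"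
    by (simp only: side_average_def)
  also have "\<dots> = side_average S (trace_from (element S) v)"
    using affine by (intro side_average_cong) simp
  finally show ?thesis .
qed

lemma side_projection_rel_interior:
  assumes S: "S \<in> boundary_sides \<T> \<Omega>" and x: "x \<in> rel_interior S"
  shows "side_projection \<T> \<Omega> q x = side_average S (trace_from \<Omega> q)"
proof -
  have "x \<notin> rel_interior S'" if "S' \<in> boundary_sides \<T> \<Omega>" "S' \<noteq> S" for S'
    using rel_interior_sides_disjoint[of S S' x] S x that by (auto simp: boundary_sides_def)
  then have "side_projection \<T> \<Omega> q x =
      (\<Sum>S'\<in>boundary_sides \<T> \<Omega>. if S' = S then side_average S (trace_from \<Omega> q) else 0)"
    unfolding side_projection_def using x by (intro sum.cong refl) (auto simp: indicator_def)
  moreover have "finite (boundary_sides \<T> \<Omega>)"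
    by (rule finite_subset[OF _ finite_sides]) (auto simp: boundary_sides_def)
  ultimately show ?thesis
    using S by simp
qed

text \<open>The element-wise Green identities are summed. On an interior side the normal components of the two
  elements are opposite by the Raviart--Thomas condition, and the averages of \<open>v\<close> agree by the
  Crouzeix--Raviart condition.\<close>

proposition discrete_integration_by_parts:
  assumes v: "v \<in> crouzeix_raviart \<T> \<Omega>" and y: "y \<in> raviart_thomas \<T> \<Omega>"
    and va: "\<And>T x. T \<in> \<T> \<Longrightarrow> x \<in> interior T \<Longrightarrow> v x = c T + a T \<bullet> x"
    and yA: "\<And>T x. T \<in> \<T> \<Longrightarrow> x \<in> interior T \<Longrightarrow> y x = p T + A T x"
    and A: "\<And>T. T \<in> \<T> \<Longrightarrow> linear (A T)"
    and nt: "\<And>S x. S \<in> boundary_sides \<T> \<Omega> \<Longrightarrow> x \<in> rel_interior S \<Longrightarrow> normal_trace \<Omega> y x = nt S"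
  shows "(\<Sum>T\<in>\<T>. measure lebesgue T *
      (element_average T y \<bullet> a T + (\<Sum>b\<in>Basis. A T b \<bullet> b) * element_average T v)) =
    (\<Sum>S\<in>boundary_sides \<T> \<Omega>.
      measure (side_measure S) S * (nt S * side_average S (trace_from \<Omega> v)))"
proof -
  define k where "k T S = (SOME t. \<forall>x\<in>rel_interior S. normal_trace T y x = t)" for T S
  have k: "normal_trace T y x = k T S" if "T \<in> \<T>" "S facet_of T" "x \<in> rel_interior S" for T S x
  proof -
    have "\<exists>t. \<forall>x\<in>rel_interior S. normal_trace T y x = t"
      using y that(1,2) unfolding raviart_thomas_def by blast
    then show ?thesis
      unfolding k_def by (rule someI2_ex) (use that(3) in blast)
  qed
  let ?Z = "\<lambda>T S. measure (side_measure S) S * (k T S * side_average S (trace_from T v))"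
  have "(\<Sum>T\<in>\<T>. measure lebesgue T *
      (element_average T y \<bullet> a T + (\<Sum>b\<in>Basis. A T b \<bullet> b) * element_average T v)) =
    (\<Sum>T\<in>\<T>. \<Sum>S | S facet_of T. ?Z T S)"
  proof (intro sum.cong refl)
    fix T assume T: "T \<in> \<T>"
    show "measure lebesgue T *
        (element_average T y \<bullet> a T + (\<Sum>b\<in>Basis. A T b \<bullet> b) * element_average T v) =
      (\<Sum>S | S facet_of T. ?Z T S)"
      using simplex_\<T>[OF T] va[OF T] yA[OF T] A[OF T] k[OF T] by (rule green_identity_element)
  qed
  also have "\<dots> = (\<Sum>S\<in>boundary_sides \<T> \<Omega>. ?Z (element S) S)"
  proof (rule sum_facets_eq_sum_boundary_sides)
    fix S T T' assume S: "S \<in> interior_sides \<T> \<Omega>" and T: "T \<in> \<T>" "T' \<in> \<T>" "T \<noteq> T'"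
      and facet: "S facet_of T" "S facet_of T'"
    obtain x where x: "x \<in> rel_interior S"
      using facet_convex_closed(3)[OF T(1) facet(1)] by blast
    have "normal_trace T y x + normal_trace T' y x = 0"
      using y S T facet x unfolding raviart_thomas_def by blast
    then have "k T' S = - k T S"
      using k[OF T(1) facet(1) x] k[OF T(2) facet(2) x] by simp
    moreover have "side_average S (trace_from T v) = side_average S (trace_from T' v)"
    proof -
      have affine: "trace_from U v x = c U + a U \<bullet> x"
        if "U \<in> \<T>" "S facet_of U" "x \<in> S" for U x
        using that facet_of_imp_subset[OF that(2)] by (intro trace_from_element va) auto
      have int: "set_integrable (side_measure S) S (\<lambda>x. c U + a U \<bullet> x)" for U
        by (intro facet_measure_facts(3)[OF T(1) facet(1)] continuous_intros)
      have "0 = side_average S (\<lambda>x. trace_from T v x - trace_from T' v x)"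
        using v S T facet unfolding crouzeix_raviart_def by simp
      also have "\<dots> = side_average S (\<lambda>x. (c T + a T \<bullet> x) - (c T' + a T' \<bullet> x))"
        using affine T facet by (intro side_average_cong) simp
      also have "\<dots> = side_average S (\<lambda>x. c T + a T \<bullet> x) - side_average S (\<lambda>x. c T' + a T' \<bullet> x)"
        unfolding side_average_def set_integral_diff(2)[OF int int] by (rule diff_divide_distrib)
      also have "side_average S (\<lambda>x. c T + a T \<bullet> x) = side_average S (trace_from T v)"
        using affine T facet by (intro side_average_cong) simp
      also have "side_average S (\<lambda>x. c T' + a T' \<bullet> x) = side_average S (trace_from T' v)"
        using affine T facet by (intro side_average_cong) simp
      finally show ?thesis
        by simp
    qed
    ultimately show "?Z T S + ?Z T' S = 0"
      by simp
  qed
  also have "\<dots> = (\<Sum>S\<in>boundary_sides \<T> \<Omega>.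
      measure (side_measure S) S * (nt S * side_average S (trace_from \<Omega> v)))"
  proof (intro sum.cong refl)
    fix S assume S: "S \<in> boundary_sides \<T> \<Omega>"
    then have "S \<in> sides \<T>"
      by (simp add: boundary_sides_def)
    note E = element[OF this]
    obtain x where x: "x \<in> rel_interior S"
      using facet_convex_closed(3)[OF E] by blast
    have "k (element S) S = nt S"
      using k[OF E x] nt[OF S x] boundary_side_normal_trace[OF S x, of y] by metis
    moreover have "side_average S (trace_from \<Omega> v) = side_average S (trace_from (element S) v)"
      by (rule side_average_trace_domain[OF S va[OF E(1)]])
    ultimately show "?Z (element S) S =
        measure (side_measure S) S * (nt S * side_average S (trace_from \<Omega> v))"
      by simp
  qed
  finally show ?thesis .
qed

end

section \<open>The primal-dual gap\<close>

text \<open>On a Dirichlet side \<open>u\<^sub>D\<close> is the side average of \<open>v\<close>, and on a Neumann side \<open>g\<close> is the normal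
  component of \<open>y\<close>. The relative interior of the side misses the other part of the boundary, so the
  other integral vanishes.\<close>

lemma (in mesh) boundary_side_terms:
  assumes S: "S \<in> boundary_sides \<T> \<Omega>"
    and part: "(S \<in> sides_on \<T> \<Omega> \<Gamma>\<^sub>D) \<noteq> (S \<in> sides_on \<T> \<Omega> \<Gamma>\<^sub>N)" and disjoint: "\<Gamma>\<^sub>D \<inter> \<Gamma>\<^sub>N = {}"
    and nt: "\<And>x. x \<in> rel_interior S \<Longrightarrow> normal_trace \<Omega> y x = t"
    and u\<^sub>D: "AE_boundary \<T> \<Omega> \<Gamma>\<^sub>D (\<lambda>x. side_projection \<T> \<Omega> v x = u\<^sub>D x)"
    and g: "AE_boundary \<T> \<Omega> \<Gamma>\<^sub>N (\<lambda>x. normal_trace \<Omega> y x = g x)"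
  shows "(LINT x : S \<inter> \<Gamma>\<^sub>N | side_measure S. g x * side_projection \<T> \<Omega> v x) +
      (LINT x : S \<inter> \<Gamma>\<^sub>D | side_measure S. normal_trace \<Omega> y x * u\<^sub>D x) =
    measure (side_measure S) S * (t * side_average S (trace_from \<Omega> v))"
proof -
  have "S \<in> sides \<T>"
    using S by (simp add: boundary_sides_def)
  note E = element[OF this]
  have avg: "side_projection \<T> \<Omega> v x = side_average S (trace_from \<Omega> v)" if "x \<in> rel_interior S" for x
    by (rule side_projection_rel_interior[OF S that])
  show ?thesis
  proof (cases "S \<in> sides_on \<T> \<Omega> \<Gamma>\<^sub>D")
    case True
    then have \<Gamma>: "rel_interior S \<subseteq> \<Gamma>\<^sub>D" "rel_interior S \<inter> \<Gamma>\<^sub>N = {}"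
      using disjoint by (auto simp: sides_on_def)
    have "AE x in side_measure S. x \<in> S \<inter> \<Gamma>\<^sub>D \<longrightarrow> side_projection \<T> \<Omega> v x = u\<^sub>D x"
      using u\<^sub>D S by (simp add: AE_boundary_def)
    then have "AE x in side_measure S. x \<in> rel_interior S \<longrightarrow>
        normal_trace \<Omega> y x * u\<^sub>D x = t * side_average S (trace_from \<Omega> v)"
    proof eventually_elim
      case (elim x)
      show ?case
      proof
        assume x: "x \<in> rel_interior S"
        then have "x \<in> S \<inter> \<Gamma>\<^sub>D"
          using \<Gamma>(1) rel_interior_subset by blast
        then have "u\<^sub>D x = side_average S (trace_from \<Omega> v)"
          using elim avg[OF x] by simp
        then show "normal_trace \<Omega> y x * u\<^sub>D x = t * side_average S (trace_from \<Omega> v)"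
          using nt[OF x] by simp
      qed
    qed
    then show ?thesis
      using set_integral_side_constant[OF E \<Gamma>(1)] set_integral_side_eq_0[OF E \<Gamma>(2)] by simp
  next
    case False
    then have "S \<in> sides_on \<T> \<Omega> \<Gamma>\<^sub>N"
      using part by blast
    then have \<Gamma>: "rel_interior S \<subseteq> \<Gamma>\<^sub>N" "rel_interior S \<inter> \<Gamma>\<^sub>D = {}"
      using disjoint by (auto simp: sides_on_def)
    have "AE x in side_measure S. x \<in> S \<inter> \<Gamma>\<^sub>N \<longrightarrow> normal_trace \<Omega> y x = g x"
      using g S by (simp add: AE_boundary_def)
    then have "AE x in side_measure S. x \<in> rel_interior S \<longrightarrow>
        g x * side_projection \<T> \<Omega> v x = t * side_average S (trace_from \<Omega> v)"
    proof eventually_elim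
      case (elim x)
      show ?case
      proof
        assume x: "x \<in> rel_interior S"
        then have "x \<in> S \<inter> \<Gamma>\<^sub>N"
          using \<Gamma>(1) rel_interior_subset by blast
        then have "g x = t"
          using elim nt[OF x] by simp
        then show "g x * side_projection \<T> \<Omega> v x = t * side_average S (trace_from \<Omega> v)"
          using avg[OF x] by simp
      qed
    qed
    then show ?thesis
      using set_integral_side_constant[OF E \<Gamma>(1)] set_integral_side_eq_0[OF E \<Gamma>(2)] by simp
  qed
qed

theorem lemma6p1:
  fixes \<Omega> \<Gamma>\<^sub>D \<Gamma>\<^sub>N :: "(real ^ 'd) set"
    and \<T> :: "(real ^ 'd) set set"
    and \<kappa> :: real
    and f g \<zeta> u\<^sub>D :: "real ^ 'd \<Rightarrow> real"
  assumes domain: "lipschitz_domain \<Omega>" "simplicial_domain \<Omega>"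
    and boundary: "frontier \<Omega> = closure \<Gamma>\<^sub>D \<union> closure \<Gamma>\<^sub>N" "\<Gamma>\<^sub>D \<inter> \<Gamma>\<^sub>N = {}"
      "openin (top_of_set (frontier \<Omega>)) \<Gamma>\<^sub>D" "openin (top_of_set (frontier \<Omega>)) \<Gamma>\<^sub>N"
      "boundary_area \<T> \<Omega> \<Gamma>\<^sub>D > 0"
    and mesh: "triangulation_of \<T> \<Omega>" "shape_regular \<kappa> \<T>"
      "\<And>S. S \<in> boundary_sides \<T> \<Omega> \<Longrightarrow>
         (S \<in> sides_on \<T> \<Omega> \<Gamma>\<^sub>D) \<noteq> (S \<in> sides_on \<T> \<Omega> \<Gamma>\<^sub>N)"
    and data: "f \<in> L0 \<T>" "g \<in> L0_sides (sides_on \<T> \<Omega> \<Gamma>\<^sub>N)"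
      "\<zeta> \<in> L0 \<T>" "essinf (lebesgue_on \<Omega>) \<zeta> > 0"
      "u\<^sub>D \<in> L0_sides (sides_on \<T> \<Omega> \<Gamma>\<^sub>D)"
      "\<exists>u \<in> crouzeix_raviart \<T> \<Omega>.
         AE_boundary \<T> \<Omega> \<Gamma>\<^sub>D (\<lambda>x. side_projection \<T> \<Omega> u x = u\<^sub>D x) \<and>
         Linf_norm (lebesgue_on \<Omega>) (\<lambda>x. gradient_h \<T> u x /\<^sub>R \<zeta> x) < 1"
  shows "\<forall>v \<in> K_cr \<T> \<Omega> \<Gamma>\<^sub>D \<zeta> u\<^sub>D. \<forall>y \<in> K_rt \<T> \<Omega> \<Gamma>\<^sub>N f g.
    gap_estimator_squared \<T> \<Omega> \<Gamma>\<^sub>D \<Gamma>\<^sub>N f g \<zeta> u\<^sub>D v y =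
    ereal_integral (lebesgue_on \<Omega>) (\<lambda>x.
      ereal (\<phi>\<^sub>h_star \<zeta> x (element_projection \<T> y x))
      - ereal (element_projection \<T> y x \<bullet> gradient_h \<T> v x)
      + \<phi>\<^sub>h \<zeta> x (gradient_h \<T> v x))"
proof (intro ballI)
  fix v y assume vK: "v \<in> K_cr \<T> \<Omega> \<Gamma>\<^sub>D \<zeta> u\<^sub>D" and yK: "y \<in> K_rt \<T> \<Omega> \<Gamma>\<^sub>N f g"
  interpret mesh \<Omega> \<T>
    by unfold_locales (rule domain(1) mesh(1))+
  have v: "v \<in> crouzeix_raviart \<T> \<Omega>"
    and v_\<zeta>: "AE x in lebesgue_on \<Omega>. norm (gradient_h \<T> v x) \<le> \<zeta> x"
    and v_u\<^sub>D: "AE_boundary \<T> \<Omega> \<Gamma>\<^sub>D (\<lambda>x. side_projection \<T> \<Omega> v x = u\<^sub>D x)"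
    using vK by (simp_all add: K_cr_def)
  have y: "y \<in> raviart_thomas \<T> \<Omega>"
    and y_f: "AE x in lebesgue_on \<Omega>. divergence y x = - f x"
    and y_g: "AE_boundary \<T> \<Omega> \<Gamma>\<^sub>N (\<lambda>x. normal_trace \<Omega> y x = g x)"
    using yK by (simp_all add: K_rt_def)
  have "\<forall>T\<in>\<T>. \<exists>ca. \<forall>x\<in>interior T. v x = fst ca + snd ca \<bullet> x"
    using v by (simp add: crouzeix_raviart_def L1_def)
  then obtain ca where "\<forall>T\<in>\<T>. \<forall>x\<in>interior T. v x = fst (ca T) + snd (ca T) \<bullet> x"
    by (rule bchoice[THEN exE])
  then obtain c a where va: "\<And>T x. T \<in> \<T> \<Longrightarrow> x \<in> interior T \<Longrightarrow> v x = c T + a T \<bullet> x"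
    by (intro that[of "\<lambda>T. fst (ca T)" "\<lambda>T. snd (ca T)"]) blast
  have "\<exists>pA. linear (snd pA) \<and> (\<forall>x\<in>interior T. y x = fst pA + snd pA x)" if T: "T \<in> \<T>" for T
  proof -
    have "\<exists>c a. \<forall>x\<in>interior T. y x \<bullet> b = c + a \<bullet> x" if "b \<in> Basis" for b
      using y that T by (simp add: raviart_thomas_def L1_def)
    then have "\<exists>p A. linear A \<and> (\<forall>x\<in>interior T. y x = p + A x)"
      by (rule affine_if_components_affine)
    then show ?thesis
      by simp
  qed
  then have "\<forall>T\<in>\<T>. \<exists>pA. linear (snd pA) \<and> (\<forall>x\<in>interior T. y x = fst pA + snd pA x)"
    by blast
  then obtain pA where "\<forall>T\<in>\<T>. linear (snd (pA T)) \<and> (\<forall>x\<in>interior T. y x = fst (pA T) + snd (pA T) x)"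
    by (rule bchoice[THEN exE])
  then obtain p A where yA: "\<And>T x. T \<in> \<T> \<Longrightarrow> x \<in> interior T \<Longrightarrow> y x = p T + A T x"
    and A: "\<And>T. T \<in> \<T> \<Longrightarrow> linear (A T)"
    by (intro that[of "\<lambda>T. fst (pA T)" "\<lambda>T. snd (pA T)"]) blast+
  obtain \<phi> where \<phi>: "\<And>T x. T \<in> \<T> \<Longrightarrow> x \<in> interior T \<Longrightarrow> f x = \<phi> T"
    using data(1) bchoice[of \<T> "\<lambda>T c. \<forall>x\<in>interior T. f x = c"] unfolding L0_def by blast
  obtain z where z: "\<And>T x. T \<in> \<T> \<Longrightarrow> x \<in> interior T \<Longrightarrow> \<zeta> x = z T"
    using data(3) bchoice[of \<T> "\<lambda>T c. \<forall>x\<in>interior T. \<zeta> x = c"] unfolding L0_def by blast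
  let ?M = "\<lambda>T. measure lebesgue T"
  let ?y = "\<lambda>T. element_average T y" and ?v = "\<lambda>T. element_average T v"
  have grad: "gradient_h \<T> v x = a T" if "T \<in> \<T>" "x \<in> interior T" for T x
    using gradient_h_interior[OF that] gradient_affine[OF that(2) va[OF that(1)]] by simp
  have div: "(\<Sum>b\<in>Basis. A T b \<bullet> b) = - \<phi> T" if T: "T \<in> \<T>" for T
  proof -
    obtain x where x: "x \<in> interior T" "divergence y x = - f x"
      using AE_imp_ex_interior[OF y_f T] by blast
    then show ?thesis
      using divergence_affine[OF x(1) yA[OF T] A[OF T]] \<phi>[OF T x(1)] by simp
  qed
  have a_le: "norm (a T) \<le> z T" if T: "T \<in> \<T>" for T
  proof -
    obtain x where x: "x \<in> interior T" "norm (gradient_h \<T> v x) \<le> \<zeta> x"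
      using AE_imp_ex_interior[OF v_\<zeta> T] by blast
    then show ?thesis
      using grad[OF T x(1)] z[OF T x(1)] by simp
  qed
  define star where "star T = (if norm (?y T) \<le> z T then 1 / 2 * (norm (?y T))\<^sup>2
      else z T * norm (?y T) - 1 / 2 * (z T)\<^sup>2)" for T
  have star: "\<phi>\<^sub>h_star \<zeta> x (element_projection \<T> y x) = star T" if "T \<in> \<T>" "x \<in> interior T" for T x
    by (simp only: \<phi>\<^sub>h_star_def star_def element_projection_interior[OF that] z[OF that])
  define nt where "nt S = (SOME t. \<forall>x\<in>rel_interior S. normal_trace \<Omega> y x = t)" for S
  have nt: "normal_trace \<Omega> y x = nt S" if S: "S \<in> boundary_sides \<T> \<Omega>" and x: "x \<in> rel_interior S" for S x
  proof -
    have E: "element S \<in> \<T>" "S facet_of element S"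
      using S element[of S] by (simp_all add: boundary_sides_def)
    then have "\<exists>t. \<forall>x\<in>rel_interior S. normal_trace (element S) y x = t"
      using y by (simp add: raviart_thomas_def)
    then obtain t where "\<forall>x\<in>rel_interior S. normal_trace (element S) y x = t" ..
    then have "\<forall>x\<in>rel_interior S. normal_trace \<Omega> y x = t"
      using boundary_side_normal_trace[OF S] by simp
    then have "\<forall>x\<in>rel_interior S. normal_trace \<Omega> y x = nt S"
      unfolding nt_def by (rule someI[where P = "\<lambda>t. \<forall>x\<in>rel_interior S. normal_trace \<Omega> y x = t"])
    then show ?thesis
      using x by blast
  qed
  let ?N = "boundary_integral \<T> \<Omega> \<Gamma>\<^sub>N (\<lambda>x. g x * side_projection \<T> \<Omega> v x)"
  let ?D = "boundary_integral \<T> \<Omega> \<Gamma>\<^sub>D (\<lambda>x. normal_trace \<Omega> y x * u\<^sub>D x)"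
  have "?N + ?D = (\<Sum>S\<in>boundary_sides \<T> \<Omega>.
      measure (side_measure S) S * (nt S * side_average S (trace_from \<Omega> v)))"
    unfolding boundary_integral_def sum.distrib[symmetric]
    by (intro sum.cong refl boundary_side_terms mesh(3) boundary(2) v_u\<^sub>D y_g nt)
  also have "\<dots> = (\<Sum>T\<in>\<T>. ?M T * (?y T \<bullet> a T + (\<Sum>b\<in>Basis. A T b \<bullet> b) * ?v T))"
    by (rule discrete_integration_by_parts[OF v y va yA A nt, symmetric])
  also have "\<dots> = (\<Sum>T\<in>\<T>. ?M T * (?y T \<bullet> a T)) - (\<Sum>T\<in>\<T>. ?M T * (\<phi> T * ?v T))"
    unfolding sum_subtractf[symmetric]
    by (intro sum.cong refl) (simp add: div right_diff_distrib)
  finally have parts: "?N + ?D =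
    (\<Sum>T\<in>\<T>. ?M T * (?y T \<bullet> a T)) - (\<Sum>T\<in>\<T>. ?M T * (\<phi> T * ?v T))" .
  have "(LINT x | lebesgue_on \<Omega>. (norm (gradient_h \<T> v x))\<^sup>2) = (\<Sum>T\<in>\<T>. ?M T * (norm (a T))\<^sup>2)"
    by (rule integral_elementwise_constant) (simp only: grad)
  moreover have "(LINT x | lebesgue_on \<Omega>. f x * element_projection \<T> v x) =
      (\<Sum>T\<in>\<T>. ?M T * (\<phi> T * ?v T))"
    by (rule integral_elementwise_constant) (simp only: \<phi> element_projection_interior)
  ultimately have I: "I_cr \<T> \<Omega> \<Gamma>\<^sub>D \<Gamma>\<^sub>N f g \<zeta> u\<^sub>D v =
      ereal (1 / 2 * (\<Sum>T\<in>\<T>. ?M T * (norm (a T))\<^sup>2) - (\<Sum>T\<in>\<T>. ?M T * (\<phi> T * ?v T)) - ?N)"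
    using vK by (simp only: I_cr_def if_True)
  have "(LINT x | lebesgue_on \<Omega>. \<phi>\<^sub>h_star \<zeta> x (element_projection \<T> y x)) = (\<Sum>T\<in>\<T>. ?M T * star T)"
    by (rule integral_elementwise_constant) (rule star)
  then have D: "D_rt \<T> \<Omega> \<Gamma>\<^sub>D \<Gamma>\<^sub>N f g \<zeta> u\<^sub>D y = ereal (- (\<Sum>T\<in>\<T>. ?M T * star T) + ?D)"
    using yK by (simp only: D_rt_def if_True)
  let ?k = "\<lambda>T. star T - ?y T \<bullet> a T + 1 / 2 * (norm (a T))\<^sup>2"
  let ?F = "\<lambda>x. ereal (\<phi>\<^sub>h_star \<zeta> x (element_projection \<T> y x))
      - ereal (element_projection \<T> y x \<bullet> gradient_h \<T> v x) + \<phi>\<^sub>h \<zeta> x (gradient_h \<T> v x)"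
  \<comment> \<open>\<open>\<phi>\<^sub>h\<close> takes its finite value, since \<open>norm (a T) \<le> z T\<close>\<close>
  have F: "?F x = ereal (?k T)" if "T \<in> \<T>" "x \<in> interior T" for T x
    using a_le[OF that(1)]
    unfolding star[OF that]
    unfolding element_projection_interior[OF that] grad[OF that] \<phi>\<^sub>h_def z[OF that]
    by simp
  then have F': "real_of_ereal (?F x) = ?k T" if "T \<in> \<T>" "x \<in> interior T" for T x
    using that by simp
  have "AE x in lebesgue_on \<Omega>. ?F x = ereal (real_of_ereal (?F x))"
    unfolding AE_lebesgue_on_\<Omega> using AE_element_interiors
  proof eventually_elim
    case (elim x)
    show ?case
    proof
      assume "x \<in> \<Omega>"
      then obtain T where T: "T \<in> \<T>" "x \<in> interior T"
        using elim by blast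
      show "?F x = ereal (real_of_ereal (?F x))"
        unfolding F[OF T] by simp
    qed
  qed
  then have "ereal_integral (lebesgue_on \<Omega>) ?F = ereal (\<Sum>T\<in>\<T>. ?M T * ?k T)"
    using integrable_elementwise_constant[OF F'] integral_elementwise_constant[OF F']
    by (subst ereal_integral_eq) simp_all
  also have "(\<Sum>T\<in>\<T>. ?M T * ?k T) =
      (\<Sum>T\<in>\<T>. ?M T * star T) - (\<Sum>T\<in>\<T>. ?M T * (?y T \<bullet> a T)) +
      1 / 2 * (\<Sum>T\<in>\<T>. ?M T * (norm (a T))\<^sup>2)"
    unfolding sum_distrib_left sum_subtractf[symmetric] sum.distrib[symmetric]
    by (intro sum.cong refl) (simp add: algebra_simps)
  also have "ereal \<dots> = I_cr \<T> \<Omega> \<Gamma>\<^sub>D \<Gamma>\<^sub>N f g \<zeta> u\<^sub>D v - D_rt \<T> \<Omega> \<Gamma>\<^sub>D \<Gamma>\<^sub>N f g \<zeta> u\<^sub>D y"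
    unfolding I D using parts by simp
  finally show "gap_estimator_squared \<T> \<Omega> \<Gamma>\<^sub>D \<Gamma>\<^sub>N f g \<zeta> u\<^sub>D v y = ereal_integral (lebesgue_on \<Omega>) ?F"
    by (simp only: gap_estimator_squared_def)
qed

end
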